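(* Let $G$ be a locally compact group with left invariant Haar measure $\mu$, let $B$ be a Banach space, let $1 \le p < \infty$, and let $p'$ be the conjugate exponent of $p$. Let $\Gamma$ be a bounded subset of the Bochner space $L^p(G;B)$. Then $\Gamma$ is relatively norm compact in $L^p(G;B)$ if and only if condition (1) holds and one of the conditions (2a), (2b) holds, where: (1) for any (measurable) $A \subseteq G$ with $\mu(A) < \infty$, the set $\left\{\int_A f^-(y)\,d\mu(y) : f \in \Gamma\right\} \subseteq B$ is relatively norm compact in $B$; (2a) for any $\epsilon > 0$ there exist a compact set $S \subseteq G$ and a function $j \in L^{p'}(G)$, where $j$ has compact support if either $G$ is nonabelian or $p = 1$, such that for all $f \in \Gamma$, $\|f\|_{p;\,G\setminus S} < \epsilon$, and for all $f \in \Gamma$, $\|f - j * f\|_{p;\,S} < \epsilon$; (2b) for any $\epsilon > 0$ there exist a compact set $S \subseteq G$ and a neighborhood $\Theta$ of the identity of $G$ such that for all $f \in \Gamma$, $\|f\|_{p;\,G\setminus S} < \epsilon$, and for all $f \in \Gamma$ and all $h \in \Theta$, $\|T^h f - f\|_{p;\,S} < \epsilon$.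
   Context: $L^p(G;B)$ is the Bochner space of (classes of) $\mu$-measurable functions $f : G \to B$ with $\|f(\cdot)\|_B^p \in L^1(G)$, where $\|\cdot\|_B$ is the norm of $B$; $L^{r}(G)$ denotes the usual Lebesgue space of complex-valued functions on $G$ with respect to $\mu$. The conjugate exponent satisfies $1/p + 1/p' = 1$, with $p' = \infty$ when $p = 1$. All $B$-valued integrals are Bochner integrals with respect to $\mu$. For measurable $A \subseteq G$, $\|f\|_{p;A} = \left(\int_A \|f(x)\|_B^p \, d\mu(x)\right)^{1/p}$. For $f : G \to B$, $f^-$ is the function $f^-(x) = f(x^{-1})$. For $h \in G$, $T^h$ is the translation operator $(T^h f)(x) = f(h^{-1}x)$. For $j \in L^{p'}(G)$ (with compact support if $G$ is nonabelian or $p=1$) and $f \in L^p(G;B)$, the convolution is $(j*f)(x) = \int_G j(xy)\, f(y^{-1})\,d\mu(y) = \int_G j(y)\, f(y^{-1}x)\, d\mu(y)$. "Relatively norm compact" means having compact closure in the norm topology.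
   Formalization: In (1), A ranges only over sets of finite measure on which g^- is Bochner integrable for every g in L^p(G;B); this is automatic for unimodular G, but without it the necessity of (1) fails for some nonunimodular groups. *)

theory Defs
  imports "HOL-Analysis.Analysis"
begin

section \<open>Complex Banach spaces\<close>

text \<open>
  The library only has real Banach spaces, whereas convolution with a complex-valued
  function needs complex scalars.
\<close>

class complex_normed_vector = real_normed_vector +
  fixes scaleC :: "complex \<Rightarrow> 'a \<Rightarrow> 'a"  (infixr "*\<^sub>C" 75)
  assumes scaleC_add_right: "a *\<^sub>C (x + y) = a *\<^sub>C x + a *\<^sub>C y"
    and scaleC_add_left: "(a + b) *\<^sub>C x = a *\<^sub>C x + b *\<^sub>C x"
    and scaleC_scaleC: "a *\<^sub>C b *\<^sub>C x = (a * b) *\<^sub>C x"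
    and scaleC_of_real: "complex_of_real r *\<^sub>C x = r *\<^sub>R x"
    and norm_scaleC: "norm (a *\<^sub>C x) = cmod a * norm x"

class complex_banach = complex_normed_vector + banach

instantiation complex :: complex_banach
begin

definition scaleC_complex :: "complex \<Rightarrow> complex \<Rightarrow> complex"
  where "scaleC_complex a x = a * x"

instance
  by standard (auto simp: scaleC_complex_def algebra_simps norm_mult scaleR_conv_of_real)

end


section \<open>Haar measure\<close>

text \<open>
  The group is a type of class \<open>topological_group_add\<close>: the operation is written additively
  but is not assumed commutative, so \<open>x + y\<close> is the product, \<open>- x\<close> the inverse and
  \<open>0\<close> the identity.  A left Haar measure is a nonzero left invariant Radon measure on the
  Borel sets, with the usual regularity convention for groups that need not be
  \<open>\<sigma>\<close>-compact: outer regular on Borel sets, inner regular on open sets.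
\<close>

definition left_haar_measure :: "'g::{topological_group_add, t2_space} measure \<Rightarrow> bool" where
  "left_haar_measure \<mu> \<longleftrightarrow>
     sets \<mu> = sets borel \<and>
     emeasure \<mu> UNIV \<noteq> 0 \<and>
     (\<forall>h. \<forall>A\<in>sets borel. emeasure \<mu> ((+) h ` A) = emeasure \<mu> A) \<and>
     (\<forall>K. compact K \<longrightarrow> emeasure \<mu> K < \<infinity>) \<and>
     (\<forall>A\<in>sets borel. emeasure \<mu> A = (INF U\<in>{U. open U \<and> A \<subseteq> U}. emeasure \<mu> U)) \<and>
     (\<forall>U. open U \<longrightarrow> emeasure \<mu> U = (SUP K\<in>{K. compact K \<and> K \<subseteq> U}. emeasure \<mu> K))"


section \<open>The Bochner integral in arbitrary Banach spaces\<close>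

text \<open>
  The library's \<open>has_bochner_integral\<close> is restricted to second countable target spaces.  The
  definitions below follow it, with Borel measurability replaced by strong measurability
  (almost everywhere limit of simple functions).  A strongly measurable function is in general
  only measurable with respect to the completion of \<open>M\<close>; this is harmless for the
  nonnegative integrals below, since \<open>nn_integral\<close> does not change when \<open>M\<close> is
  replaced by its completion (\<open>nn_integral_completion\<close>).
\<close>

definition strongly_measurable :: "'a measure \<Rightarrow> ('a \<Rightarrow> 'b::real_normed_vector) \<Rightarrow> bool" where
  "strongly_measurable M f \<longleftrightarrow>
     (\<exists>s :: nat \<Rightarrow> 'a \<Rightarrow> 'b. (\<forall>i. simple_function M (s i)) \<and> (AE x in M. (\<lambda>i. s i x) \<longlonglongrightarrow> f x))"

definition has_bochner_int :: "'a measure \<Rightarrow> ('a \<Rightarrow> 'b::real_normed_vector) \<Rightarrow> 'b \<Rightarrow> bool" where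
  "has_bochner_int M f I \<longleftrightarrow>
     strongly_measurable M f \<and>
     (\<exists>s. (\<forall>i. Bochner_Integration.simple_bochner_integrable M (s i)) \<and>
          (\<lambda>i. \<integral>\<^sup>+x. ennreal (norm (f x - s i x)) \<partial>M) \<longlonglongrightarrow> 0 \<and>
          (\<lambda>i. Bochner_Integration.simple_bochner_integral M (s i)) \<longlonglongrightarrow> I)"

definition bochner_integrable_on ::
    "'a measure \<Rightarrow> 'a set \<Rightarrow> ('a \<Rightarrow> 'b::real_normed_vector) \<Rightarrow> bool" where
  "bochner_integrable_on M A f \<longleftrightarrow> (\<exists>I. has_bochner_int M (\<lambda>x. indicator A x *\<^sub>R f x) I)"

definition bochner_integral_on ::
    "'a measure \<Rightarrow> 'a set \<Rightarrow> ('a \<Rightarrow> 'b::real_normed_vector) \<Rightarrow> 'b" where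
  "bochner_integral_on M A f =
     (if bochner_integrable_on M A f
      then THE I. has_bochner_int M (\<lambda>x. indicator A x *\<^sub>R f x) I else 0)"


section \<open>Bochner spaces\<close>

definition Lp_norm_on :: "real \<Rightarrow> 'a measure \<Rightarrow> 'a set \<Rightarrow> ('a \<Rightarrow> 'b::real_normed_vector) \<Rightarrow> ennreal"
  where
  "Lp_norm_on p M A f =
     (let I = \<integral>\<^sup>+x\<in>A. ennreal (norm (f x) powr p) \<partial>M
      in if I = \<infinity> then \<infinity> else ennreal (enn2real I powr (1 / p)))"

definition Lp_functions :: "ennreal \<Rightarrow> 'a measure \<Rightarrow> ('a \<Rightarrow> 'b::real_normed_vector) set" where
  "Lp_functions q M =
     {f. strongly_measurable M f \<and>
         (if q = \<infinity> then \<exists>C. AE x in M. norm (f x) \<le> C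
          else Lp_norm_on (enn2real q) M (space M) f < \<infinity>)}"

definition Lp_space :: "real \<Rightarrow> 'a measure \<Rightarrow> ('a \<Rightarrow> 'b::real_normed_vector) set set" where
  "Lp_space p M =
     Lp_functions (ennreal p) M //
       {(f, g). f \<in> Lp_functions (ennreal p) M \<and> g \<in> Lp_functions (ennreal p) M \<and>
                (AE x in M. f x = g x)}"

text \<open>The value of the distance does not depend on the chosen representatives.\<close>

definition Lp_dist ::
    "real \<Rightarrow> 'a measure \<Rightarrow> ('a \<Rightarrow> 'b::real_normed_vector) set \<Rightarrow> ('a \<Rightarrow> 'b) set \<Rightarrow> real" where
  "Lp_dist p M F G =
     enn2real (Lp_norm_on p M (space M) (\<lambda>x. (SOME f. f \<in> F) x - (SOME g. g \<in> G) x))"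

definition Lp_topology :: "real \<Rightarrow> 'a measure \<Rightarrow> ('a \<Rightarrow> 'b::real_normed_vector) set topology" where
  "Lp_topology p M = Metric_space.mtopology (Lp_space p M) (Lp_dist p M)"


section \<open>Translation and convolution\<close>

definition translate :: "'g::group_add \<Rightarrow> ('g \<Rightarrow> 'b) \<Rightarrow> 'g \<Rightarrow> 'b" where
  "translate h f = (\<lambda>x. f (- h + x))"

definition convolve ::
    "'g::group_add measure \<Rightarrow> ('g \<Rightarrow> complex) \<Rightarrow> ('g \<Rightarrow> 'b::complex_normed_vector) \<Rightarrow> 'g \<Rightarrow> 'b" where
  "convolve \<mu> j f = (\<lambda>x. bochner_integral_on \<mu> UNIV (\<lambda>y. j (x + y) *\<^sub>C f (- y)))"

text \<open>
  Pitfall with the averages of \<open>\<lambda>y. f (- y)\<close> over a set \<open>A\<close> of finite measure: if the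
  group is unimodular, this function is integrable on \<open>A\<close> for every \<open>f\<close> in \<open>L\<^sup>p\<close>, but
  otherwise it need not be, because reflection changes Haar measure by the modular function, which
  may be unbounded on \<open>A\<close>.  Statements about such averages must therefore restrict to sets
  \<open>A\<close> on which they exist for all of \<open>L\<^sup>p\<close>; these include all relatively compact Borel sets.
\<close>

end

theory Submission
  imports Defs
begin

text \<open>
  In the complete metric space \<open>L\<^sup>p\<close>, relative compactness is total boundedness.  A finite net transfers
  the smallness of tails and the continuity of translations from single functions to \<open>\<Gamma>\<close>, which gives
  (2b); it also gives (1), since an average which exists on all of \<open>L\<^sup>p\<close> is automatically bounded.
  Conversely, (2b) yields (2a) for a continuous bump \<open>j\<close> near the identity, and the kernel in (2a) may be
  replaced with a continuous one of compact support.  On the compact set \<open>S\<close> such a convolution is a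
  uniform limit of operators \<open>f \<mapsto> \<Sum>i. 1\<^bsub>Q i\<^esub> (\<Sum>l. c i l \<integral>\<^bsub>R l\<^esub> f\<^sup>-)\<close>, which by (1) map \<open>\<Gamma>\<close> to a totally bounded set.
  The Borel sets of \<open>G \<times> G\<close> need not be generated by rectangles, so Fubini's theorem is replaced throughout
  by finite partitions into small pieces.
\<close>


section \<open>Strong measurability\<close>

text \<open>Two features shape the estimates. \<open>G\<close> need not be unimodular, so reflection
  is controlled only locally: \<open>reflection_bound A C\<close> says that reflection on
  \<open>A\<close> costs at most a factor \<open>C\<close>, which is available for compact
  \<open>A\<close>, and for \<open>A = UNIV\<close> if \<open>G\<close> is abelian. When
  \<open>x\<close> ranges over a compact set and \<open>x + y\<close> over the compact support of a
  kernel, \<open>y\<close> stays in a compact set; this is what the compact support in (2a)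
  provides. In the abelian case with \<open>p > 1\<close> the global bound takes over. For
  \<open>p = 1\<close> the kernel lies in an \<open>L\<^sup>\<infinity>\<close> space, where
  continuous functions are not dense; its compact support puts it into \<open>L\<^sup>1\<close> as
  well, and the error of replacing it is small in \<open>L\<^sup>1(S)\<close> rather than uniformly.
  The space \<open>B\<close> need not be separable, so norms of strongly measurable functions are
  treated as measurable for \<open>completion \<mu>\<close>. Convolutions with a general kernel are
  not known to be measurable, and errors are estimated through measurable majorants.\<close>

lemma bounded_bilinear_scaleC: "bounded_bilinear (scaleC :: complex \<Rightarrow> 'b::complex_normed_vector \<Rightarrow> 'b)"
proof
  fix r :: real and a :: complex and b :: 'b
  show "(r *\<^sub>R a) *\<^sub>C b = r *\<^sub>R (a *\<^sub>C b)"
    by (simp add: scaleR_conv_of_real flip: scaleC_of_real scaleC_scaleC)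
  show "a *\<^sub>C (r *\<^sub>R b) = r *\<^sub>R (a *\<^sub>C b)"
    by (simp add: scaleC_scaleC mult.commute flip: scaleC_of_real)
  show "\<exists>K. \<forall>a (b::'b). norm (a *\<^sub>C b) \<le> norm a * norm b * K"
    by (rule exI[of _ 1]) (simp add: norm_scaleC)
qed (simp_all add: scaleC_add_left scaleC_add_right)

interpretation scaleC: bounded_bilinear "scaleC :: complex \<Rightarrow> 'b::complex_normed_vector \<Rightarrow> 'b"
  by (rule bounded_bilinear_scaleC)

lemma strongly_measurable_simple: "simple_function M f \<Longrightarrow> strongly_measurable M f"
  unfolding strongly_measurable_def by (intro exI[of _ "\<lambda>_. f"]) auto

lemma strongly_measurable_cong_AE:
  "strongly_measurable M f \<Longrightarrow> AE x in M. f x = g x \<Longrightarrow> strongly_measurable M g"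
  unfolding strongly_measurable_def
  by (elim exE conjE, intro exI conjI, assumption) (auto elim!: AE_mp)

text \<open>Simple approximants may be combined pointwise, so every sequentially continuous
  operation of two arguments preserves strong measurability; most closure rules below are
  instances.\<close>

lemma strongly_measurable_compose2:
  assumes f: "strongly_measurable M f" and g: "strongly_measurable M g"
    and H: "\<And>s t x y. s \<longlonglongrightarrow> x \<Longrightarrow> t \<longlonglongrightarrow> y \<Longrightarrow> (\<lambda>i::nat. H (s i) (t i)) \<longlonglongrightarrow> H x y"
  shows "strongly_measurable M (\<lambda>x. H (f x) (g x))"
proof -
  obtain s where s: "\<And>i. simple_function M (s i)" "AE x in M. (\<lambda>i. s i x) \<longlonglongrightarrow> f x"
    using f unfolding strongly_measurable_def by auto
  obtain t where t: "\<And>i. simple_function M (t i)" "AE x in M. (\<lambda>i. t i x) \<longlonglongrightarrow> g x"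
    using g unfolding strongly_measurable_def by auto
  show ?thesis unfolding strongly_measurable_def
  proof (intro exI conjI allI)
    show "simple_function M (\<lambda>x. H (s i x) (t i x))" for i
      by (rule simple_function_compose2[OF s(1) t(1)])
    show "AE x in M. (\<lambda>i. H (s i x) (t i x)) \<longlonglongrightarrow> H (f x) (g x)"
      using s(2) t(2) by eventually_elim (rule H)
  qed
qed

lemma strongly_measurable_const: "strongly_measurable M (\<lambda>x. c)"
  by (intro strongly_measurable_simple) simp

lemma strongly_measurable_add:
  "strongly_measurable M f \<Longrightarrow> strongly_measurable M g \<Longrightarrow> strongly_measurable M (\<lambda>x. f x + g x)"
  by (erule strongly_measurable_compose2[where H="(+)"]) (auto intro: tendsto_add)

lemma strongly_measurable_diff:
  "strongly_measurable M f \<Longrightarrow> strongly_measurable M g \<Longrightarrow> strongly_measurable M (\<lambda>x. f x - g x)"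
  by (erule strongly_measurable_compose2[where H="(-)"]) (auto intro: tendsto_diff)

lemma strongly_measurable_scaleR:
  "strongly_measurable M f \<Longrightarrow> strongly_measurable M g \<Longrightarrow> strongly_measurable M (\<lambda>x. f x *\<^sub>R g x)"
  by (erule strongly_measurable_compose2[where H="(*\<^sub>R)"]) (auto intro: tendsto_scaleR)

lemma strongly_measurable_scaleC:
  "strongly_measurable M f \<Longrightarrow> strongly_measurable M g \<Longrightarrow> strongly_measurable M (\<lambda>x. f x *\<^sub>C g x)"
  by (erule strongly_measurable_compose2[where H="(*\<^sub>C)"]) (auto intro: scaleC.tendsto)

lemma strongly_measurable_norm:
  "strongly_measurable M f \<Longrightarrow> strongly_measurable M (\<lambda>x. norm (f x))"
  using strongly_measurable_compose2[where H="\<lambda>x y. norm x" and g=f and f=f and M=M]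
  by (auto intro: tendsto_norm)

lemma strongly_measurable_sum:
  "(\<And>i. i \<in> I \<Longrightarrow> strongly_measurable M (f i)) \<Longrightarrow> strongly_measurable M (\<lambda>x. \<Sum>i\<in>I. f i x)"
  by (induction I rule: infinite_finite_induct)
    (auto intro: strongly_measurable_add strongly_measurable_const)

lemma strongly_measurable_bounded_linear:
  assumes "bounded_linear T" "strongly_measurable M f"
  shows "strongly_measurable M (\<lambda>x. T (f x))"
  using strongly_measurable_compose2[OF assms(2,2), where H="\<lambda>x y. T x"]
    bounded_linear.tendsto[OF assms(1)] by auto

lemma strongly_measurable_indicator:
  "A \<in> sets M \<Longrightarrow> strongly_measurable M (indicator A :: _ \<Rightarrow> real)"
  by (intro strongly_measurable_simple) simp

section \<open>Strong measurability compared with measurability for the completion\<close>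

lemma strongly_measurable_borel:
  fixes f :: "'a \<Rightarrow> 'b::{real_normed_vector, second_countable_topology}"
  assumes "f \<in> borel_measurable M"
  shows "strongly_measurable M f"
  using borel_measurable_implies_sequence_metric[OF assms, of 0] unfolding strongly_measurable_def
    by blast

text \<open>The set where the two functions differ is null for the completion, in which every subset
  of a null set is measurable; preimages therefore change only by measurable sets.\<close>

lemma measurable_completion_cong_AE:
  assumes f: "f \<in> measurable (completion M) N" and eq: "AE x in M. f x = g x"
    and g: "g \<in> space M \<rightarrow> space N"
  shows "g \<in> measurable (completion M) N"
proof (rule measurableI)
  show "x \<in> space (completion M) \<Longrightarrow> g x \<in> space N" for x using g by auto
  fix A assume A: "A \<in> sets N"
  have d: "{x \<in> space M. f x \<noteq> g x} \<in> sets (completion M)" "AE x in completion M. f x = g x"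
    using sets_completion_AE[where P="\<lambda>x. f x \<noteq> g x" and M=M] eq AE_completion by (auto simp: pred_def)
  then have n: "{x \<in> space M. f x \<noteq> g x} \<in> null_sets (completion M)"
    by (subst (asm) AE_iff_null) auto

  have "g -` A \<inter> space M =
    (f -` A \<inter> space M - {x \<in> space M. f x \<noteq> g x}) \<union> (g -` A \<inter> {x \<in> space M. f x \<noteq> g x})"
    by auto
  moreover have "g -` A \<inter> {x \<in> space M. f x \<noteq> g x} \<in> null_sets (completion M)"
    by (rule completion.complete2[OF _ n]) auto
  ultimately show "g -` A \<inter> space (completion M) \<in> sets (completion M)"
    using measurable_sets[OF f A] d(1) by auto
qed

lemma strongly_measurable_imp_borel_AE:
  fixes f :: "'a \<Rightarrow> real"
  assumes "strongly_measurable M f"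
  obtains f' where "f' \<in> borel_measurable M" "AE x in M. f x = f' x"
proof -
  obtain s where s: "\<And>i. simple_function M (s i)" "AE x in M. (\<lambda>i. s i x) \<longlonglongrightarrow> f x"
    using assms unfolding strongly_measurable_def by auto
  from s(2) obtain N where N: "N \<in> null_sets M" "{x \<in> space M. \<not> (\<lambda>i. s i x) \<longlonglongrightarrow> f x} \<subseteq> N"
    unfolding eventually_ae_filter by auto
  \<comment> \<open>Setting the function and its approximants to 0 on a null set turns convergence
    almost everywhere into convergence everywhere, so the limit is Borel measurable.\<close>
  let ?f = "\<lambda>x. if x \<in> N then 0 else f x"
  have "?f \<in> borel_measurable M"
  proof (rule borel_measurable_LIMSEQ_metric)
    show "(\<lambda>x. if x \<in> N then 0 else s i x) \<in> borel_measurable M" for i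
      using N(1) borel_measurable_simple_function[OF s(1)[of i]] by (intro measurable_If_set) auto
    show "(\<lambda>i. if x \<in> N then 0 else s i x) \<longlonglongrightarrow> ?f x" if "x \<in> space M" for x
      using N(2) that by auto
  qed
  moreover have "AE x in M. f x = ?f x" using AE_not_in[OF N(1)] by eventually_elim auto
  ultimately show thesis by (rule that)
qed

lemma strongly_measurable_imp_completion:
  fixes f :: "'a \<Rightarrow> real"
  assumes "strongly_measurable M f"
  shows "f \<in> borel_measurable (completion M)"
proof -
  obtain f' where f': "f' \<in> borel_measurable M" "AE x in M. f x = f' x"
    using strongly_measurable_imp_borel_AE[OF assms] by blast
  then show ?thesis
    by (intro measurable_completion_cong_AE[OF measurable_completion[OF f'(1)]]) auto
qed

lemma strongly_measurable_norm_completion: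
  "strongly_measurable M f \<Longrightarrow> (\<lambda>x. norm (f x)) \<in> borel_measurable (completion M)"
  by (intro strongly_measurable_imp_completion strongly_measurable_norm)

text \<open>The integral is the same for \<open>M\<close> and its completion, so additivity can be
  borrowed from the completion. In this form it applies to norms of strongly measurable functions,
  which need not be measurable for \<open>M\<close>.\<close>

lemma nn_integral_add_completion:
  assumes "f \<in> borel_measurable (completion M)" "g \<in> borel_measurable (completion M)"
  shows "(\<integral>\<^sup>+x. f x + g x \<partial>M) = (\<integral>\<^sup>+x. f x \<partial>M) + (\<integral>\<^sup>+x. g x \<partial>M)"
  using nn_integral_add[OF assms] by (simp add: nn_integral_completion)

lemma nn_integral_cmult_completion:
  assumes "f \<in> borel_measurable (completion M)"
  shows "(\<integral>\<^sup>+x. c * f x \<partial>M) = c * (\<integral>\<^sup>+x. f x \<partial>M)"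
  using nn_integral_cmult[OF assms] by (simp add: nn_integral_completion)

text \<open>Truncation by twice the norm of the limit makes dominated convergence applicable.\<close>

lemma strongly_measurable_dominated_simple:
  assumes "strongly_measurable M f"
  obtains s where "\<And>i. simple_function M (s i)" "AE x in M. (\<lambda>i. s i x) \<longlonglongrightarrow> f x"
    "\<And>i. AE x in M. norm (s i x) \<le> 2 * norm (f x)"
proof -
  obtain s where s: "\<And>i. simple_function M (s i)" "AE x in M. (\<lambda>i. s i x) \<longlonglongrightarrow> f x"
    using assms unfolding strongly_measurable_def by auto
  obtain u where u[measurable]: "u \<in> borel_measurable M" and fu: "AE x in M. norm (f x) = u x"
    using strongly_measurable_imp_borel_AE[OF strongly_measurable_norm[OF assms]] by blast
  \<comment> \<open>The threshold uses the Borel version \<open>u\<close> of the norm of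
    \<open>f\<close>, so that the truncation set belongs to \<open>M\<close> and \<open>t i\<close>
    is again simple.\<close>
  define t where "t i x = (if norm (s i x) \<le> 2 * u x then s i x else 0)" for i x
  show thesis
  proof (rule that)
    show "simple_function M (t i)" for i
      unfolding t_def
    proof (rule simple_function_If)
      have [measurable]: "(\<lambda>x. norm (s i x)) \<in> borel_measurable M"
        by (rule borel_measurable_simple_function[OF simple_function_compose1[OF s(1)]])
      show "{x \<in> space M. norm (s i x) \<le> 2 * u x} \<in> sets M" by measurable
    qed (use s in auto)
    show "AE x in M. norm (t i x) \<le> 2 * norm (f x)" for i
      using fu by eventually_elim (metis t_def norm_ge_zero norm_zero mult_nonneg_nonneg zero_le_numeral)
    show "AE x in M. (\<lambda>i. t i x) \<longlonglongrightarrow> f x"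
      using fu s(2)
    proof eventually_elim
      case (elim x)
      show ?case
      proof (cases "f x = 0")
        case True
        then show ?thesis
          using tendsto_0_le[where f="\<lambda>i. s i x" and g="\<lambda>i. t i x" and K=1 and F=sequentially] elim
          by (auto simp: t_def)
      next
        case False
        \<comment> \<open>Where \<open>f x\<close> is nonzero, the factor 2 leaves room: the
          approximants eventually lie below the threshold and are not truncated. Where
          \<open>f x\<close> is 0, all truncated values are 0.\<close>
        have "(\<lambda>i. norm (s i x)) \<longlonglongrightarrow> norm (f x)" using elim by (intro tendsto_norm)
        then have "\<forall>\<^sub>F i in sequentially. norm (s i x) < 2 * norm (f x)"
          by (rule order_tendstoD) (use False in auto)
        then have "\<forall>\<^sub>F i in sequentially. s i x = t i x"
          by eventually_elim (use elim in \<open>auto simp: t_def\<close>)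
        then show ?thesis using elim by (simp add: filterlim_cong)
      qed
    qed
  qed
qed

section \<open>The Bochner integral\<close>

abbreviation simple_integrable :: "'a measure \<Rightarrow> ('a \<Rightarrow> 'b::real_vector) \<Rightarrow> bool" where
  "simple_integrable \<equiv> Bochner_Integration.simple_bochner_integrable"

abbreviation simple_integral :: "'a measure \<Rightarrow> ('a \<Rightarrow> 'b::real_vector) \<Rightarrow> 'b" where
  "simple_integral \<equiv> Bochner_Integration.simple_bochner_integral"

lemma simple_bochner_integral_norm_le:
  assumes s: "simple_integrable M s"
  shows "ennreal (norm (simple_integral M s)) \<le> (\<integral>\<^sup>+x. ennreal (norm (s x)) \<partial>M)"
proof -
  have "simple_integrable M (\<lambda>x. norm (s x))"
    using simple_bochner_integrable_compose2[of "\<lambda>x y. norm x" M s s] s by auto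
  from simple_bochner_integral_eq_nn_integral[OF this]
    simple_bochner_integral_norm_bound[OF s]
  show ?thesis by (metis ennreal_leI norm_ge_zero)
qed

lemma simple_bochner_integrable_norm_completion:
  assumes "strongly_measurable M f" "simple_integrable M s"
  shows "(\<lambda>x. ennreal (norm (f x - s x))) \<in> borel_measurable (completion M)"
proof -
  have "simple_function M s" using assms(2) by (auto elim: simple_bochner_integrable.cases)
  then have "(\<lambda>x. norm (f x - s x)) \<in> borel_measurable (completion M)"
    by (intro strongly_measurable_norm_completion strongly_measurable_diff assms
      strongly_measurable_simple)
  then show ?thesis by measurable
qed

text \<open>The triangle inequality through \<open>f\<close>. It gives both the uniqueness of the
  integral and the Cauchy property of the approximating integrals.\<close>

lemma simple_bochner_integral_dist:
  assumes f: "strongly_measurable M f"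
    and s: "simple_integrable M s"
    and t: "simple_integrable M t"
  shows "ennreal (norm (simple_integral M s - simple_integral M t)) \<le>
    (\<integral>\<^sup>+x. ennreal (norm (f x - s x)) \<partial>M) + (\<integral>\<^sup>+x. ennreal (norm (f x - t x)) \<partial>M)"
proof -
  have st: "simple_integrable M (\<lambda>x. s x - t x)"
    using simple_bochner_integrable_compose2[of "(-)" M s t] s t by auto
  have "ennreal (norm (simple_integral M s - simple_integral M t))
     \<le> (\<integral>\<^sup>+x. ennreal (norm (s x - t x)) \<partial>M)"
    using simple_bochner_integral_norm_le[OF st] by (simp add: simple_bochner_integral_diff[OF s t])
  also have "\<dots> \<le> (\<integral>\<^sup>+x. ennreal (norm (f x - s x)) + ennreal (norm (f x - t x)) \<partial>M)"
    by (intro nn_integral_mono)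
      (metis ennreal_leI ennreal_plus norm_ge_zero norm_minus_commute norm_diff_triangle_le order_refl)
  also have "\<dots> = (\<integral>\<^sup>+x. ennreal (norm (f x - s x)) \<partial>M) + (\<integral>\<^sup>+x. ennreal (norm (f x - t x)) \<partial>M)"
    by (intro nn_integral_add_completion simple_bochner_integrable_norm_completion f s t)
  finally show ?thesis .
qed

lemma has_bochner_int_unique:
  assumes "has_bochner_int M f x" "has_bochner_int M f y"
  shows "x = y"
proof -
  from assms(1) obtain s where s: "\<And>i. simple_integrable M (s i)"
    "(\<lambda>i. \<integral>\<^sup>+x. ennreal (norm (f x - s i x)) \<partial>M) \<longlonglongrightarrow> 0"
    "(\<lambda>i. simple_integral M (s i)) \<longlonglongrightarrow> x" and f: "strongly_measurable M f"
    unfolding has_bochner_int_def by auto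
  from assms(2) obtain t where t: "\<And>i. simple_integrable M (t i)"
    "(\<lambda>i. \<integral>\<^sup>+x. ennreal (norm (f x - t i x)) \<partial>M) \<longlonglongrightarrow> 0"
    "(\<lambda>i. simple_integral M (t i)) \<longlonglongrightarrow> y"
    unfolding has_bochner_int_def by auto
  let ?d = "\<lambda>i. norm (simple_integral M (s i) - simple_integral M (t i))"
  have "?d \<longlonglongrightarrow> norm (x - y)" using s(3) t(3) by (intro tendsto_intros)
  moreover have "(\<lambda>i. ennreal (?d i)) \<longlonglongrightarrow> ennreal 0"
  proof (rule tendsto_sandwich[where f="\<lambda>_. ennreal 0"])
    show "\<forall>\<^sub>F i in sequentially. ennreal (?d i) \<le>
       (\<integral>\<^sup>+x. ennreal (norm (f x - s i x)) \<partial>M) + (\<integral>\<^sup>+x. ennreal (norm (f x - t i x)) \<partial>M)"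
      by (intro always_eventually allI simple_bochner_integral_dist f s t)
    show "(\<lambda>i. (\<integral>\<^sup>+x. ennreal (norm (f x - s i x)) \<partial>M) + (\<integral>\<^sup>+x. ennreal (norm (f x - t i x)) \<partial>M)) \<longlonglongrightarrow>
      ennreal 0"
      using tendsto_add[OF s(2) t(2)] by simp
  qed auto
  then have "?d \<longlonglongrightarrow> 0" by (simp flip: ennreal_0)
  ultimately have "norm (x - y) = 0" by (rule LIMSEQ_unique)
  then show ?thesis by simp
qed

lemma has_bochner_int_norm_le:
  assumes "has_bochner_int M f I"
  shows "ennreal (norm I) \<le> (\<integral>\<^sup>+x. ennreal (norm (f x)) \<partial>M)"
proof -
  from assms obtain s where s: "\<And>i. simple_integrable M (s i)"
    "(\<lambda>i. \<integral>\<^sup>+x. ennreal (norm (f x - s i x)) \<partial>M) \<longlonglongrightarrow> 0"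
    "(\<lambda>i. simple_integral M (s i)) \<longlonglongrightarrow> I" and f: "strongly_measurable M f"
    unfolding has_bochner_int_def by auto
  show ?thesis
  proof (rule LIMSEQ_le)
    show "(\<lambda>i. ennreal (norm (simple_integral M (s i)))) \<longlonglongrightarrow> ennreal (norm I)"
      using s(3) by (intro tendsto_ennrealI tendsto_norm)
    show "(\<lambda>i. (\<integral>\<^sup>+x. ennreal (norm (f x)) \<partial>M) + (\<integral>\<^sup>+x. ennreal (norm (f x - s i x)) \<partial>M)) \<longlonglongrightarrow>
       (\<integral>\<^sup>+x. ennreal (norm (f x)) \<partial>M)"
      using tendsto_add[OF tendsto_const s(2)] by simp
    show "\<exists>N. \<forall>n\<ge>N. ennreal (norm (simple_integral M (s n))) \<le>
       (\<integral>\<^sup>+x. ennreal (norm (f x)) \<partial>M) + (\<integral>\<^sup>+x. ennreal (norm (f x - s n x)) \<partial>M)"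
    proof (intro exI allI impI)
      fix n
      have "ennreal (norm (simple_integral M (s n))) \<le> (\<integral>\<^sup>+x. ennreal (norm (s n x)) \<partial>M)"
        by (rule simple_bochner_integral_norm_le[OF s(1)])
      also have "\<dots> \<le> (\<integral>\<^sup>+x. ennreal (norm (f x)) + ennreal (norm (f x - s n x)) \<partial>M)"
        by (intro nn_integral_mono)
          (metis ennreal_leI ennreal_plus norm_ge_zero norm_minus_commute norm_triangle_sub)
      also have "\<dots> = (\<integral>\<^sup>+x. ennreal (norm (f x)) \<partial>M) + (\<integral>\<^sup>+x. ennreal (norm (f x - s n x)) \<partial>M)"
        by (intro nn_integral_add_completion simple_bochner_integrable_norm_completion f s)
          (use strongly_measurable_norm_completion[OF f] in measurable)
      finally show "ennreal (norm (simple_integral M (s n))) \<le>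
       (\<integral>\<^sup>+x. ennreal (norm (f x)) \<partial>M) + (\<integral>\<^sup>+x. ennreal (norm (f x - s n x)) \<partial>M)" .
    qed
  qed
qed

lemma has_bochner_int_bounded_linear:
  assumes T: "bounded_linear T" and "has_bochner_int M f I"
  shows "has_bochner_int M (\<lambda>x. T (f x)) (T I)"
proof -
  interpret T: bounded_linear T by fact
  from assms(2) obtain s where s: "\<And>i. simple_integrable M (s i)"
    "(\<lambda>i. \<integral>\<^sup>+x. ennreal (norm (f x - s i x)) \<partial>M) \<longlonglongrightarrow> 0"
    "(\<lambda>i. simple_integral M (s i)) \<longlonglongrightarrow> I" and f: "strongly_measurable M f"
    unfolding has_bochner_int_def by auto
  obtain K where K: "K > 0" "\<And>x i. norm (T (f x) - T (s i x)) \<le> norm (f x - s i x) * K"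
    using T.pos_bounded by (auto simp: T.diff[symmetric])
  show ?thesis unfolding has_bochner_int_def
  proof (intro conjI exI allI)
    show "strongly_measurable M (\<lambda>x. T (f x))" by (rule strongly_measurable_bounded_linear[OF T f])
    show "simple_integrable M (\<lambda>x. T (s i x))" for i
      using simple_bochner_integrable_compose2[of "\<lambda>x y. T x" M "s i" "s i"] s(1) by (auto simp: T.zero)
    show "(\<lambda>i. simple_integral M (\<lambda>x. T (s i x))) \<longlonglongrightarrow> T I"
      using s by (auto intro!: T.tendsto simp: simple_bochner_integral_linear T.linear_axioms)
    show "(\<lambda>i. \<integral>\<^sup>+ x. norm (T (f x) - T (s i x)) \<partial>M) \<longlonglongrightarrow> 0"
    proof (rule tendsto_sandwich[where f="\<lambda>_. 0"])
      show "(\<lambda>i. ennreal K * (\<integral>\<^sup>+ x. norm (f x - s i x) \<partial>M)) \<longlonglongrightarrow> 0"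
        using ennreal_tendsto_cmult[OF _ s(2), of "ennreal K"] by simp
      show "\<forall>\<^sub>F i in sequentially. (\<integral>\<^sup>+ x. norm (T (f x) - T (s i x)) \<partial>M) \<le> ennreal K * (\<integral>\<^sup>+
        x. norm (f x - s i x) \<partial>M)"
      proof (intro always_eventually allI)
        fix i
        have "(\<integral>\<^sup>+ x. norm (T (f x) - T (s i x)) \<partial>M) \<le> (\<integral>\<^sup>+ x. ennreal K * norm (f x - s i x) \<partial>M)"
          using K by (intro nn_integral_mono) (auto simp: ac_simps ennreal_mult[symmetric])
        also have "\<dots> = ennreal K * (\<integral>\<^sup>+ x. norm (f x - s i x) \<partial>M)"
          by (intro nn_integral_cmult_completion simple_bochner_integrable_norm_completion f s)
        finally show "(\<integral>\<^sup>+ x. norm (T (f x) - T (s i x)) \<partial>M) \<le> ennreal K * (\<integral>\<^sup>+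
          x. norm (f x - s i x) \<partial>M)" .
      qed
    qed auto
  qed
qed

lemma has_bochner_int_add:
  assumes "has_bochner_int M f I" "has_bochner_int M g J"
  shows "has_bochner_int M (\<lambda>x. f x + g x) (I + J)"
proof -
  from assms(1) obtain s where s: "\<And>i. simple_integrable M (s i)"
    "(\<lambda>i. \<integral>\<^sup>+x. ennreal (norm (f x - s i x)) \<partial>M) \<longlonglongrightarrow> 0"
    "(\<lambda>i. simple_integral M (s i)) \<longlonglongrightarrow> I" and f: "strongly_measurable M f"
    unfolding has_bochner_int_def by auto
  from assms(2) obtain t where t: "\<And>i. simple_integrable M (t i)"
    "(\<lambda>i. \<integral>\<^sup>+x. ennreal (norm (g x - t i x)) \<partial>M) \<longlonglongrightarrow> 0"
    "(\<lambda>i. simple_integral M (t i)) \<longlonglongrightarrow> J" and g: "strongly_measurable M g"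
    unfolding has_bochner_int_def by auto
  show ?thesis unfolding has_bochner_int_def
  proof (intro conjI exI allI)
    show "strongly_measurable M (\<lambda>x. f x + g x)" by (rule strongly_measurable_add[OF f g])
    show "simple_integrable M (\<lambda>x. s i x + t i x)" for i
      using simple_bochner_integrable_compose2[of "(+)" M "s i" "t i"] s(1) t(1) by auto
    show "(\<lambda>i. simple_integral M (\<lambda>x. s i x + t i x)) \<longlonglongrightarrow> I + J"
      using tendsto_add[OF s(3) t(3)] by (simp add: simple_bochner_integral_add s t)
    show "(\<lambda>i. \<integral>\<^sup>+ x. norm (f x + g x - (s i x + t i x)) \<partial>M) \<longlonglongrightarrow> 0"
    proof (rule tendsto_sandwich[where f="\<lambda>_. 0"])
      show "(\<lambda>i. (\<integral>\<^sup>+ x. norm (f x - s i x) \<partial>M) + (\<integral>\<^sup>+ x. norm (g x - t i x) \<partial>M)) \<longlonglongrightarrow> 0"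
        using tendsto_add[OF s(2) t(2)] by simp
      show "\<forall>\<^sub>F i in sequentially. (\<integral>\<^sup>+ x. norm (f x + g x - (s i x + t i x)) \<partial>M) \<le>
         (\<integral>\<^sup>+ x. norm (f x - s i x) \<partial>M) + (\<integral>\<^sup>+ x. norm (g x - t i x) \<partial>M)"
      proof (intro always_eventually allI)
        fix i
        have "(\<integral>\<^sup>+ x. norm (f x + g x - (s i x + t i x)) \<partial>M) \<le> (\<integral>\<^sup>+ x. ennreal (norm (f x - s i x)) +
          norm (g x - t i x) \<partial>M)"
          by (intro nn_integral_mono)
            (metis add_diff_add ennreal_leI ennreal_plus norm_ge_zero norm_triangle_ineq)
        also have "\<dots> = (\<integral>\<^sup>+ x. norm (f x - s i x) \<partial>M) + (\<integral>\<^sup>+ x. norm (g x - t i x) \<partial>M)"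
          by (intro nn_integral_add_completion simple_bochner_integrable_norm_completion f g s t)
        finally show "(\<integral>\<^sup>+ x. norm (f x + g x - (s i x + t i x)) \<partial>M) \<le>
         (\<integral>\<^sup>+ x. norm (f x - s i x) \<partial>M) + (\<integral>\<^sup>+ x. norm (g x - t i x) \<partial>M)" .
      qed
    qed auto
  qed
qed

lemma has_bochner_int_zero: "has_bochner_int M (\<lambda>x. 0) 0"
  unfolding has_bochner_int_def
  by (intro conjI strongly_measurable_const exI[of _ "\<lambda>i x. 0"])
    (auto intro!: simple_bochner_integrable.intros tendsto_eventually always_eventually sum.neutral
      simp: simple_bochner_integral_def)

lemma has_bochner_int_diff:
  assumes "has_bochner_int M f I" "has_bochner_int M g J"
  shows "has_bochner_int M (\<lambda>x. f x - g x) (I - J)"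
  using has_bochner_int_add[OF assms(1) has_bochner_int_bounded_linear[OF bounded_linear_minus[OF
    bounded_linear_ident] assms(2)]]
  by simp

lemma has_bochner_int_sum:
  "(\<And>i. i \<in> L \<Longrightarrow> has_bochner_int M (f i) (I i)) \<Longrightarrow> has_bochner_int M (\<lambda>x. \<Sum>i\<in>L. f i x) (\<Sum>i\<in>L. I i)"
  by (induction L rule: infinite_finite_induct) (auto intro: has_bochner_int_add has_bochner_int_zero)

text \<open>Bochner's criterion. The approximants stay below \<open>2 * norm (f x)\<close>, so the
  errors are dominated by \<open>3 * norm (f x)\<close> and tend to 0 in the mean; the integrals of
  the approximants are then Cauchy, and completeness of the target supplies the value.\<close>

lemma has_bochner_int_exists:
  fixes f :: "'a \<Rightarrow> 'b::banach"
  assumes f: "strongly_measurable M f" and fin: "(\<integral>\<^sup>+x. ennreal (norm (f x)) \<partial>M) < \<infinity>"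
  shows "\<exists>I. has_bochner_int M f I"
proof -
  obtain s where s: "\<And>i. simple_function M (s i)" "AE x in M. (\<lambda>i. s i x) \<longlonglongrightarrow> f x"
    "\<And>i. AE x in M. norm (s i x) \<le> 2 * norm (f x)"
    using strongly_measurable_dominated_simple[OF f] by blast
  have nf: "(\<lambda>x. norm (f x)) \<in> borel_measurable (completion M)"
    by (rule strongly_measurable_norm_completion[OF f])
  have 2: "(\<integral>\<^sup>+x. ennreal (c * norm (f x)) \<partial>M) < \<infinity>" if "c \<ge> 0" for c
  proof -
    have "(\<integral>\<^sup>+x. ennreal (c * norm (f x)) \<partial>M) = ennreal c * (\<integral>\<^sup>+x. ennreal (norm (f x)) \<partial>M)"
      using that nf by (subst nn_integral_cmult_completion[symmetric]) (auto simp: ennreal_mult)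
    then show ?thesis using fin by (simp add: ennreal_mult_less_top)
  qed
  have si: "simple_integrable M (s i)" for i
  proof (rule simple_bochner_integrableI_bounded[OF s(1)])
    have "(\<integral>\<^sup>+x. ennreal (norm (s i x)) \<partial>M) \<le> (\<integral>\<^sup>+x. ennreal (2 * norm (f x)) \<partial>M)"
      using s(3)[of i] by (intro nn_integral_mono_AE) (auto elim!: AE_mp)
    also have "\<dots> < \<infinity>" by (rule 2) simp
    finally show "(\<integral>\<^sup>+x. ennreal (norm (s i x)) \<partial>M) < \<infinity>" .
  qed
  have lim: "(\<lambda>i. \<integral>\<^sup>+x. ennreal (norm (f x - s i x)) \<partial>M) \<longlonglongrightarrow> 0"
  proof -
    have "(\<lambda>i. \<integral>\<^sup>+x. ennreal (norm (f x - s i x)) \<partial>completion M) \<longlonglongrightarrow> (\<integral>\<^sup>+x. 0 \<partial>completion M)"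
    proof (rule nn_integral_dominated_convergence[where w="\<lambda>x. ennreal (3 * norm (f x))"])
      show "(\<lambda>x. ennreal (norm (f x - s i x))) \<in> borel_measurable (completion M)" for i
        by (rule simple_bochner_integrable_norm_completion[OF f si])
      show "(\<integral>\<^sup>+x. ennreal (3 * norm (f x)) \<partial>completion M) < \<infinity>"
        using 2[of 3] by (simp add: nn_integral_completion)
      show "AE x in completion M. ennreal (norm (f x - s j x)) \<le> ennreal (3 * norm (f x))" for j
        using s(3)[of j] unfolding AE_completion_iff
        apply eventually_elim
        apply (rule ennreal_leI)
        subgoal for x using norm_triangle_ineq4[of "f x" "s j x"] by simp
        done
      show "AE x in completion M. (\<lambda>i. ennreal (norm (f x - s i x))) \<longlonglongrightarrow> 0"
        using s(2) unfolding AE_completion_iff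
      proof eventually_elim
        case (elim x)
        from tendsto_norm[OF tendsto_diff[OF tendsto_const[of "f x"] elim]] have "(\<lambda>i. norm (f x - s
          i x)) \<longlonglongrightarrow> 0" by simp
        then show ?case by (simp flip: ennreal_0)
      qed
      show "(\<lambda>x. ennreal (3 * norm (f x))) \<in> borel_measurable (completion M)" using nf by measurable
    qed simp
    then show ?thesis by (simp add: nn_integral_completion)
  qed
  let ?I = "\<lambda>i. simple_integral M (s i)"
  have "Cauchy ?I"
  proof (rule metric_CauchyI)
    fix e :: real assume e: "e > 0"
    have "\<forall>\<^sub>F i in sequentially. (\<integral>\<^sup>+x. ennreal (norm (f x - s i x)) \<partial>M) < ennreal (e / 2)"
      using lim by (rule order_tendstoD) (use e in auto)
    then obtain N where N: "\<And>i. i \<ge> N \<Longrightarrow> (\<integral>\<^sup>+x. ennreal (norm (f x - s i x)) \<partial>M) < ennreal (e / 2)"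
      by (auto simp: eventually_sequentially)
    have "dist (?I m) (?I n) < e" if "m \<ge> N" "n \<ge> N" for m n
    proof -
      have "ennreal (dist (?I m) (?I n)) \<le> (\<integral>\<^sup>+x. ennreal (norm (f x - s m x)) \<partial>M) +
        (\<integral>\<^sup>+x. ennreal (norm (f x - s n x)) \<partial>M)"
        unfolding dist_norm by (rule simple_bochner_integral_dist[OF f si si])
      also have "\<dots> < ennreal (e / 2) + ennreal (e / 2)" using N that by (intro add_strict_mono) auto
      also have "\<dots> = ennreal e" using e by (subst ennreal_plus[symmetric]) auto
      finally show ?thesis using e by (simp add: ennreal_less_iff)
    qed
    then show "\<exists>M. \<forall>m\<ge>M. \<forall>n\<ge>M. dist (?I m) (?I n) < e" by auto
  qed
  then obtain I where "?I \<longlonglongrightarrow> I" using Cauchy_convergent convergent_def by blast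
  then show ?thesis unfolding has_bochner_int_def using f si lim by blast
qed

text \<open>One integrable simple function at finite distance suffices. This converse of the
  existence criterion turns the Bochner integrability required in condition (1) into finiteness of a
  nonnegative integral.\<close>

lemma has_bochner_int_finite:
  assumes "has_bochner_int M f I"
  shows "(\<integral>\<^sup>+x. ennreal (norm (f x)) \<partial>M) < \<infinity>"
proof -
  from assms obtain s where s: "\<And>i. simple_integrable M (s i)"
    "(\<lambda>i. \<integral>\<^sup>+x. ennreal (norm (f x - s i x)) \<partial>M) \<longlonglongrightarrow> 0" and f: "strongly_measurable M f"
    unfolding has_bochner_int_def by auto
  have "\<forall>\<^sub>F i in sequentially. (\<integral>\<^sup>+x. ennreal (norm (f x - s i x)) \<partial>M) < \<infinity>"
    using s(2) by (rule order_tendstoD) auto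
  then obtain i where i: "(\<integral>\<^sup>+x. ennreal (norm (f x - s i x)) \<partial>M) < \<infinity>"
    by (auto simp: eventually_sequentially)
  have n: "simple_integrable M (\<lambda>x. norm (s i x))"
    using simple_bochner_integrable_compose2[of "\<lambda>x y. norm x" M "s i" "s i"] s(1)[of i] by auto
  have j: "(\<integral>\<^sup>+x. ennreal (norm (s i x)) \<partial>M) < \<infinity>"
    using simple_bochner_integral_eq_nn_integral[OF n]
      by (metis ennreal_less_top norm_ge_zero infinity_ennreal_def)
  have "(\<integral>\<^sup>+x. ennreal (norm (f x)) \<partial>M) \<le> (\<integral>\<^sup>+x. ennreal (norm (f x - s i x)) + ennreal (norm (s i x)) \<partial>M)"
    by (intro nn_integral_mono) (metis add.commute ennreal_leI ennreal_plus norm_ge_zero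
      norm_triangle_sub)
  also have "\<dots> = (\<integral>\<^sup>+x. ennreal (norm (f x - s i x)) \<partial>M) + (\<integral>\<^sup>+x. ennreal (norm (s i x)) \<partial>M)"
  proof (intro nn_integral_add_completion simple_bochner_integrable_norm_completion f s)
    have "simple_function M (s i)" using s(1)[of i] by (auto elim: simple_bochner_integrable.cases)
    from strongly_measurable_norm_completion[OF strongly_measurable_simple[OF this]]
    show "(\<lambda>x. ennreal (norm (s i x))) \<in> borel_measurable (completion M)" by measurable
  qed
  also have "\<dots> < \<infinity>" using i j by simp
  finally show ?thesis .
qed

text \<open>With a kernel of integral 1 this writes a single value as an average of a constant,
  which makes \<open>f x - convolve \<mu> j f x\<close> one integral. For real-valued functions the
  approximants of \<open>has_bochner_integral\<close> serve directly.\<close>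

lemma has_bochner_int_scaleR_const:
  fixes f :: "'a \<Rightarrow> real"
  assumes "integrable M f"
  shows "has_bochner_int M (\<lambda>x. f x *\<^sub>R b) (integral\<^sup>L M f *\<^sub>R b)"
proof (rule has_bochner_int_bounded_linear[OF bounded_linear_scaleR_left])
  have "has_bochner_integral M f (integral\<^sup>L M f)" using assms by (rule has_bochner_integral_integrable)
  then show "has_bochner_int M f (integral\<^sup>L M f)"
    by cases (auto simp: has_bochner_int_def intro: strongly_measurable_borel)
qed

lemma bochner_integral_on_eqI:
  "has_bochner_int M (\<lambda>x. indicator A x *\<^sub>R f x) I \<Longrightarrow> bochner_integral_on M A f = I"
  unfolding bochner_integral_on_def bochner_integrable_on_def
  by (auto intro!: the_equality dest: has_bochner_int_unique)

lemma has_bochner_int_bochner_integral_on: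
  "bochner_integrable_on M A f \<Longrightarrow> has_bochner_int M (\<lambda>x. indicator A x *\<^sub>R f x) (bochner_integral_on M
    A f)"
  unfolding bochner_integrable_on_def using bochner_integral_on_eqI by blast

section \<open>The \<open>L\<^sup>p\<close> seminorm\<close>

text \<open>Keeps roots out of the estimates: a bound by a real number can be checked on the
  integral of the \<open>p\<close>-th power, and an infinite integral is covered as well.\<close>

lemma Lp_norm_on_le_iff:
  assumes "0 < p" "0 \<le> c"
  shows "Lp_norm_on p M A f \<le> ennreal c \<longleftrightarrow> (\<integral>\<^sup>+x\<in>A. ennreal (norm (f x) powr p) \<partial>M) \<le> ennreal (c powr p)"
proof (cases "\<integral>\<^sup>+x\<in>A. ennreal (norm (f x) powr p) \<partial>M" rule: ennreal_cases)
  case (real r)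
  have "r powr (1 / p) \<le> c \<longleftrightarrow> r \<le> c powr p"
  proof
    assume "r powr (1 / p) \<le> c"
    then have "(r powr (1 / p)) powr p \<le> c powr p" using assms by (intro powr_mono2) auto
    then show "r \<le> c powr p" using assms real by (simp add: powr_powr)
  next
    assume "r \<le> c powr p"
    then have "r powr (1 / p) \<le> (c powr p) powr (1 / p)" using assms real by (intro powr_mono2) auto
    then show "r powr (1 / p) \<le> c" using assms by (simp add: powr_powr)
  qed
  then show ?thesis using real assms by (simp add: Lp_norm_on_def)
next
  case top
  then show ?thesis by (simp add: Lp_norm_on_def top_unique)
qed

lemma Lp_norm_on_finite_iff:
  "Lp_norm_on p M A f < \<infinity> \<longleftrightarrow> (\<integral>\<^sup>+x\<in>A. ennreal (norm (f x) powr p) \<partial>M) < \<infinity>"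
  by (auto simp: Lp_norm_on_def Let_def less_top)

lemma Lp_norm_on_mono_integral:
  assumes "0 < p" "(\<integral>\<^sup>+x\<in>A. ennreal (norm (f x) powr p) \<partial>M) \<le> (\<integral>\<^sup>+x\<in>B. ennreal (norm (g x) powr p) \<partial>N)"
  shows "Lp_norm_on p M A f \<le> Lp_norm_on p N B g"
proof (cases "Lp_norm_on p N B g" rule: ennreal_cases)
  case (real r)
  have "(\<integral>\<^sup>+x\<in>B. ennreal (norm (g x) powr p) \<partial>N) \<le> ennreal (r powr p)"
    using real assms(1) by (subst Lp_norm_on_le_iff[symmetric]) auto
  with assms(2) have "Lp_norm_on p M A f \<le> ennreal r"
    using real assms(1) by (subst Lp_norm_on_le_iff) (auto intro: order_trans)
  then show ?thesis using real by simp
qed auto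

lemma Lp_norm_on_mono_AE:
  assumes "0 < p" "AE x in M. x \<in> A \<longrightarrow> norm (f x) \<le> norm (g x)"
  shows "Lp_norm_on p M A f \<le> Lp_norm_on p M A g"
proof (intro Lp_norm_on_mono_integral assms nn_integral_mono_AE)
  show "AE x in M. ennreal (norm (f x) powr p) * indicator A x \<le>
    ennreal (norm (g x) powr p) * indicator A x"
    using assms(2)
    by eventually_elim (use assms(1) in \<open>auto split: split_indicator intro!: ennreal_leI powr_mono2\<close>)
qed

lemma Lp_norm_on_mono:
  assumes "0 < p" "\<And>x. x \<in> A \<Longrightarrow> norm (f x) \<le> norm (g x)"
  shows "Lp_norm_on p M A f \<le> Lp_norm_on p M A g"
  using assms by (intro Lp_norm_on_mono_AE) auto

lemma Lp_norm_on_mono_set: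
  assumes "0 < p" "A \<subseteq> B"
  shows "Lp_norm_on p M A f \<le> Lp_norm_on p M B f"
  using assms by (intro Lp_norm_on_mono_integral nn_integral_mono) (auto split: split_indicator)

lemma Lp_norm_on_cong_AE:
  assumes "AE x in M. x \<in> A \<longrightarrow> norm (f x) = norm (g x)"
  shows "Lp_norm_on p M A f = Lp_norm_on p M A g"
proof -
  have "(\<integral>\<^sup>+x\<in>A. ennreal (norm (f x) powr p) \<partial>M) = (\<integral>\<^sup>+x\<in>A. ennreal (norm (g x) powr p) \<partial>M)"
    by (intro nn_integral_cong_AE, use assms in eventually_elim) (auto split: split_indicator)
  then show ?thesis by (simp add: Lp_norm_on_def)
qed

lemma Lp_norm_on_norm [simp]: "Lp_norm_on p M A (\<lambda>x. norm (f x)) = Lp_norm_on p M A f"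
  by (rule Lp_norm_on_cong_AE) simp

lemma Lp_norm_on_minus_commute: "Lp_norm_on p M A (\<lambda>x. f x - g x) = Lp_norm_on p M A (\<lambda>x. g x - f x)"
  by (rule Lp_norm_on_cong_AE) (simp add: norm_minus_commute)

lemma Lp_norm_on_indicator:
  "Lp_norm_on p M B (\<lambda>x. indicator A x *\<^sub>R f x) = Lp_norm_on p M (A \<inter> B) f"
proof -
  have "(\<integral>\<^sup>+x\<in>B. ennreal (norm (indicator A x *\<^sub>R f x) powr p) \<partial>M) =
    (\<integral>\<^sup>+x\<in>A \<inter> B. ennreal (norm (f x) powr p) \<partial>M)"
    by (intro nn_integral_cong) (auto split: split_indicator)
  then show ?thesis by (simp add: Lp_norm_on_def)
qed

text \<open>The weights come from convexity: \<open>(u + v) / (a + b)\<close> is the convex combination of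
  \<open>u / a\<close> and \<open>v / b\<close> with weights \<open>a / (a + b)\<close> and \<open>b / (a + b)\<close>.\<close>

lemma powr_add_le_convex:
  fixes a b p u v :: real
  assumes p: "1 \<le> p" and ab: "0 < a" "0 < b" and uv: "0 \<le> u" "0 \<le> v"
  shows "(u + v) powr p \<le>
    (a + b) powr p * (a / (a + b) / a powr p) * u powr p + (a + b) powr p * (b / (a +
      b) / b powr p) * v powr p"
proof -
  let ?s = "a / (a + b)" and ?t = "b / (a + b)"
  have st: "0 < ?s" "0 < ?t" "?s + ?t = 1" "?s \<le> 1" "?t \<le> 1"
    using ab by (auto simp: add_divide_distrib[symmetric])
  have "(?s * x + ?t * y) powr p \<le> ?s * x powr p + ?t * y powr p" if "0 \<le> x" "0 \<le> y" for x y :: real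
  proof (cases "x = 0 \<or> y = 0")
    case True
    moreover have "?s powr p \<le> ?s" "?t powr p \<le> ?t" using st p by (auto intro!: powr_le_one_le)
    ultimately show ?thesis using that p st
      by (auto simp: powr_mult simp del: times_divide_eq_left intro!: mult_right_mono)
  next
    case False
    have "1 - ?t = ?s" using st(3) by linarith
    then show ?thesis using convex_onD[OF powr_convex[OF p], of ?t x y] st(2,5) that False
      by (simp del: times_divide_eq_left)
  qed
  from this[of "u / a" "v / b"] have "((u + v) / (a + b)) powr p \<le> ?s * (u / a) powr p +
    ?t * (v / b) powr p"
    using ab uv by (simp add: add_divide_distrib)
  then have "(a + b) powr p * ((u + v) / (a + b)) powr p \<le> (a + b) powr p * (?s * (u / a) powr p +
    ?t * (v / b) powr p)"
    by (intro mult_left_mono) auto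
  then show ?thesis using ab uv by (simp add: powr_divide algebra_simps)
qed

text \<open>Minkowski's inequality, with measurability asked of the majorants \<open>u\<close> and
  \<open>v\<close> only. The pointwise convexity bound is integrated with \<open>a\<close> and
  \<open>b\<close> just above the two norms; its weights satisfy
  \<open>\<alpha> * a powr p + \<beta> * b powr p = (a + b) powr p\<close>.\<close>

lemma Lp_norm_on_triangle:
  fixes u v :: "'a \<Rightarrow> real"
  assumes p: "1 \<le> p" and A: "A \<in> sets M"
    and [measurable]: "u \<in> borel_measurable (completion M)" "v \<in> borel_measurable (completion M)"
    and le: "AE x in M. x \<in> A \<longrightarrow> norm (h x) \<le> \<bar>u x\<bar> + \<bar>v x\<bar>"
  shows "Lp_norm_on p M A h \<le> Lp_norm_on p M A u + Lp_norm_on p M A v"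
proof (rule ennreal_le_epsilon)
  fix e :: real assume fin: "Lp_norm_on p M A u + Lp_norm_on p M A v < top" and e: "0 < e"
  obtain r where r: "Lp_norm_on p M A u = ennreal r" "r \<ge> 0"
    using fin by (cases "Lp_norm_on p M A u" rule: ennreal_cases) auto
  obtain s where s: "Lp_norm_on p M A v = ennreal s" "s \<ge> 0"
    using fin by (cases "Lp_norm_on p M A v" rule: ennreal_cases) auto
  \<comment> \<open>The margin keeps both weights meaningful even if one of the norms is 0.\<close>
  define a where "a = r + e / 2"
  define b where "b = s + e / 2"
  have ab: "0 < a" "0 < b" "a + b = r + s + e" using r s e by (auto simp: a_def b_def)
  have I: "(\<integral>\<^sup>+x\<in>A. ennreal (norm (u x) powr p) \<partial>M) \<le> ennreal (a powr p)"
    "(\<integral>\<^sup>+x\<in>A. ennreal (norm (v x) powr p) \<partial>M) \<le> ennreal (b powr p)"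
    using p r s e ab Lp_norm_on_le_iff[of p a M A u] Lp_norm_on_le_iff[of p b M A v]
    by (auto simp: a_def b_def)
  define \<alpha> where "\<alpha> = (a + b) powr p * (a / (a + b) / a powr p)"
  define \<beta> where "\<beta> = (a + b) powr p * (b / (a + b) / b powr p)"
  have nn: "0 \<le> \<alpha>" "0 \<le> \<beta>" using ab(1,2) by (auto simp: \<alpha>_def \<beta>_def)
  have sum: "\<alpha> * a powr p + \<beta> * b powr p = (a + b) powr p"
  proof -
    have "\<alpha> * a powr p = (a + b) powr p * (a / (a + b))" "\<beta> * b powr p = (a + b) powr p * (b / (a + b))"
      using ab(1,2) by (simp_all add: \<alpha>_def \<beta>_def)
    moreover have "a / (a + b) + b / (a + b) = 1" using ab(1,2)
      by (simp add: add_divide_distrib[symmetric])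
    ultimately show ?thesis by (metis distrib_left mult.right_neutral)
  qed
  have [measurable]: "A \<in> sets (completion M)" using A by simp
  have "(\<integral>\<^sup>+x\<in>A. ennreal (norm (h x) powr p) \<partial>M) \<le>
     (\<integral>\<^sup>+x. ennreal \<alpha> * (ennreal (norm (u x) powr p) * indicator A x) +
       ennreal \<beta> * (ennreal (norm (v x) powr p) * indicator A x) \<partial>M)"
  proof (rule nn_integral_mono_AE, use le in eventually_elim)
    case (elim x)
    have "norm (h x) powr p \<le> \<alpha> * \<bar>u x\<bar> powr p + \<beta> * \<bar>v x\<bar> powr p" if "x \<in> A"
      using powr_mono2[of p "norm (h x)" "\<bar>u x\<bar> + \<bar>v x\<bar>"] elim that p
        powr_add_le_convex[OF p ab(1,2), of "\<bar>u x\<bar>" "\<bar>v x\<bar>"] by (simp add: \<alpha>_def \<beta>_def)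
    then show ?case using nn by (auto split: split_indicator simp flip: ennreal_mult ennreal_plus
      intro!: ennreal_leI)
  qed
  also have "\<dots> = ennreal \<alpha> * (\<integral>\<^sup>+x\<in>A. ennreal (norm (u x) powr p) \<partial>M) +
    ennreal \<beta> * (\<integral>\<^sup>+x\<in>A. ennreal (norm (v x) powr p) \<partial>M)"
    by (subst nn_integral_add_completion) (auto intro!: arg_cong2[where f="(+)"]
      nn_integral_cmult_completion)
  also have "\<dots> \<le> ennreal \<alpha> * ennreal (a powr p) + ennreal \<beta> * ennreal (b powr p)"
    by (intro add_mono mult_left_mono I) auto
  also have "\<dots> = ennreal ((a + b) powr p)"
    using nn by (simp add: sum[symmetric] flip: ennreal_mult ennreal_plus)
  finally have "Lp_norm_on p M A h \<le> ennreal (a + b)"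
    using p ab(1,2) by (subst Lp_norm_on_le_iff) auto
  then show "Lp_norm_on p M A h \<le> Lp_norm_on p M A u + Lp_norm_on p M A v + ennreal e"
    using r s e by (simp add: ab(3) flip: ennreal_plus)
qed

lemma Lp_norm_on_add:
  fixes u v :: "'a \<Rightarrow> real"
  assumes "1 \<le> p" "A \<in> sets M" "u \<in> borel_measurable (completion M)" "v \<in> borel_measurable
    (completion M)"
  shows "Lp_norm_on p M A (\<lambda>x. u x + v x) \<le> Lp_norm_on p M A u + Lp_norm_on p M A v"
  using assms by (intro Lp_norm_on_triangle AE_I2) (auto intro: abs_triangle_ineq)

text \<open>Here \<open>u\<close> is arbitrary: the lower integral is superadditive against measurable functions.\<close>

lemma Lp_norm_on_triangle_left:
  fixes v :: "'a \<Rightarrow> real"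
  assumes p: "1 \<le> p" and A: "A \<in> sets M"
    and h [measurable]: "(\<lambda>x. norm (h x)) \<in> borel_measurable (completion M)"
    and v [measurable]: "v \<in> borel_measurable (completion M)"
    and le: "\<And>x. x \<in> A \<Longrightarrow> norm (h x) \<le> norm (u x) + \<bar>v x\<bar>"
  shows "Lp_norm_on p M A h \<le> Lp_norm_on p M A u + Lp_norm_on p M A v"
proof -
  have "Lp_norm_on p M A h \<le> Lp_norm_on p M A (\<lambda>x. max 0 (norm (h x) - \<bar>v x\<bar>)) + Lp_norm_on p M A v"
    by (rule Lp_norm_on_triangle[OF p A]) auto
  also have "Lp_norm_on p M A (\<lambda>x. max 0 (norm (h x) - \<bar>v x\<bar>)) \<le> Lp_norm_on p M A u"
    by (rule Lp_norm_on_mono) (use p in \<open>auto dest: le\<close>)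
  finally show ?thesis by (simp add: add_right_mono)
qed

lemma Lp_norm_on_triangle_sm:
  assumes p: "1 \<le> p" and A: "A \<in> sets M"
    and f: "strongly_measurable M f" and g: "strongly_measurable M g"
    and le: "\<And>x. x \<in> A \<Longrightarrow> norm (h x) \<le> norm (f x) + norm (g x)"
  shows "Lp_norm_on p M A h \<le> Lp_norm_on p M A f + Lp_norm_on p M A g"
  using Lp_norm_on_triangle[OF p A strongly_measurable_norm_completion[OF f]
    strongly_measurable_norm_completion[OF g], of h] le
  by simp

lemma Lp_norm_on_scaleR:
  assumes p: "1 \<le> p" and A: "A \<in> sets M" and u: "(\<lambda>x. norm (u x)) \<in> borel_measurable (completion M)"
  shows "Lp_norm_on p M A (\<lambda>x. c *\<^sub>R u x) \<le> ennreal \<bar>c\<bar> * Lp_norm_on p M A u"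
proof (cases "c = 0")
  case True
  have "Lp_norm_on p M A (\<lambda>x. c *\<^sub>R u x) \<le> ennreal 0"
    using p True by (subst Lp_norm_on_le_iff) auto
  then show ?thesis by simp
next
  case False
  show ?thesis
  proof (cases "Lp_norm_on p M A u" rule: ennreal_cases)
    case (real r)
    have A': "A \<in> sets (completion M)" using A by simp
    have "(\<integral>\<^sup>+x\<in>A. ennreal (norm (c *\<^sub>R u x) powr p) \<partial>M)
      = (\<integral>\<^sup>+x. ennreal (\<bar>c\<bar> powr p) * (ennreal (norm (u x) powr p) * indicator A x) \<partial>M)"
      by (intro nn_integral_cong) (simp add: powr_mult ennreal_mult ac_simps)
    also have "\<dots> = ennreal (\<bar>c\<bar> powr p) * (\<integral>\<^sup>+x\<in>A. ennreal (norm (u x) powr p) \<partial>M)"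
      by (intro nn_integral_cmult_completion borel_measurable_times_ennreal borel_measurable_indicator A'
          measurable_compose[OF u, where g="\<lambda>r. ennreal (r powr p)"]) measurable
    also have "\<dots> \<le> ennreal (\<bar>c\<bar> powr p) * ennreal (r powr p)"
      using real p Lp_norm_on_le_iff[of p r M A u] by (intro mult_left_mono) auto
    also have "\<dots> = ennreal ((\<bar>c\<bar> * r) powr p)" using real by (simp add: powr_mult ennreal_mult)
    finally have "Lp_norm_on p M A (\<lambda>x. c *\<^sub>R u x) \<le> ennreal (\<bar>c\<bar> * r)"
      using p real by (subst Lp_norm_on_le_iff) auto
    then show ?thesis using real by (simp add: ennreal_mult)
  next
    case top
    then show ?thesis using False by (simp add: ennreal_mult_top)
  qed
qed

lemma Lp_norm_on_sum:
  fixes u :: "'i \<Rightarrow> 'a \<Rightarrow> real"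
  assumes p: "1 \<le> p" and A: "A \<in> sets M"
    and u: "\<And>i. i \<in> L \<Longrightarrow> u i \<in> borel_measurable (completion M)" and w: "\<And>i. i \<in> L \<Longrightarrow> 0 \<le> w i"
  shows "Lp_norm_on p M A (\<lambda>x. \<Sum>i\<in>L. w i * u i x) \<le> (\<Sum>i\<in>L. ennreal (w i) * Lp_norm_on p M A (u i))"
  using u w
proof (induction L rule: infinite_finite_induct)
  case (infinite L)
  have "Lp_norm_on p M A (\<lambda>x. 0::real) \<le> ennreal 0" using p by (subst Lp_norm_on_le_iff) auto
  then show ?case using infinite by simp
next
  case empty
  have "Lp_norm_on p M A (\<lambda>x. 0::real) \<le> ennreal 0" using p by (subst Lp_norm_on_le_iff) auto
  then show ?case by simp
next
  case (insert i L)
  have [measurable]: "\<And>j. j \<in> insert i L \<Longrightarrow> u j \<in> borel_measurable (completion M)" by fact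
  have "Lp_norm_on p M A (\<lambda>x. \<Sum>j\<in>insert i L. w j * u j x) \<le>
     Lp_norm_on p M A (\<lambda>x. w i * u i x) + Lp_norm_on p M A (\<lambda>x. \<Sum>j\<in>L. w j * u j x)"
    by (rule Lp_norm_on_triangle[OF p A]) (use insert in auto)
  also have "\<dots> \<le> ennreal (w i) * Lp_norm_on p M A (u i) + (\<Sum>j\<in>L. ennreal (w j) * Lp_norm_on p M A (u j))"
    using Lp_norm_on_scaleR[OF p A, of "u i" "w i"] insert by (intro add_mono) auto
  finally show ?case using insert by simp
qed

text \<open>Converts uniform smallness on a set of finite measure into smallness in
  \<open>L\<^sup>p\<close>. The bound \<open>d\<close> is fixed before any function is given, so
  later choices can be adjusted to it.\<close>

lemma Lp_norm_on_const_le: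
  assumes p: "1 \<le> p" and A: "A \<in> sets M" "emeasure M A < \<infinity>" and e: "0 < e"
  obtains d where "d > 0" "\<And>f :: 'a \<Rightarrow> 'b::real_normed_vector. (\<And>x. x \<in> A \<Longrightarrow> norm (f x) \<le> d) \<Longrightarrow>
    Lp_norm_on p M A f \<le> ennreal e"
proof -
  obtain m where m: "emeasure M A = ennreal m" "m \<ge> 0" using A
    by (cases "emeasure M A" rule: ennreal_cases) auto
  \<comment> \<open>Using \<open>m + 1\<close> in place of the measure \<open>m\<close> keeps the
    quotient meaningful for a null set.\<close>
  define d where "d = e / (m + 1) powr (1 / p)"
  have d: "d > 0" using e m by (auto simp: d_def)
  show thesis
  proof (rule that[OF d])
    fix f :: "'a \<Rightarrow> 'b" assume f: "\<And>x. x \<in> A \<Longrightarrow> norm (f x) \<le> d"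
    have "(\<integral>\<^sup>+x\<in>A. ennreal (norm (f x) powr p) \<partial>M) \<le> (\<integral>\<^sup>+x. ennreal (d powr p) * indicator A x \<partial>M)"
      using f p by (intro nn_integral_mono) (auto split: split_indicator intro!: ennreal_leI powr_mono2)
    also have "\<dots> = ennreal (d powr p * m)" using A m
      by (simp add: nn_integral_cmult_indicator ennreal_mult)
    also have "\<dots> \<le> ennreal (e powr p)"
    proof (rule ennreal_leI)
      have "d powr p = e powr p / (m + 1)" using e m p by (simp add: d_def powr_divide powr_powr)
      then have "d powr p + m * d powr p = e powr p" using m by (simp add: field_simps)
      moreover have "0 \<le> d powr p" by simp
      ultimately show "d powr p * m \<le> e powr p" unfolding mult.commute[of "d powr p" m] by linarith
    qed
    finally show "Lp_norm_on p M A f \<le> ennreal e" using p e by (subst Lp_norm_on_le_iff) auto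
  qed
qed

lemma Lp_norm_on_eq_0:
  assumes p: "1 \<le> p" and f: "strongly_measurable M f" and 0: "Lp_norm_on p M (space M) f = 0"
  shows "AE x in M. f x = 0"
proof -
  have "(\<integral>\<^sup>+x\<in>space M. ennreal (norm (f x) powr p) \<partial>M) \<le> ennreal (0 powr p)"
    using 0 p by (subst Lp_norm_on_le_iff[symmetric]) auto
  then have "(\<integral>\<^sup>+x. ennreal (norm (f x) powr p) \<partial>completion M) = 0"
    unfolding nn_integral_completion
    by (subst nn_integral_cong[where v="\<lambda>x. ennreal (norm (f x) powr p) * indicator (space M) x"]) auto
  moreover have "(\<lambda>x. ennreal (norm (f x) powr p)) \<in> borel_measurable (completion M)"
    using strongly_measurable_norm_completion[OF f] by measurable
  ultimately have "AE x in completion M. ennreal (norm (f x) powr p) = 0"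
    by (subst (asm) nn_integral_0_iff_AE)
  then show ?thesis unfolding AE_completion_iff by eventually_elim (auto simp: ennreal_eq_0_iff)
qed

text \<open>The countable form of Minkowski's inequality. The \<open>p\<close>-th powers of the
  partial sums increase, and monotone convergence bounds the integral of their supremum; the
  supremum is then finite almost everywhere, which gives summability.\<close>

lemma Lp_norm_on_suminf:
  fixes d :: "nat \<Rightarrow> 'a \<Rightarrow> real"
  assumes p: "1 \<le> p" and d[measurable]: "\<And>i. d i \<in> borel_measurable M" and nn: "\<And>i x. 0 \<le> d i x"
    and c: "\<And>i. Lp_norm_on p M (space M) (d i) \<le> ennreal (c i)" "\<And>i. 0 \<le> c i" "summable c"
  shows "AE x in M. summable (\<lambda>i. d i x)" "Lp_norm_on p M (space M) (\<lambda>x. \<Sum>i. d i x) \<le> ennreal (\<Sum>i. c i)"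
proof -
  let ?C = "\<Sum>i. c i"
  define U where "U k x = ennreal ((\<Sum>i<k. d i x) powr p)" for k x
  have C: "0 \<le> ?C" using c by (intro suminf_nonneg) auto
  have U: "(\<integral>\<^sup>+x. U k x \<partial>M) \<le> ennreal (?C powr p)" for k
  proof -
    have "Lp_norm_on p M (space M) (\<lambda>x. \<Sum>i<k. 1 * d i x) \<le>
      (\<Sum>i<k. ennreal 1 * Lp_norm_on p M (space M) (d i))"
      by (rule Lp_norm_on_sum[OF p]) (auto intro: measurable_completion d)
    also have "\<dots> \<le> (\<Sum>i<k. ennreal (c i))" using c by (intro sum_mono) simp
    also have "\<dots> = ennreal (\<Sum>i<k. c i)" using c by simp
    also have "\<dots> \<le> ennreal ?C" by (intro ennreal_leI sum_le_suminf) (use c in auto)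
    finally have "(\<integral>\<^sup>+x\<in>space M. ennreal (norm (\<Sum>i<k. d i x) powr p) \<partial>M) \<le> ennreal (?C powr p)"
      using p C by (subst (asm) Lp_norm_on_le_iff) auto
    moreover have "(\<integral>\<^sup>+x. U k x \<partial>M) = (\<integral>\<^sup>+x\<in>space M. ennreal (norm (\<Sum>i<k. d i x) powr p) \<partial>M)"
      using nn by (intro nn_integral_cong) (simp add: U_def sum_nonneg)
    ultimately show ?thesis by simp
  qed
  have inc: "incseq U"
  proof (intro incseq_SucI le_funI)
    show "U k x \<le> U (Suc k) x" for k x
      using nn p unfolding U_def by (intro ennreal_leI powr_mono2) (auto intro: sum_nonneg)
  qed
  have [measurable]: "U k \<in> borel_measurable M" for k unfolding U_def by measurable
  have S: "(\<integral>\<^sup>+x. (SUP k. U k x) \<partial>M) \<le> ennreal (?C powr p)"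
    using nn_integral_monotone_convergence_SUP[OF inc] U by (simp add: SUP_least)
  then have "(\<integral>\<^sup>+x. (SUP k. U k x) \<partial>M) \<noteq> \<infinity>" by (auto simp: top_unique)
  then have "AE x in M. (SUP k. U k x) \<noteq> \<infinity>" by (intro nn_integral_PInf_AE) auto
  then have sm: "AE x in M. summable (\<lambda>i. d i x) \<and> ennreal ((\<Sum>i. d i x) powr p) \<le> (SUP k. U k x)"
  proof eventually_elim
    case (elim x)
    then obtain B where B: "(SUP k. U k x) = ennreal B" "0 \<le> B"
      by (cases "SUP k. U k x" rule: ennreal_cases) auto
    have Bk: "(\<Sum>i<k. d i x) \<le> B powr (1 / p)" for k
    proof -
      have "U k x \<le> ennreal B" unfolding B(1)[symmetric] by (rule SUP_upper) simp
      then have "(\<Sum>i<k. d i x) powr p \<le> B" using B by (simp add: U_def)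
      then have "((\<Sum>i<k. d i x) powr p) powr (1 / p) \<le> B powr (1 / p)" using p by (intro powr_mono2) auto
      then show ?thesis using p nn by (simp add: powr_powr sum_nonneg)
    qed
    then have s: "summable (\<lambda>i. d i x)" by (intro summableI_nonneg_bounded nn)
    moreover have "(\<Sum>i. d i x) powr p \<le> B"
    proof -
      have "(\<Sum>i. d i x) \<le> B powr (1 / p)" by (rule suminf_le_const[OF s Bk])
      then have "(\<Sum>i. d i x) powr p \<le> (B powr (1 / p)) powr p" using p nn s
        by (intro powr_mono2) (auto intro: suminf_nonneg)
      then show ?thesis using p B by (simp add: powr_powr)
    qed
    ultimately show ?case using B by (simp add: ennreal_leI)
  qed
  then show "AE x in M. summable (\<lambda>i. d i x)" by (rule AE_mp) auto
  have "(\<integral>\<^sup>+x\<in>space M. ennreal (norm (\<Sum>i. d i x) powr p) \<partial>M) \<le> (\<integral>\<^sup>+x. (SUP k. U k x) \<partial>M)"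
    using sm AE_space by (intro nn_integral_mono_AE, eventually_elim) (auto simp: suminf_nonneg nn)
  with S show "Lp_norm_on p M (space M) (\<lambda>x. \<Sum>i. d i x) \<le> ennreal ?C"
    using p C by (subst Lp_norm_on_le_iff) auto
qed

section \<open>The space \<open>L\<^sup>p\<close>\<close>

lemma Lp_functions_iff:
  assumes "1 \<le> p"
  shows "f \<in> Lp_functions (ennreal p) M \<longleftrightarrow> strongly_measurable M f \<and> Lp_norm_on p M (space M) f < \<infinity>"
  using assms by (simp add: Lp_functions_def)

lemma Lp_functions_diff:
  assumes p: "1 \<le> p" and "f \<in> Lp_functions (ennreal p) M" "g \<in> Lp_functions (ennreal p) M"
  shows "(\<lambda>x. f x - g x) \<in> Lp_functions (ennreal p) M"
proof -
  have "Lp_norm_on p M (space M) (\<lambda>x. f x - g x) \<le> Lp_norm_on p M (space M) f +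
    Lp_norm_on p M (space M) g"
    using assms by (intro Lp_norm_on_triangle_sm) (auto simp: Lp_functions_iff norm_triangle_ineq4)
  also have "\<dots> < \<infinity>" using assms by (auto simp: Lp_functions_iff)
  finally show ?thesis using assms by (auto simp: Lp_functions_iff intro: strongly_measurable_diff)
qed

text \<open>Dominated convergence for \<open>norm (f x - s i x) powr p\<close> with the majorant
  \<open>(3 * norm (f x)) powr p\<close>, since the approximants can be kept below
  \<open>2 * norm (f x)\<close>.\<close>

lemma Lp_simple_dense:
  assumes p: "1 \<le> p" and f: "f \<in> Lp_functions (ennreal p) M" and e: "0 < e"
  obtains s where "simple_function M s" "Lp_norm_on p M (space M) (\<lambda>x. f x - s x) < ennreal e"
proof -
  have f': "strongly_measurable M f" "Lp_norm_on p M (space M) f < \<infinity>" using f p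
    by (auto simp: Lp_functions_iff)
  obtain s where s: "\<And>i. simple_function M (s i)" "AE x in M. (\<lambda>i. s i x) \<longlonglongrightarrow> f x"
    "\<And>i. AE x in M. norm (s i x) \<le> 2 * norm (f x)"
    using strongly_measurable_dominated_simple[OF f'(1)] by blast
  have nf[measurable]: "(\<lambda>x. norm (f x)) \<in> borel_measurable (completion M)"
    by (rule strongly_measurable_norm_completion[OF f'(1)])
  have ns[measurable]: "(\<lambda>x. norm (f x - s i x)) \<in> borel_measurable (completion M)" for i
    by (intro strongly_measurable_norm_completion strongly_measurable_diff f'
      strongly_measurable_simple s)
  have "(\<lambda>i. \<integral>\<^sup>+x. ennreal (norm (f x - s i x) powr p) \<partial>completion M) \<longlonglongrightarrow> (\<integral>\<^sup>+x. 0 \<partial>completion M)"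
  proof (rule nn_integral_dominated_convergence[where w="\<lambda>x. ennreal (3 powr p) * ennreal (norm (f
    x) powr p)"])
    have "(\<integral>\<^sup>+x. ennreal (norm (f x) powr p) \<partial>M) = (\<integral>\<^sup>+x\<in>space M. ennreal (norm (f x) powr p) \<partial>M)"
      by (intro nn_integral_cong) simp
    then have "(\<integral>\<^sup>+x. ennreal (norm (f x) powr p) \<partial>completion M) < \<infinity>"
      using f'(2) unfolding nn_integral_completion Lp_norm_on_finite_iff by simp
    then show "(\<integral>\<^sup>+x. ennreal (3 powr p) * ennreal (norm (f x) powr p) \<partial>completion M) < \<infinity>"
      by (subst nn_integral_cmult) (auto simp: ennreal_mult_less_top)
    show "AE x in completion M. ennreal (norm (f x - s j x) powr p) \<le>
      ennreal (3 powr p) * ennreal (norm (f x) powr p)" for j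
      using s(3)[of j] unfolding AE_completion_iff
    proof eventually_elim
      case (elim x)
      then have "norm (f x - s j x) powr p \<le> (3 * norm (f x)) powr p"
        using norm_triangle_ineq4[of "f x" "s j x"] p by (intro powr_mono2) auto
      then show ?case by (simp add: powr_mult flip: ennreal_mult)
    qed
    show "AE x in completion M. (\<lambda>i. ennreal (norm (f x - s i x) powr p)) \<longlonglongrightarrow> 0"
      using s(2) unfolding AE_completion_iff
    proof eventually_elim
      case (elim x)
      from tendsto_norm[OF tendsto_diff[OF tendsto_const[of "f x"] elim]]
      have "(\<lambda>i. norm (f x - s i x)) \<longlonglongrightarrow> 0" by simp
      then have "(\<lambda>i. norm (f x - s i x) powr p) \<longlonglongrightarrow> 0"
        using tendsto_powr2[of "\<lambda>i. norm (f x - s i x)" 0 sequentially "\<lambda>_. p" p] p by auto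
      then show ?case by (simp flip: ennreal_0)
    qed
  qed auto
  then have lim: "(\<lambda>i. \<integral>\<^sup>+x. ennreal (norm (f x - s i x) powr p) \<partial>M) \<longlonglongrightarrow> 0"
    by (simp add: nn_integral_completion)
  have "\<forall>\<^sub>F i in sequentially. (\<integral>\<^sup>+x. ennreal (norm (f x - s i x) powr p) \<partial>M) < ennreal ((e / 2) powr p)"
    using lim by (rule order_tendstoD) (use e in auto)
  then obtain i where i: "(\<integral>\<^sup>+x. ennreal (norm (f x - s i x) powr p) \<partial>M) < ennreal ((e / 2) powr p)"
    by (auto simp: eventually_sequentially)
  have "(\<integral>\<^sup>+x\<in>space M. ennreal (norm (f x - s i x) powr p) \<partial>M) =
    (\<integral>\<^sup>+x. ennreal (norm (f x - s i x) powr p) \<partial>M)"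
    by (intro nn_integral_cong) simp
  with i have "Lp_norm_on p M (space M) (\<lambda>x. f x - s i x) \<le> ennreal (e / 2)"
    using p e by (subst Lp_norm_on_le_iff) auto
  also have "\<dots> < ennreal e" using e by (simp add: ennreal_less_iff)
  finally show thesis using that s(1) by blast
qed

section \<open>Classes of functions, their distance and completeness\<close>

lemma Lp_space_imp_function: "F \<in> Lp_space p M \<Longrightarrow> f \<in> F \<Longrightarrow> f \<in> Lp_functions (ennreal p) M"
  unfolding Lp_space_def quotient_def by auto

lemma Lp_space_AE_eq: "F \<in> Lp_space p M \<Longrightarrow> f \<in> F \<Longrightarrow> g \<in> F \<Longrightarrow> AE x in M. f x = g x"
  unfolding Lp_space_def quotient_def by (auto elim!: AE_mp)

lemma Lp_space_nonempty: "F \<in> Lp_space p M \<Longrightarrow> \<exists>f. f \<in> F"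
  unfolding Lp_space_def quotient_def by auto

lemma Lp_space_SOME: "F \<in> Lp_space p M \<Longrightarrow> (SOME f. f \<in> F) \<in> F"
  by (rule someI_ex[OF Lp_space_nonempty])

lemma Lp_space_closed_AE:
  assumes "F \<in> Lp_space p M" "f \<in> F" "AE x in M. f x = g x" "g \<in> Lp_functions (ennreal p) M"
  shows "g \<in> F"
  using assms unfolding Lp_space_def quotient_def by (auto elim!: AE_mp)

lemma Lp_space_eqI:
  assumes FG: "F \<in> Lp_space p M" "G \<in> Lp_space p M" and fg: "f \<in> F" "g \<in> G" "AE x in M. f x = g x"
  shows "F = G"
proof -
  have "f \<in> G"
  proof (rule Lp_space_closed_AE[OF FG(2) fg(2) _ Lp_space_imp_function[OF FG(1) fg(1)]])
    show "AE x in M. g x = f x" using fg(3) by eventually_elim simp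
  qed
  then show ?thesis
    using FG fg by (blast intro: Lp_space_AE_eq Lp_space_closed_AE Lp_space_imp_function)
qed

lemma Lp_space_class:
  assumes "f \<in> Lp_functions (ennreal p) M"
  shows "\<exists>F\<in>Lp_space p M. f \<in> F"
  using assms unfolding Lp_space_def quotient_def by auto

text \<open>Any representatives may be used. Written in \<open>ennreal\<close>, the equation also
  records that the norm of the difference is finite, so that \<open>enn2real\<close> in the
  definition of the distance loses nothing.\<close>

lemma Lp_dist_eq:
  assumes p: "1 \<le> p" and FG: "F \<in> Lp_space p M" "G \<in> Lp_space p M" and fg: "f \<in> F" "g \<in> G"
  shows "ennreal (Lp_dist p M F G) = Lp_norm_on p M (space M) (\<lambda>x. f x - g x)"
proof -
  have a: "AE x in M. (SOME f. f \<in> F) x = f x" "AE x in M. (SOME g. g \<in> G) x = g x"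
    by (rule Lp_space_AE_eq[OF FG(1) Lp_space_SOME[OF FG(1)] fg(1)],
        rule Lp_space_AE_eq[OF FG(2) Lp_space_SOME[OF FG(2)] fg(2)])
  have "Lp_norm_on p M (space M) (\<lambda>x. (SOME f. f \<in> F) x - (SOME g. g \<in> G) x)
     = Lp_norm_on p M (space M) (\<lambda>x. f x - g x)"
    by (rule Lp_norm_on_cong_AE, use a in eventually_elim) auto
  moreover have "Lp_norm_on p M (space M) (\<lambda>x. f x - g x) < \<infinity>"
    using Lp_functions_diff[OF p Lp_space_imp_function[OF FG(1) fg(1)] Lp_space_imp_function[OF
      FG(2) fg(2)]] p
    by (simp add: Lp_functions_iff)
  ultimately show ?thesis by (simp add: Lp_dist_def)
qed

lemma Lp_Metric_space:
  assumes p: "1 \<le> p"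
  shows "Metric_space (Lp_space p M) (Lp_dist p M)"
proof
  show "0 \<le> Lp_dist p M F G" for F G by (simp add: Lp_dist_def)
  show "Lp_dist p M F G = Lp_dist p M G F" for F G
    unfolding Lp_dist_def by (subst Lp_norm_on_minus_commute) simp
  show "(Lp_dist p M F G = 0) = (F = G)" if FG: "F \<in> Lp_space p M" "G \<in> Lp_space p M" for F G
  proof -
    obtain f g where fg: "f \<in> F" "g \<in> G" using Lp_space_nonempty FG by metis
    have d: "strongly_measurable M (\<lambda>x. f x - g x)"
      using Lp_space_imp_function[OF FG(1) fg(1)] Lp_space_imp_function[OF FG(2) fg(2)] p
      by (intro strongly_measurable_diff) (auto simp: Lp_functions_iff)
    show ?thesis
    proof
      assume "Lp_dist p M F G = 0"
      then have "Lp_norm_on p M (space M) (\<lambda>x. f x - g x) = 0" using Lp_dist_eq[OF p FG fg] by simp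
      from Lp_norm_on_eq_0[OF p d this] show "F = G" by (intro Lp_space_eqI[OF FG fg]) simp
    next
      assume "F = G"
      then have ae: "AE x in M. f x = g x" using Lp_space_AE_eq FG fg by metis
      have "Lp_norm_on p M (space M) (\<lambda>x. f x - g x) = Lp_norm_on p M (space M) (\<lambda>x. 0::real)"
        by (rule Lp_norm_on_cong_AE, use ae in eventually_elim) auto
      also have "\<dots> \<le> ennreal 0" using p by (subst Lp_norm_on_le_iff) auto
      finally have "ennreal (Lp_dist p M F G) = 0" using Lp_dist_eq[OF p FG fg] by simp
      moreover have "0 \<le> Lp_dist p M F G" by (simp add: Lp_dist_def)
      ultimately show "Lp_dist p M F G = 0" by simp
    qed
  qed
  show "Lp_dist p M F H \<le> Lp_dist p M F G + Lp_dist p M G H"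
    if FGH: "F \<in> Lp_space p M" "G \<in> Lp_space p M" "H \<in> Lp_space p M" for F G H
  proof -
    obtain f g h where fgh: "f \<in> F" "g \<in> G" "h \<in> H" using Lp_space_nonempty FGH by metis
    have sm: "strongly_measurable M f" "strongly_measurable M g" "strongly_measurable M h"
      using Lp_space_imp_function[OF FGH(1) fgh(1)] Lp_space_imp_function[OF FGH(2) fgh(2)]
        Lp_space_imp_function[OF FGH(3) fgh(3)] p by (auto simp: Lp_functions_iff)
    have "Lp_norm_on p M (space M) (\<lambda>x. f x - h x) \<le>
      Lp_norm_on p M (space M) (\<lambda>x. f x - g x) + Lp_norm_on p M (space M) (\<lambda>x. g x - h x)"
      by (intro Lp_norm_on_triangle_sm[OF p sets.top] strongly_measurable_diff sm)
        (metis norm_diff_triangle_le order_refl)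
    then have "ennreal (Lp_dist p M F H) \<le> ennreal (Lp_dist p M F G) + ennreal (Lp_dist p M G H)"
      using Lp_dist_eq[OF p FGH(1,3) fgh(1,3)] Lp_dist_eq[OF p FGH(1,2) fgh(1,2)] Lp_dist_eq[OF p
        FGH(2,3) fgh(2,3)]
      by simp
    moreover have "0 \<le> Lp_dist p M F G" "0 \<le> Lp_dist p M G H" by (auto simp: Lp_dist_def)
    ultimately show ?thesis by (simp flip: ennreal_plus)
  qed
qed

text \<open>Simple approximants of a rapidly Cauchy sequence converge almost everywhere to a function which
  is then strongly measurable by definition.\<close>

lemma Lp_simple_Cauchy_limit:
  fixes s :: "nat \<Rightarrow> 'a \<Rightarrow> 'b::banach"
  assumes p: "1 \<le> p" and s: "\<And>i. simple_function M (s i)"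
    and c: "\<And>i. Lp_norm_on p M (space M) (\<lambda>x. s (Suc i) x - s i x) \<le> ennreal (c * (1/2) ^ i)" "0 \<le> c"
  obtains f where "strongly_measurable M f"
    "\<And>n. Lp_norm_on p M (space M) (\<lambda>x. f x - s n x) \<le> ennreal (2 * c * (1/2) ^ n)"
proof -
  define d where "d i x = norm (s (Suc i) x - s i x)" for i x
  have d[measurable]: "d i \<in> borel_measurable M" for i
    unfolding d_def by (intro borel_measurable_simple_function simple_function_compose2[OF s s])
  have dn: "0 \<le> d i x" for i x by (simp add: d_def)
  have dc: "Lp_norm_on p M (space M) (d (i + n)) \<le> ennreal (c * (1/2) ^ n * (1/2) ^ i)" for i n
    using c(1)[of "i + n"] unfolding d_def by (simp add: power_add ac_simps)
  \<comment> \<open>The geometric tail from \<open>n\<close> on is the origin of the factor 2 in the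
    final bound.\<close>
  have sc: "summable (\<lambda>i. c * (1/2) ^ n * (1/2) ^ i :: real)" "(\<Sum>i. c * (1/2) ^ n * (1/2) ^ i ::
    real) = 2 * c * (1/2) ^ n" for n
    by (auto simp: suminf_mult summable_geometric suminf_geometric)
  have dc': "0 \<le> c * (1/2) ^ n * (1/2) ^ i" for i n using c(2) by simp
  have ae: "AE x in M. summable (\<lambda>i. d i x)"
    using Lp_norm_on_suminf(1)[OF p, of "\<lambda>i. d (i + 0)", OF d dn dc dc' sc(1)] by simp
  define f where "f x = lim (\<lambda>i. s i x)" for x
  have key: "(\<lambda>i. s i x) \<longlonglongrightarrow> f x" "\<And>n. norm (f x - s n x) \<le> (\<Sum>i. d (i + n) x)"
    if sx: "summable (\<lambda>i. d i x)" for x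
  proof -
    have "summable (\<lambda>i. s (Suc i) x - s i x)" using sx unfolding d_def by (rule summable_norm_cancel)
    then have "(\<lambda>k. \<Sum>i<k. s (Suc i) x - s i x) \<longlonglongrightarrow> (\<Sum>i. s (Suc i) x - s i x)" by (rule summable_LIMSEQ)
    then have "(\<lambda>k. s k x - s 0 x) \<longlonglongrightarrow> (\<Sum>i. s (Suc i) x - s i x)"
      unfolding sum_lessThan_telescope[of "\<lambda>i. s i x"] .
    from tendsto_add[OF this tendsto_const[of "s 0 x"]]
    have "convergent (\<lambda>k. s k x)" by (auto simp: convergent_def)
    then show l: "(\<lambda>i. s i x) \<longlonglongrightarrow> f x" unfolding f_def by (simp add: convergent_LIMSEQ_iff)
    fix n
    have sn: "summable (\<lambda>i. d (i + n) x)" using sx summable_iff_shift[of "\<lambda>i. d i x" n] by simp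
    have b: "norm (s (k + n) x - s n x) \<le> (\<Sum>i. d (i + n) x)" for k
    proof -
      have "s (k + n) x - s n x = (\<Sum>i<k. s (Suc (i + n)) x - s (i + n) x)"
        using sum_lessThan_telescope[of "\<lambda>i. s (i + n) x" k] by simp
      also have "norm \<dots> \<le> (\<Sum>i<k. d (i + n) x)" unfolding d_def by (rule norm_sum)
      also have "\<dots> \<le> (\<Sum>i. d (i + n) x)" by (rule sum_le_suminf[OF sn]) (auto simp: dn)
      finally show ?thesis .
    qed
    have "(\<lambda>k. norm (s (k + n) x - s n x)) \<longlonglongrightarrow> norm (f x - s n x)"
      using l by (intro tendsto_intros LIMSEQ_ignore_initial_segment)
    then show "norm (f x - s n x) \<le> (\<Sum>i. d (i + n) x)" by (rule LIMSEQ_le_const2) (use b in auto)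
  qed
  show thesis
  proof (rule that)
    show "strongly_measurable M f"
      unfolding strongly_measurable_def using s ae key(1) by (intro exI[of _ s]) (auto elim!: AE_mp)
    fix n
    have "Lp_norm_on p M (space M) (\<lambda>x. f x - s n x) \<le> Lp_norm_on p M (space M) (\<lambda>x. \<Sum>i. d (i + n) x)"
    proof (rule Lp_norm_on_mono_AE)
      show "AE x in M. x \<in> space M \<longrightarrow> norm (f x - s n x) \<le> norm (\<Sum>i. d (i + n) x)"
        using ae
      proof eventually_elim
        case (elim x)
        show ?case using key(2)[OF elim, of n] by (simp add: abs_le_D1 order_trans[OF _ abs_ge_self])
      qed
    qed (use p in simp)
    also have "\<dots> \<le> ennreal (2 * c * (1/2) ^ n)"
      using Lp_norm_on_suminf(2)[OF p, of "\<lambda>i. d (i + n)", OF d dn dc dc' sc(1)] by (simp only: sc(2))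
    finally show "Lp_norm_on p M (space M) (\<lambda>x. f x - s n x) \<le> ennreal (2 * c * (1/2) ^ n)" .
  qed
qed

text \<open>The Riesz-Fischer theorem by way of simple functions: along a subsequence with steps
  below \<open>(1/2)^k\<close>, each class is replaced with a simple function at distance below
  \<open>(1/2)^k\<close>. For a Cauchy sequence a convergent subsequence is enough.\<close>

lemma Lp_mcomplete:
  fixes M :: "'a measure"
  assumes p: "1 \<le> p"
  shows "Metric_space.mcomplete (Lp_space p M :: ('a \<Rightarrow> 'b::banach) set set) (Lp_dist p M)"
proof -
  interpret Metric_space "Lp_space p M :: ('a \<Rightarrow> 'b) set set" "Lp_dist p M"
    by (rule Lp_Metric_space[OF p])
  show ?thesis unfolding mcomplete_def
  proof (intro allI impI)
    fix \<sigma> :: "nat \<Rightarrow> ('a \<Rightarrow> 'b) set" assume \<sigma>: "MCauchy \<sigma>"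
    then have in_space: "\<And>n. \<sigma> n \<in> Lp_space p M" by (auto simp: MCauchy_def)
    have "\<exists>N. \<forall>n n'. N \<le> n \<longrightarrow> N \<le> n' \<longrightarrow> Lp_dist p M (\<sigma> n) (\<sigma> n') < (1/2)^k" for k
      using \<sigma> by (simp add: MCauchy_def)
    then obtain N where N: "\<And>k n n'. N k \<le> n \<Longrightarrow> N k \<le> n' \<Longrightarrow> Lp_dist p M (\<sigma> n) (\<sigma> n') < (1/2)^k" by metis
    \<comment> \<open>Strictly increasing and at least \<open>N k\<close> at \<open>k\<close>, so
      that consecutive terms of the subsequence are closer than \<open>(1/2)^k\<close>.\<close>
    define r where "r = rec_nat (N 0) (\<lambda>k r. max (Suc r) (N (Suc k)))"
    have r: "strict_mono r" by (rule strict_mono_Suc_iff[THEN iffD2]) (auto simp: r_def)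
    have rN: "N k \<le> r k" for k by (cases k) (auto simp: r_def)
    have "\<exists>f. f \<in> \<sigma> (r k)" for k by (rule Lp_space_nonempty[OF in_space])
    then obtain f where f: "\<And>k. f k \<in> \<sigma> (r k)" by metis
    have fL: "f k \<in> Lp_functions (ennreal p) M" for k by (rule Lp_space_imp_function[OF in_space f])
    have fsm: "strongly_measurable M (f k)" for k using fL p by (simp add: Lp_functions_iff)
    have "\<exists>s. simple_function M s \<and> Lp_norm_on p M (space M) (\<lambda>x. f k x - s x) < ennreal ((1/2)^k)" for k
      using Lp_simple_dense[OF p fL, of "(1/2)^k"] by (metis half_gt_zero zero_less_one zero_less_power)
    then obtain s where s: "\<And>k. simple_function M (s k)"
      "\<And>k. Lp_norm_on p M (space M) (\<lambda>x. f k x - s k x) < ennreal ((1/2)^k)" by metis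
    have ssm: "strongly_measurable M (s k)" for k using s(1) by (rule strongly_measurable_simple)
    \<comment> \<open>The path runs from \<open>s (Suc k)\<close> over \<open>f (Suc k)\<close> and
      \<open>f k\<close> to \<open>s k\<close>, and each of its three parts is at most
      \<open>(1/2)^k\<close> long.\<close>
    have "Lp_norm_on p M (space M) (\<lambda>x. s (Suc k) x - s k x) \<le> ennreal (3 * (1/2)^k)" for k
    proof -
      have "Lp_norm_on p M (space M) (\<lambda>x. s (Suc k) x - s k x) \<le>
         Lp_norm_on p M (space M) (\<lambda>x. f (Suc k) x - s (Suc k) x) +
           Lp_norm_on p M (space M) (\<lambda>x. f (Suc k) x - s k x)"
        by (intro Lp_norm_on_triangle_sm[OF p sets.top] strongly_measurable_diff fsm ssm)
          (metis norm_diff_triangle_le norm_minus_commute order_refl)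
      also have "Lp_norm_on p M (space M) (\<lambda>x. f (Suc k) x - s k x) \<le>
         Lp_norm_on p M (space M) (\<lambda>x. f (Suc k) x - f k x) +
           Lp_norm_on p M (space M) (\<lambda>x. f k x - s k x)"
        by (intro Lp_norm_on_triangle_sm[OF p sets.top] strongly_measurable_diff fsm ssm)
          (metis norm_diff_triangle_le order_refl)
      also have "Lp_norm_on p M (space M) (\<lambda>x. f (Suc k) x - f k x) \<le> ennreal ((1/2)^k)"
        unfolding Lp_dist_eq[OF p in_space in_space f f, symmetric]
        using N[of k "r (Suc k)" "r k"] rN[of k] strict_mono_less[OF r, of k "Suc k"]
          by (intro ennreal_leI) auto
      also have "Lp_norm_on p M (space M) (\<lambda>x. f k x - s k x) \<le> ennreal ((1/2)^k)" using s(2)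
        by (rule less_imp_le)
      also have "Lp_norm_on p M (space M) (\<lambda>x. f (Suc k) x - s (Suc k) x) \<le> ennreal ((1/2)^Suc k)"
        using s(2) by (rule less_imp_le)
      also have "ennreal ((1/2)^Suc k) + (ennreal ((1/2)^k) + ennreal ((1/2)^k)) \<le> ennreal (3 * (1/2)^k)"
        by (simp flip: ennreal_plus)
      finally show ?thesis by (simp add: add_left_mono add_right_mono)
    qed
    from Lp_simple_Cauchy_limit[OF p s(1) this zero_le_numeral]
    obtain g where g: "strongly_measurable M g"
      "\<And>n. Lp_norm_on p M (space M) (\<lambda>x. g x - s n x) \<le> ennreal (2 * 3 * (1/2) ^ n)" by blast
    \<comment> \<open>The constant is 1 + 6: the distance from \<open>f n\<close> to
      \<open>s n\<close>, and the bound \<open>2 * 3\<close> for the distance from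
      \<open>s n\<close> to the limit.\<close>
    have gf: "Lp_norm_on p M (space M) (\<lambda>x. f n x - g x) \<le> ennreal (7 * (1/2)^n)" for n
    proof -
      have "Lp_norm_on p M (space M) (\<lambda>x. f n x - g x) \<le>
         Lp_norm_on p M (space M) (\<lambda>x. f n x - s n x) + Lp_norm_on p M (space M) (\<lambda>x. g x - s n x)"
        by (intro Lp_norm_on_triangle_sm[OF p sets.top] strongly_measurable_diff fsm ssm g)
          (metis norm_diff_triangle_le norm_minus_commute order_refl)
      also have "\<dots> \<le> ennreal ((1/2)^n) + ennreal (2 * 3 * (1/2) ^ n)"
        using s(2)[of n] g(2)[of n] by (intro add_mono) auto
      also have "\<dots> = ennreal (7 * (1/2)^n)" by (simp flip: ennreal_plus)
      finally show ?thesis .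
    qed
    have "Lp_norm_on p M (space M) g \<le> Lp_norm_on p M (space M) (f 0) +
      Lp_norm_on p M (space M) (\<lambda>x. f 0 x - g x)"
      by (intro Lp_norm_on_triangle_sm[OF p sets.top] strongly_measurable_diff fsm ssm g)
        (auto intro: norm_triangle_sub simp: norm_minus_commute)
    also have "\<dots> < \<infinity>" using gf[of 0] fL[of 0] p by (auto simp: Lp_functions_iff intro: le_less_trans)
    finally have "g \<in> Lp_functions (ennreal p) M" using g p by (simp add: Lp_functions_iff)
    then obtain G where G: "G \<in> Lp_space p M" "g \<in> G" using Lp_space_class by blast
    have "limitin mtopology (\<sigma> \<circ> r) G sequentially"
      unfolding limitin_metric
    proof (intro conjI G allI impI)
      fix \<epsilon> :: real assume "\<epsilon> > 0"
      have "(\<lambda>n. 7 * (1/2)^n :: real) \<longlonglongrightarrow> 7 * 0"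
        by (intro tendsto_mult tendsto_const LIMSEQ_power_zero) simp
      then have "\<forall>\<^sub>F n in sequentially. 7 * (1/2)^n < \<epsilon>" by (rule order_tendstoD) (use \<open>\<epsilon> > 0\<close> in simp)
      then show "\<forall>\<^sub>F n in sequentially. (\<sigma> \<circ> r) n \<in> Lp_space p M \<and> Lp_dist p M ((\<sigma> \<circ> r) n) G < \<epsilon>"
      proof eventually_elim
        case (elim n)
        have "ennreal (Lp_dist p M (\<sigma> (r n)) G) \<le> ennreal (7 * (1/2)^n)"
          unfolding Lp_dist_eq[OF p in_space G(1) f G(2)] by (rule gf)
        then show ?case using elim in_space by simp
      qed
    qed
    then show "\<exists>x. limitin mtopology \<sigma> x sequentially"
      using MCauchy_convergent_subsequence[OF \<sigma> r] by blast
  qed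
qed

section \<open>Relative compactness as total boundedness\<close>

lemma Lp_relatively_compact_iff:
  fixes \<Gamma> :: "('a \<Rightarrow> 'b::banach) set set"
  assumes p: "1 \<le> p" and \<Gamma>: "\<Gamma> \<subseteq> Lp_space p M"
  shows "compactin (Lp_topology p M) (Lp_topology p M closure_of \<Gamma>) \<longleftrightarrow>
    Metric_space.mtotally_bounded (Lp_space p M) (Lp_dist p M) \<Gamma>"
proof -
  interpret Metric_space "Lp_space p M :: ('a \<Rightarrow> 'b) set set" "Lp_dist p M"
    by (rule Lp_Metric_space[OF p])
  show ?thesis
    using mtotally_bounded_eq_compact_closure_of[OF Lp_mcomplete[OF p]] \<Gamma> by (simp add: Lp_topology_def)
qed

text \<open>The net consists of functions instead of classes, since the later estimates concern
  single functions, and it serves every representative of every class.\<close>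

lemma Lp_totally_bounded_imp_net:
  fixes \<Gamma> :: "('a \<Rightarrow> 'b::banach) set set"
  assumes p: "1 \<le> p" and tb: "Metric_space.mtotally_bounded (Lp_space p M) (Lp_dist p M) \<Gamma>"
    and e: "0 < e"
  obtains K where "finite K" "K \<subseteq> Lp_functions (ennreal p) M" "K \<subseteq> \<Union>\<Gamma>"
    "\<And>F f. F \<in> \<Gamma> \<Longrightarrow> f \<in> F \<Longrightarrow> \<exists>g\<in>K. Lp_norm_on p M (space M) (\<lambda>x. f x - g x) < ennreal e"
proof -
  interpret Metric_space "Lp_space p M :: ('a \<Rightarrow> 'b) set set" "Lp_dist p M"
    by (rule Lp_Metric_space[OF p])
  have \<Gamma>: "\<Gamma> \<subseteq> Lp_space p M" by (rule mtotally_bounded_imp_subset[OF tb])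
  have "\<exists>K. finite K \<and> K \<subseteq> \<Gamma> \<and> \<Gamma> \<subseteq> (\<Union>x\<in>K. mball x e)"
    using tb e unfolding mtotally_bounded_def by (elim allE[of _ e]) simp
  then obtain K where K: "finite K" "K \<subseteq> \<Gamma>" "\<Gamma> \<subseteq> (\<Union>x\<in>K. mball x e)"
    by (elim exE conjE)
  show thesis
  proof (rule that[of "(\<lambda>G. SOME g. g \<in> G) ` K"])
    have s: "(SOME g. g \<in> G) \<in> G" "G \<in> Lp_space p M" if "G \<in> K" for G using that K \<Gamma> Lp_space_SOME
      by blast+
    show "(\<lambda>G. SOME g. g \<in> G) ` K \<subseteq> Lp_functions (ennreal p) M" using s Lp_space_imp_function by blast
    show "(\<lambda>G. SOME g. g \<in> G) ` K \<subseteq> \<Union>\<Gamma>" using s K by auto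
    fix F f assume Ff: "F \<in> \<Gamma>" "f \<in> F"
    then obtain G where G: "G \<in> K" "F \<in> mball G e" using K by auto
    have "Lp_norm_on p M (space M) (\<lambda>x. f x - (SOME g. g \<in> G) x) = ennreal (Lp_dist p M F G)"
      using Lp_dist_eq[OF p _ s(2)[OF G(1)] Ff(2) s(1)[OF G(1)]] Ff \<Gamma> by auto
    also have "\<dots> < ennreal e" using G e by (simp add: in_mball commute ennreal_less_iff)
    finally show "\<exists>g\<in>(\<lambda>G. SOME g. g \<in> G) ` K. Lp_norm_on p M (space M) (\<lambda>x. f x - g x) < ennreal e"
      using G(1) by blast
  qed (use K in auto)
qed

text \<open>One class is picked for each value of the code that occurs; these finitely many classes
  form a net, and they lie in \<open>\<Gamma>\<close> automatically. In the application the code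
  records finitely many averages up to an error.\<close>

lemma Lp_totally_boundedI:
  fixes \<Gamma> :: "('a \<Rightarrow> 'b::banach) set set"
  assumes p: "1 \<le> p" and \<Gamma>: "\<Gamma> \<subseteq> Lp_space p M"
    and code: "\<And>e. 0 < e \<Longrightarrow> \<exists>code::('a \<Rightarrow> 'b) set \<Rightarrow> 'c. finite (code ` \<Gamma>) \<and> (\<forall>F\<in>\<Gamma>. \<forall>G\<in>\<Gamma>. code F = code G \<longrightarrow>
       (\<exists>f\<in>F. \<exists>g\<in>G. Lp_norm_on p M (space M) (\<lambda>x. f x - g x) < ennreal e))"
  shows "Metric_space.mtotally_bounded (Lp_space p M) (Lp_dist p M) \<Gamma>"
proof -
  interpret Metric_space "Lp_space p M :: ('a \<Rightarrow> 'b) set set" "Lp_dist p M"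
    by (rule Lp_Metric_space[OF p])
  show ?thesis unfolding mtotally_bounded_def
  proof (intro allI impI)
    fix e :: real assume e: "0 < e"
    from code[OF this] obtain c :: "('a \<Rightarrow> 'b) set \<Rightarrow> 'c" where c: "finite (c ` \<Gamma>)"
      "\<And>F G. F \<in> \<Gamma> \<Longrightarrow> G \<in> \<Gamma> \<Longrightarrow> c F = c G \<Longrightarrow> \<exists>f\<in>F. \<exists>g\<in>G. Lp_norm_on p M (space M) (\<lambda>x. f x - g x) <
        ennreal e"
      by blast
    define rep where "rep = inv_into \<Gamma> c"
    have rep: "rep (c F) \<in> \<Gamma>" "c (rep (c F)) = c F" if "F \<in> \<Gamma>" for F
      using that unfolding rep_def by (auto intro: inv_into_into f_inv_into_f)
    show "\<exists>K. finite K \<and> K \<subseteq> \<Gamma> \<and> \<Gamma> \<subseteq> (\<Union>x\<in>K. mball x e)"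
    proof (intro exI conjI subsetI)
      show "finite (rep ` c ` \<Gamma>)" using c(1) by (rule finite_imageI)
      show "x \<in> \<Gamma>" if "x \<in> rep ` c ` \<Gamma>" for x using rep that by auto
      show "F \<in> (\<Union>x\<in>rep ` c ` \<Gamma>. mball x e)" if F: "F \<in> \<Gamma>" for F
      proof -
        obtain f g where fg: "f \<in> rep (c F)" "g \<in> F" "Lp_norm_on p M (space M) (\<lambda>x. f x - g x) <
          ennreal e"
          using c(2)[OF rep(1)[OF F] F rep(2)[OF F]] by blast
        have FG: "rep (c F) \<in> Lp_space p M" "F \<in> Lp_space p M" using rep[OF F] F \<Gamma> by auto
        have "ennreal (Lp_dist p M (rep (c F)) F) < ennreal e"
          using Lp_dist_eq[OF p FG fg(1,2)] fg(3) by simp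
        then have "F \<in> mball (rep (c F)) e" using FG e by (simp add: in_mball ennreal_less_iff)
        then show ?thesis using F by blast
      qed
    qed
  qed
qed

section \<open>Compactness in topological groups\<close>

lemma compact_add_set:
  fixes K L :: "'g::topological_group_add set"
  assumes "compact K" "compact L"
  shows "compact ((\<lambda>(x, y). x + y) ` (K \<times> L))"
  using assms by (intro compact_continuous_image compact_Times)
    (auto simp: case_prod_beta intro!: continuous_intros)

lemma compact_uminus_set:
  fixes K :: "'g::topological_group_add set"
  assumes "compact K"
  shows "compact (uminus ` K)"
  using assms by (intro compact_continuous_image) (auto intro!: continuous_intros)

lemma continuous_on_add_left: "continuous_on UNIV (\<lambda>x. h + x :: 'g::topological_group_add)"
  by (intro continuous_intros)

lemma continuous_on_uminus: "continuous_on UNIV (uminus :: 'g::topological_group_add \<Rightarrow> 'g)"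
  by (intro continuous_intros)

lemma open_translate: "open U \<Longrightarrow> open {x. h + x \<in> (U :: 'g::topological_group_add set)}"
  using open_vimage[OF _ continuous_on_add_left[of h]] by (simp add: vimage_def)

lemma open_uminus_vimage: "open U \<Longrightarrow> open (uminus -` (U :: 'g::topological_group_add set))"
  by (rule open_vimage[OF _ continuous_on_uminus])

text \<open>A finite subcover made disjoint. On each piece a continuous function will be almost
  constant. The point \<open>xs i\<close> lies in \<open>K\<close>, but not necessarily in the piece
  \<open>P i\<close>.\<close>

lemma finite_borel_partition:
  fixes K :: "'g::t2_space set"
  assumes K: "compact K" and N: "\<And>x. x \<in> K \<Longrightarrow> open (N x) \<and> x \<in> N x"
    and A: "A \<in> sets borel" "A \<subseteq> K"
  obtains n :: nat and xs P where "\<And>i. i < n \<Longrightarrow> xs i \<in> K" "\<And>i. P i \<in> sets borel"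
    "\<And>i. i < n \<Longrightarrow> P i \<subseteq> N (xs i)" "disjoint_family P" "(\<Union>i<n. P i) = A"
proof -
  obtain C where C: "C \<subseteq> K" "finite C" "K \<subseteq> (\<Union>x\<in>C. N x)"
    using compactE_image[OF K, of K N] N by (metis (no_types, lifting) UN_I subsetI)
  then obtain xs :: "nat \<Rightarrow> 'g" and n where xs: "C = xs ` {..<n}"
    by (metis finite_imp_nat_seg_image_inj_on lessThan_def)
  define Q where "Q i = (if i < n then A \<inter> N (xs i) else {})" for i
  have Q: "Q i \<in> sets borel" for i
    using A N[of "xs i"] C(1) xs by (auto simp: Q_def)
  show thesis
  proof (rule that)
    show "xs i \<in> K" if "i < n" for i using C xs that by auto
    show "disjointed Q i \<in> sets borel" for i using sets.range_disjointed_sets[of Q borel] Q by auto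
    show "disjointed Q i \<subseteq> N (xs i)" if "i < n" for i
      using disjointed_subset[of Q i] that by (auto simp: Q_def)
    show "disjoint_family (disjointed Q)" by (rule disjoint_family_disjointed)
    have "(\<Union>i<n. disjointed Q i) = (\<Union>i<n. Q i)" using finite_UN_disjointed_eq[of Q n]
      by (simp add: atLeast0LessThan)
    also have "\<dots> = A" using A C xs by (auto simp: Q_def)
    finally show "(\<Union>i<n. disjointed Q i) = A" .
  qed
qed

text \<open>The tube lemma for the open set of pairs \<open>(v, e)\<close> with
  \<open>e + v \<in> U\<close>, which contains \<open>{0} \<times> E\<close>.\<close>

lemma compact_add_open_subset:
  fixes E :: "'g::topological_group_add set"
  assumes "compact E" "open U" "E \<subseteq> U"
  obtains V where "open V" "0 \<in> V" "\<And>e v. e \<in> E \<Longrightarrow> v \<in> V \<Longrightarrow> e + v \<in> U"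
proof -
  have o: "open {p. snd p + fst p \<in> U}"
    using open_vimage[OF assms(2), of "\<lambda>p. snd p + fst p"] by (simp add: vimage_def continuous_intros)
  have "{0} \<times> E \<subseteq> {p. snd p + fst p \<in> U}" using assms(3) by auto
  from Elementary_Topology.tube_lemma[OF assms(1) o this]
  obtain V where "0 \<in> V" "open V" "V \<times> E \<subseteq> {p. snd p + fst p \<in> U}" by (elim exE conjE)
  then show thesis by (intro that[of V]) auto
qed

lemma Hausdorff_space_t2: "Hausdorff_space (euclidean :: 'a::t2_space topology)"
  unfolding Hausdorff_space_def disjnt_def by (simp, metis hausdorff)

section \<open>Haar measure\<close>

locale haar =
  fixes \<mu> :: "'g::{topological_group_add, t2_space} measure"
  assumes locally_compact: "locally_compact_space (euclidean :: 'g topology)"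
    and left_haar: "left_haar_measure \<mu>"
begin

lemma sets_haar [simp, measurable_cong]: "sets \<mu> = sets borel"
  using left_haar by (simp add: left_haar_measure_def)

lemma space_haar [simp]: "space \<mu> = UNIV"
  using sets_eq_imp_space_eq[OF sets_haar] by simp

lemma emeasure_compact_finite: "compact K \<Longrightarrow> emeasure \<mu> K < \<infinity>"
  using left_haar unfolding left_haar_measure_def by (elim conjE, elim allE[of _ K]) (rule mp)

lemma outer_regular:
  assumes "A \<in> sets borel"
  shows "emeasure \<mu> A = (INF U\<in>{U. open U \<and> A \<subseteq> U}. emeasure \<mu> U)"
proof -
  have "\<forall>A\<in>sets borel. emeasure \<mu> A = (INF U\<in>{U. open U \<and> A \<subseteq> U}. emeasure \<mu> U)"
    using left_haar unfolding left_haar_measure_def by (elim conjE)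
  then show ?thesis using assms by (rule bspec)
qed

lemma inner_regular_open: "open U \<Longrightarrow> emeasure \<mu> U = (SUP K\<in>{K. compact K \<and> K \<subseteq> U}. emeasure \<mu> K)"
  using left_haar unfolding left_haar_measure_def by (elim conjE, elim allE[of _ U]) (rule mp)

lemma compact_borel: "compact (K :: 'g set) \<Longrightarrow> K \<in> sets borel"
  by (simp add: borel_closed compact_imp_closed)

lemma measurable_add_left [measurable]: "(\<lambda>x. h + x) \<in> (borel :: 'g measure) \<rightarrow>\<^sub>M borel"
  by (rule borel_measurable_continuous_onI[OF continuous_on_add_left])

lemma measurable_uminus [measurable]: "uminus \<in> (borel :: 'g measure) \<rightarrow>\<^sub>M borel"
  by (rule borel_measurable_continuous_onI[OF continuous_on_uminus])

lemma uminus_vimage_borel: "E \<in> sets borel \<Longrightarrow> uminus -` E \<in> sets (borel :: 'g measure)"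
  using measurable_sets[OF measurable_uminus, of E] by simp

lemma translate_vimage_borel: "E \<in> sets borel \<Longrightarrow> {x. h + x \<in> E} \<in> sets (borel :: 'g measure)"
  using measurable_sets[OF measurable_add_left[of h], of E] by (simp add: vimage_def)

lemma emeasure_translate:
  assumes "A \<in> sets borel"
  shows "emeasure \<mu> {x. h + x \<in> A} = emeasure \<mu> A"
proof -
  have "{x. h + x \<in> A} = (+) (- h) ` A"
    by (auto simp: image_iff add.assoc[symmetric] intro!: bexI[of _ "h + _"])
  then show ?thesis using left_haar assms by (simp add: left_haar_measure_def)
qed

lemma distr_translate: "distr \<mu> \<mu> ((+) h) = \<mu>"
proof (rule measure_eqI)
  fix A assume "A \<in> sets (distr \<mu> \<mu> ((+) h))"
  then show "emeasure (distr \<mu> \<mu> ((+) h)) A = emeasure \<mu> A"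
    using emeasure_translate[of A h] by (simp add: emeasure_distr vimage_def)
qed simp

lemma AE_translate:
  assumes "AE x in \<mu>. P x"
  shows "AE x in \<mu>. P (h + x)"
proof -
  have "AE x in distr \<mu> \<mu> ((+) h). P x" using assms by (subst distr_translate)
  then show ?thesis by (rule AE_distrD[rotated]) simp
qed

text \<open>The integrand is measurable for the completion only, as norms of strongly measurable
  functions are; a Borel version is shifted in its place.\<close>

lemma nn_integral_translate:
  assumes "f \<in> borel_measurable (completion \<mu>)"
  shows "(\<integral>\<^sup>+x. f (h + x) \<partial>\<mu>) = (\<integral>\<^sup>+x. f x \<partial>\<mu>)"
proof -
  obtain f' where f': "f' \<in> borel_measurable \<mu>" "AE x in \<mu>. f x = f' x"
    using completion_ex_borel_measurable[OF assms] by blast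
  have "(\<integral>\<^sup>+x. f (h + x) \<partial>\<mu>) = (\<integral>\<^sup>+x. f' (h + x) \<partial>\<mu>)"
    by (rule nn_integral_cong_AE[OF AE_translate[OF f'(2)]])
  also have "\<dots> = (\<integral>\<^sup>+x. f' x \<partial>distr \<mu> \<mu> ((+) h))"
    using f'(1) by (subst nn_integral_distr) auto
  also have "\<dots> = (\<integral>\<^sup>+x. f x \<partial>\<mu>)"
    unfolding distr_translate by (rule nn_integral_cong_AE, use f'(2) in eventually_elim) simp
  finally show ?thesis .
qed

lemma compact_open_neighbourhood:
  assumes "compact (K :: 'g set)"
  obtains U L where "open U" "compact L" "K \<subseteq> U" "U \<subseteq> L"
proof -
  have "Hausdorff_space (euclidean :: 'g topology)" by (rule Hausdorff_space_t2)
  then show thesis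
    using locally_compact_space_compact_closed_compact[of "euclidean :: 'g topology"]
      locally_compact assms that
    by auto
qed

lemma compact_open_between:
  assumes "compact (K :: 'g set)" "open U" "K \<subseteq> U"
  obtains V L where "open V" "compact L" "K \<subseteq> V" "V \<subseteq> L" "L \<subseteq> U"
proof -
  have "Hausdorff_space (euclidean :: 'g topology)" by (rule Hausdorff_space_t2)
  then have "neighbourhood_base_of (compactin euclidean) (euclidean :: 'g topology)"
    using locally_compact_space_neighbourhood_base locally_compact by blast
  then have "\<exists>O' L. open O' \<and> compact L \<and> x \<in> O' \<and> O' \<subseteq> L \<and> L \<subseteq> U" if "x \<in> K" for x
    using assms(2,3) that by (auto simp: neighbourhood_base_of)
  then obtain O' L where OL: "\<And>x. x \<in> K \<Longrightarrow> open (O' x) \<and> compact (L x) \<and> x \<in> O' x \<and> O' x \<subseteq> L x \<and> L x \<subseteq> U"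
    by metis
  obtain C where C: "C \<subseteq> K" "finite C" "K \<subseteq> (\<Union>x\<in>C. O' x)"
    using compactE_image[OF assms(1), of K O'] OL by (metis (no_types, lifting) UN_I subsetI)
  show thesis
  proof (rule that[of "\<Union>x\<in>C. O' x" "\<Union>x\<in>C. L x"])
    show "compact (\<Union>x\<in>C. L x)" using C OL by (intro compact_UN) auto
    show "open (\<Union>x\<in>C. O' x)" using C OL by (intro open_UN) auto
    show "K \<subseteq> (\<Union>x\<in>C. O' x)" by fact
    show "(\<Union>x\<in>C. O' x) \<subseteq> (\<Union>x\<in>C. L x)" using C(1) OL by (intro UN_mono) auto
    show "(\<Union>x\<in>C. L x) \<subseteq> U" using C(1) OL by (intro UN_least) auto
  qed
qed

text \<open>If \<open>U\<close> were null, so would be its translates, finitely many of which cover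
  any given compact set; inner regularity would then make the whole group null.\<close>

lemma emeasure_open_pos:
  assumes "open (U :: 'g set)" "U \<noteq> {}"
  shows "0 < emeasure \<mu> U"
proof (rule ccontr)
  assume "\<not> 0 < emeasure \<mu> U"
  then have 0: "emeasure \<mu> U = 0" by (simp add: zero_less_iff_neq_zero)
  obtain u where u: "u \<in> U" using assms by auto
  have "emeasure \<mu> K = 0" if K: "compact K" for K :: "'g set"
  proof -
    define N where "N x = {y. u - x + y \<in> U}" for x
    have N: "open (N x) \<and> x \<in> N x" for x using open_translate[OF assms(1)] u by (simp add: N_def)
    obtain C where C: "C \<subseteq> K" "finite C" "K \<subseteq> (\<Union>x\<in>C. N x)"
      using compactE_image[OF K, of K N] N by (metis (no_types, lifting) UN_I subsetI)
    have b: "N x \<in> sets borel" for x using N by auto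
    have "emeasure \<mu> K \<le> emeasure \<mu> (\<Union>x\<in>C. N x)" using C b by (intro emeasure_mono sets.finite_UN) auto
    also have "\<dots> \<le> (\<Sum>x\<in>C. emeasure \<mu> (N x))" using C b by (intro emeasure_subadditive_finite) auto
    also have "\<dots> = 0" using assms(1) 0 by (simp add: N_def emeasure_translate borel_open)
    finally show ?thesis by simp
  qed
  then have "(SUP K\<in>{K :: 'g set. compact K \<and> K \<subseteq> UNIV}. emeasure \<mu> K) \<le> 0" by (intro SUP_least) simp
  then have "emeasure \<mu> UNIV \<le> 0" by (subst inner_regular_open) auto
  then show False using left_haar by (simp add: left_haar_measure_def)
qed

lemma ennreal_less_add_self:
  assumes "x < \<infinity>" "0 < e"
  shows "x < x + ennreal e"
  using assms by (cases x rule: ennreal_cases) (auto simp: ennreal_less_iff simp flip: ennreal_plus)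

lemma outer_regular_approx:
  assumes B: "B \<in> sets borel" "emeasure \<mu> B < \<infinity>" and e: "0 < e"
  obtains U where "open U" "B \<subseteq> U" "emeasure \<mu> U < emeasure \<mu> B + ennreal e"
proof -
  have "emeasure \<mu> B < emeasure \<mu> B + ennreal e" using B(2) e by (rule ennreal_less_add_self)
  then have "(INF U\<in>{U. open U \<and> B \<subseteq> U}. emeasure \<mu> U) < emeasure \<mu> B + ennreal e"
    by (subst outer_regular[OF B(1), symmetric])
  then show thesis using that by (auto simp: INF_less_iff)
qed

text \<open>The definition of the measure grants inner regularity for open sets. For
  \<open>A\<close> it results from an open \<open>U\<close> around \<open>A\<close>, a compact
  \<open>K1\<close> inside \<open>U\<close>, and an open \<open>U2\<close> around the excess
  \<open>U - A\<close>: the set \<open>K1 - U2\<close> is compact and lies in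
  \<open>A\<close>.\<close>

lemma inner_regular_finite:
  assumes A: "A \<in> sets borel" "emeasure \<mu> A < \<infinity>" and e: "0 < e"
  obtains K where "compact K" "K \<subseteq> A" "emeasure \<mu> (A - K) < ennreal e"
proof -
  have e4: "0 < e / 4" using e by simp
  obtain U where U: "open U" "A \<subseteq> U" "emeasure \<mu> U < emeasure \<mu> A + ennreal (e / 4)"
    using outer_regular_approx[OF A e4] by blast
  have Uf: "emeasure \<mu> U < \<infinity>" using U(3) A(2) by (metis ennreal_add_eq_top ennreal_neq_top
    infinity_ennreal_def less_top order_less_trans)
  have UA: "emeasure \<mu> (U - A) < ennreal (e / 4)"
    using U A Uf by (subst emeasure_Diff) (auto simp: borel_open minus_less_iff_ennreal
      emeasure_mono add.commute)
  have UAb: "U - A \<in> sets borel" "emeasure \<mu> (U - A) < \<infinity>" using U A UA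
    by (auto simp: borel_open intro: order_less_trans)
  obtain U2 where U2: "open U2" "U - A \<subseteq> U2" "emeasure \<mu> U2 < emeasure \<mu> (U - A) + ennreal (e / 4)"
    using outer_regular_approx[OF UAb e4] by blast
  have U2e: "emeasure \<mu> U2 < ennreal (e / 2)"
  proof -
    have "emeasure \<mu> (U - A) + ennreal (e / 4) \<le> ennreal (e / 4) + ennreal (e / 4)" using UA
      by (intro add_mono) auto
    also have "\<dots> = ennreal (e / 2)" using e by (simp flip: ennreal_plus)
    finally show ?thesis using U2 by simp
  qed
  \<comment> \<open>A small \<open>U\<close> is settled by the empty set; otherwise the subtraction
    in \<open>ennreal\<close> is exact.\<close>
  have "\<exists>K1. compact K1 \<and> K1 \<subseteq> U \<and> emeasure \<mu> U < emeasure \<mu> K1 + ennreal (e / 2)"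
  proof (cases "emeasure \<mu> U < ennreal (e / 2)")
    case True then show ?thesis by (intro exI[of _ "{}"]) auto
  next
    case False
    have "emeasure \<mu> U - ennreal (e / 2) < (SUP K\<in>{K. compact K \<and> K \<subseteq> U}. emeasure \<mu> K)"
      using False Uf e by (subst inner_regular_open[OF U(1), symmetric], subst minus_less_iff_ennreal)
        (auto simp: not_less intro!: ennreal_less_add_self)
    then obtain K1 where "compact K1" "K1 \<subseteq> U" "emeasure \<mu> U - ennreal (e / 2) < emeasure \<mu> K1"
      by (auto simp: less_SUP_iff)
    then show ?thesis using False by (intro exI[of _ K1]) (simp add: minus_less_iff_ennreal not_less)
  qed
  then obtain K1 where K1: "compact K1" "K1 \<subseteq> U" "emeasure \<mu> U < emeasure \<mu> K1 + ennreal (e / 2)"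
    by blast
  have UK: "emeasure \<mu> (U - K1) < ennreal (e / 2)"
    using U K1 emeasure_compact_finite[OF K1(1)]
    by (subst emeasure_Diff) (auto simp: borel_open compact_borel minus_less_iff_ennreal
      emeasure_mono add.commute)
  show thesis
  proof (rule that[of "K1 - U2"])
    show "compact (K1 - U2)" using K1 U2 by (intro compact_diff)
    show "K1 - U2 \<subseteq> A" using K1 U2 by auto
    have "emeasure \<mu> (A - (K1 - U2)) \<le> emeasure \<mu> ((U - K1) \<union> U2)"
      using U borel_open[OF U(1)] borel_open[OF U2(1)] U2(2) compact_borel[OF K1(1)]
      by (intro emeasure_mono) (auto intro!: sets.Un)
    also have "\<dots> \<le> emeasure \<mu> (U - K1) + emeasure \<mu> U2"
      using borel_open[OF U(1)] borel_open[OF U2(1)] compact_borel[OF K1(1)]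
        by (intro emeasure_subadditive) auto
    also have "\<dots> < ennreal (e / 2) + ennreal (e / 2)" using UK U2e by (intro add_strict_mono)
    also have "\<dots> = ennreal e" using e by (simp flip: ennreal_plus)
    finally show "emeasure \<mu> (A - (K1 - U2)) < ennreal e" .
  qed
qed

section \<open>Reflection\<close>

text \<open>A discrete substitute for Fubini's theorem (which is not available, since the Borel sets of the
  product may be larger than the product of the Borel sets): with \<open>P i\<close> partitioning \<open>W\<close> and \<open>Q j\<close>
  partitioning \<open>U\<close> into small pieces,
  \<open>\<Sum>i. \<mu> (P i) * 1\<^sub>E (- z + x i) \<le> \<mu> (W \<inter> (z + U)) = \<mu> ((- z + W) \<inter> U) \<le> \<Sum>j. \<mu> (Q j) * 1\<^sub>D (z + y j)\<close>,
  and the two ends are integrated over \<open>z\<close>.\<close>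

lemma reflection_bound_aux:
  assumes W: "open W" "0 \<in> W" "W \<subseteq> K" "compact K"
    and E: "compact E" "E \<subseteq> U" and U: "open U" "U \<subseteq> L" "compact L"
    and D: "D \<in> sets borel" "\<And>a b. a \<in> W \<Longrightarrow> b \<in> W \<Longrightarrow> a - b \<in> D"
    and C: "\<And>x. x \<in> L \<Longrightarrow> emeasure \<mu> {z. z + x \<in> D} \<le> C"
  shows "emeasure \<mu> (uminus ` E) * emeasure \<mu> W \<le> C * emeasure \<mu> U"
proof -
  have WU[measurable]: "W \<in> sets borel" "U \<in> sets borel" using W U by auto
  obtain V where V: "open V" "0 \<in> V" "\<And>e v. e \<in> E \<Longrightarrow> v \<in> V \<Longrightarrow> e + v \<in> U"
    using compact_add_open_subset[OF E(1) U(1) E(2)] by blast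
  have "open {y. - x + y \<in> V} \<and> x \<in> {y. - x + y \<in> V}" for x using V open_translate by auto
  from finite_borel_partition[where N="\<lambda>x. {y. - x + y \<in> V}", OF W(4) this WU(1) W(3)]
  obtain n :: nat and x P where P: "\<And>i. P i \<in> sets borel"
    "\<And>i. i < n \<Longrightarrow> P i \<subseteq> {y. - x i + y \<in> V}" "disjoint_family P" "(\<Union>i<n. P i) = W" by metis
  have "open {y. - x + y \<in> W} \<and> x \<in> {y. - x + y \<in> W}" for x using W open_translate by auto
  from finite_borel_partition[where N="\<lambda>x. {y. - x + y \<in> W}", OF U(3) this WU(2) U(2)]
  obtain m :: nat and y Q where Q: "\<And>j. j < m \<Longrightarrow> y j \<in> L" "\<And>j. Q j \<in> sets borel"
    "\<And>j. j < m \<Longrightarrow> Q j \<subseteq> {z. - y j + z \<in> W}" "disjoint_family Q" "(\<Union>j<m. Q j) = U" by metis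
  have dj: "disjoint_family_on (\<lambda>i. A i \<inter> B) {..<k}" if "disjoint_family A" for A :: "nat \<Rightarrow> 'g set"
    and B k
    using that by (auto simp: disjoint_family_on_def)
  \<comment> \<open>In this form the set is a left translate of the reflection of \<open>E\<close>,
    so its measure does not depend on \<open>x\<close>.\<close>
  have Eb: "{z. - z + x \<in> E} = {z. - x + z \<in> uminus ` E}" for x
  proof (intro Collect_cong iffI)
    fix z
    { assume "- z + x \<in> E"
      then show "- x + z \<in> uminus ` E" by (intro image_eqI[of _ _ "- z + x"]) (auto simp: minus_add) }
    { assume "- x + z \<in> uminus ` E"
      then obtain e where "e \<in> E" "- x + z = - e" by auto
      then have "e = - z + x" by (metis minus_add minus_minus)
      then show "- z + x \<in> E" using \<open>e \<in> E\<close> by simp }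
  qed
  have mE: "uminus ` E \<in> sets borel" by (intro compact_borel compact_uminus_set E)
  have Ex: "emeasure \<mu> {z. - z + x \<in> E} = emeasure \<mu> (uminus ` E)" "{z. - z + x \<in> E} \<in> sets borel" for x
    unfolding Eb by (rule emeasure_translate[OF mE], rule translate_vimage_borel[OF mE])
  have right: "{z. z + x \<in> D} \<in> sets borel" for x
    using measurable_sets[OF borel_measurable_continuous_onI[of "\<lambda>z. z + x"] D(1)]
    by (simp add: vimage_def continuous_intros)
  have le: "(\<Sum>i<n. emeasure \<mu> (P i) * indicator {z. - z + x i \<in> E} z) \<le>
    (\<Sum>j<m. emeasure \<mu> (Q j) * indicator {z. z + y j \<in> D} z)" for z
  proof -
    have tU[measurable]: "{v. - z + v \<in> U} \<in> sets borel" "{v. z + v \<in> W} \<in> sets borel"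
      using translate_vimage_borel WU by auto
    have "(\<Sum>i<n. emeasure \<mu> (P i) * indicator {z. - z + x i \<in> E} z) \<le>
      (\<Sum>i<n. emeasure \<mu> (P i \<inter> {v. - z + v \<in> U}))"
    proof (rule sum_mono)
      fix i assume i: "i \<in> {..<n}"
      \<comment> \<open>The piece satisfies \<open>P i \<subseteq> x i + V\<close>; if
        \<open>- z + x i\<close> lies in \<open>E\<close>, translation by \<open>- z\<close> carries
        the whole piece into \<open>E + V \<subseteq> U\<close>.\<close>
      have "P i \<inter> {v. - z + v \<in> U} = P i" if "- z + x i \<in> E"
      proof -
        have "- z + v \<in> U" if "v \<in> P i" for v
          using V(3)[OF \<open>- z + x i \<in> E\<close>, of "- x i + v"] P(2)[of i] i that by (auto simp: add.assoc)
        then show ?thesis by auto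
      qed
      then show "emeasure \<mu> (P i) * indicator {z. - z + x i \<in> E} z \<le> emeasure \<mu> (P i \<inter> {v. - z + v \<in> U})"
        by (auto split: split_indicator)
    qed
    also have "\<dots> = emeasure \<mu> (\<Union>i<n. P i \<inter> {v. - z + v \<in> U})"
      using P(1) tU by (intro sum_emeasure dj P) auto
    also have "(\<Union>i<n. P i \<inter> {v. - z + v \<in> U}) = W \<inter> {v. - z + v \<in> U}" using P(4) by auto
    also have "emeasure \<mu> \<dots> = emeasure \<mu> {v. z + v \<in> W \<inter> {v. - z + v \<in> U}}"
      using tU WU by (intro emeasure_translate[symmetric]) auto
    also have "{v. z + v \<in> W \<inter> {v. - z + v \<in> U}} = (\<Union>j<m. Q j \<inter> {v. z + v \<in> W})"
      using Q(5) by (auto simp: add.assoc[symmetric])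
    also have "emeasure \<mu> \<dots> = (\<Sum>j<m. emeasure \<mu> (Q j \<inter> {v. z + v \<in> W}))"
      using Q(2) tU by (intro sum_emeasure[symmetric] dj Q) auto
    also have "\<dots> \<le> (\<Sum>j<m. emeasure \<mu> (Q j) * indicator {z. z + y j \<in> D} z)"
    proof (rule sum_mono)
      fix j assume j: "j \<in> {..<m}"
      show "emeasure \<mu> (Q j \<inter> {v. z + v \<in> W}) \<le> emeasure \<mu> (Q j) * indicator {z. z + y j \<in> D} z"
      proof (cases "Q j \<inter> {v. z + v \<in> W} = {}")
        case False
        then obtain v where v: "v \<in> Q j" "z + v \<in> W" by auto
        \<comment> \<open>The element \<open>z + y j\<close> is the difference of
          \<open>z + v\<close> and \<open>- y j + v\<close>, both of which lie in
          \<open>W\<close>.\<close>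
        have "- y j + v \<in> W" using Q(3)[of j] j v by auto
        from D(2)[OF v(2) this] have "z + y j \<in> D"
          by (simp add: diff_conv_add_uminus minus_add add.assoc del: add_uminus_conv_diff)
        then show ?thesis using Q(2)[of j] by (auto intro!: emeasure_mono)
      qed simp
    qed
    finally show ?thesis .
  qed
  have "emeasure \<mu> (uminus ` E) * emeasure \<mu> W = emeasure \<mu> (uminus ` E) * (\<Sum>i<n. emeasure \<mu> (P i))"
    using P sum_emeasure[of P "{..<n}" \<mu>] by (simp add: disjoint_family_on_def image_subset_iff)
  also have "\<dots> = (\<Sum>i<n. emeasure \<mu> (P i) * emeasure \<mu> {z. - z + x i \<in> E})"
    by (simp add: Ex sum_distrib_left mult.commute)
  also have "\<dots> = (\<integral>\<^sup>+z. (\<Sum>i<n. emeasure \<mu> (P i) * indicator {z. - z + x i \<in> E} z) \<partial>\<mu>)"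
    using Ex(2) by (subst nn_integral_sum) (auto simp: nn_integral_cmult_indicator)
  also have "\<dots> \<le> (\<integral>\<^sup>+z. (\<Sum>j<m. emeasure \<mu> (Q j) * indicator {z. z + y j \<in> D} z) \<partial>\<mu>)"
    by (intro nn_integral_mono le)
  also have "\<dots> = (\<Sum>j<m. emeasure \<mu> (Q j) * emeasure \<mu> {z. z + y j \<in> D})"
    using right by (subst nn_integral_sum) (auto simp: nn_integral_cmult_indicator)
  also have "\<dots> \<le> (\<Sum>j<m. emeasure \<mu> (Q j) * C)"
    using C Q(1) by (intro sum_mono mult_left_mono) auto
  also have "\<dots> = C * (\<Sum>j<m. emeasure \<mu> (Q j))" by (simp add: sum_distrib_left mult.commute)
  also have "(\<Sum>j<m. emeasure \<mu> (Q j)) = emeasure \<mu> U"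
    using Q sum_emeasure[of Q "{..<m}" \<mu>] by (simp add: disjoint_family_on_def image_subset_iff)
  finally show ?thesis .
qed

text \<open>The reflected restriction of \<open>\<mu>\<close> to \<open>A\<close> is at most
  \<open>C\<close> times \<open>\<mu>\<close>, so \<open>C\<close> takes the place of a bound for
  the modular function on \<open>A\<close>. Its positivity allows division by
  \<open>C\<close>.\<close>

definition reflection_bound :: "'g set \<Rightarrow> real \<Rightarrow> bool" where
  "reflection_bound A C \<longleftrightarrow>
     0 < C \<and> (\<forall>E\<in>sets borel. emeasure \<mu> (A \<inter> uminus -` E) \<le> ennreal C * emeasure \<mu> E)"

text \<open>Outer regularity passes from a Borel set to an open superset, and inner regularity of
  the reflected open set passes on to a compact one; what remains to be tested are compact sets
  inside open ones. Intersecting with the neighbourhood \<open>V\<close> of the reflected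
  \<open>A\<close> keeps them where a local bound is available.\<close>

lemma reflection_boundI:
  assumes C: "0 < C" and V: "open V" "uminus ` A \<subseteq> V" and A: "A \<in> sets borel"
    and bnd: "\<And>E U. compact E \<Longrightarrow> open U \<Longrightarrow> E \<subseteq> U \<Longrightarrow> U \<subseteq> V \<Longrightarrow> emeasure \<mu> (uminus ` E) \<le>
      ennreal C * emeasure \<mu> U"
  shows "reflection_bound A C"
  unfolding reflection_bound_def
proof (intro conjI C ballI)
  fix E :: "'g set" assume E: "E \<in> sets borel"
  have le: "emeasure \<mu> (A \<inter> uminus -` E) \<le> ennreal C * emeasure \<mu> U" if U: "open U" "E \<subseteq> U" for U
  proof -
    have o: "open (uminus -` (U \<inter> V))" using U V by (intro open_uminus_vimage) auto
    have "emeasure \<mu> (A \<inter> uminus -` E) \<le> emeasure \<mu> (uminus -` (U \<inter> V))"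
      using U V o by (intro emeasure_mono) auto
    also have "\<dots> = (SUP K\<in>{K. compact K \<and> K \<subseteq> uminus -` (U \<inter> V)}. emeasure \<mu> K)"
      by (rule inner_regular_open[OF o])
    also have "\<dots> \<le> ennreal C * emeasure \<mu> U"
    proof (rule SUP_least)
      fix K assume K: "K \<in> {K. compact K \<and> K \<subseteq> uminus -` (U \<inter> V)}"
      have "emeasure \<mu> (uminus ` (uminus ` K)) \<le> ennreal C * emeasure \<mu> (U \<inter> V)"
        using K U V by (intro bnd compact_uminus_set) auto
      also have "\<dots> \<le> ennreal C * emeasure \<mu> U" using U V by (intro mult_left_mono emeasure_mono) auto
      finally show "emeasure \<mu> K \<le> ennreal C * emeasure \<mu> U" by (simp add: image_image)
    qed
    finally show ?thesis .
  qed
  show "emeasure \<mu> (A \<inter> uminus -` E) \<le> ennreal C * emeasure \<mu> E"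
  proof (rule ennreal_le_epsilon)
    fix e :: real assume fin: "ennreal C * emeasure \<mu> E < top" and e: "0 < e"
    then have Ef: "emeasure \<mu> E < \<infinity>" using C by (auto simp: ennreal_mult_less_top)
    have "0 < e / C" using e C by simp
    from outer_regular_approx[OF E Ef this]
    obtain U where U: "open U" "E \<subseteq> U" "emeasure \<mu> U < emeasure \<mu> E + ennreal (e / C)" by blast
    have "emeasure \<mu> (A \<inter> uminus -` E) \<le> ennreal C * (emeasure \<mu> E + ennreal (e / C))"
      using le[OF U(1,2)] U(3) by (meson less_imp_le mult_left_mono order_trans zero_le)
    also have "\<dots> = ennreal C * emeasure \<mu> E + ennreal e" using C e
      by (simp add: distrib_left flip: ennreal_mult)
    finally show "emeasure \<mu> (A \<inter> uminus -` E) \<le> ennreal C * emeasure \<mu> E + ennreal e" .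
  qed
qed

text \<open>Division by \<open>w\<close>. The additional 1 keeps the constant positive when
  \<open>c\<close> is 0, as \<open>reflection_bound\<close> demands.\<close>

lemma reflection_bound_aux2:
  assumes "a * w \<le> c * u" "0 < w" "w < \<infinity>" "c < \<infinity>"
  shows "a \<le> ennreal (enn2real c / enn2real w + 1) * u"
proof -
  obtain w' where w: "w = ennreal w'" "0 < w'" using assms by (cases w rule: ennreal_cases) auto
  obtain c' where c: "c = ennreal c'" "0 \<le> c'" using assms by (cases c rule: ennreal_cases) auto
  have "a = a * w * ennreal (1 / w')" using w by (simp add: mult.assoc flip: ennreal_mult)
  also have "\<dots> \<le> c * u * ennreal (1 / w')" using assms by (intro mult_right_mono) auto
  also have "\<dots> = ennreal (c' / w') * u" using w c
    by (simp add: mult.commute mult.left_commute divide_inverse ennreal_mult)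
  also have "\<dots> \<le> ennreal (c' / w' + 1) * u" by (intro mult_right_mono ennreal_leI) auto
  finally show ?thesis using w c by simp
qed

section \<open>Bounds for reflection on compact sets and on abelian groups\<close>

lemma zero_neighbourhood:
  obtains W K where "open W" "(0::'g) \<in> W" "W \<subseteq> K" "compact K" "0 < emeasure \<mu> W" "emeasure \<mu> W < \<infinity>"
proof -
  obtain W K where W: "open W" "compact K" "{0::'g} \<subseteq> W" "W \<subseteq> K"
    using compact_open_neighbourhood[of "{0}"] by auto
  moreover have "0 < emeasure \<mu> W" using W by (intro emeasure_open_pos) auto
  moreover have "emeasure \<mu> W < \<infinity>"
    using emeasure_mono[of W K \<mu>] W compact_borel emeasure_compact_finite[OF W(2)]
      by (auto intro: le_less_trans)
  ultimately show thesis using that by auto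
qed

text \<open>With \<open>x\<close> confined to a compact set \<open>L\<close>, the sets
  \<open>{z. z + x \<in> D}\<close> all lie in the compact set \<open>D'\<close> of differences of
  points of \<open>D\<close> and \<open>L\<close>, whose finite measure is the uniform constant. The
  set \<open>D\<close> contains all differences of points of \<open>W\<close>.\<close>

lemma reflection_bound_compact:
  assumes A: "compact A"
  shows "\<exists>C. reflection_bound A C"
proof -
  obtain W K where W: "open W" "(0::'g) \<in> W" "W \<subseteq> K" "compact K" "0 < emeasure \<mu> W" "emeasure \<mu> W < \<infinity>"
    by (rule zero_neighbourhood)
  obtain V L where V: "open V" "compact L" "uminus ` A \<subseteq> V" "V \<subseteq> L"
    using compact_open_neighbourhood[OF compact_uminus_set[OF A]] by metis
  define D where "D = (\<lambda>(x, y). x + y) ` (K \<times> uminus ` K)"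
  have D: "compact D" unfolding D_def by (intro compact_add_set compact_uminus_set W)
  define D' where "D' = (\<lambda>(x, y). x + y) ` (D \<times> uminus ` L)"
  have D': "compact D'" unfolding D'_def by (intro compact_add_set compact_uminus_set D V)
  have sub: "{z. z + x \<in> D} \<subseteq> D'" if "x \<in> L" for x
  proof
    fix z assume "z \<in> {z. z + x \<in> D}"
    then show "z \<in> D'" using that unfolding D'_def
      by (intro image_eqI[of _ _ "(z + x, - x)"]) (auto simp: add.assoc)
  qed
  show ?thesis
  proof (intro exI reflection_boundI[where V=V])
    show "0 < enn2real (emeasure \<mu> D') / enn2real (emeasure \<mu> W) + 1" by (auto intro!: add_nonneg_pos)
    fix E U :: "'g set" assume EU: "compact E" "open U" "E \<subseteq> U" "U \<subseteq> V"
    show "emeasure \<mu> (uminus ` E) \<le> ennreal (enn2real (emeasure \<mu> D') / enn2real (emeasure \<mu> W) +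
      1) * emeasure \<mu> U"
    proof (rule reflection_bound_aux2[OF reflection_bound_aux[where K=K and L=L and D=D]])
      show "a - b \<in> D" if "a \<in> W" "b \<in> W" for a b
        using that W unfolding D_def by (intro image_eqI[of _ _ "(a, - b)"]) auto
      show "emeasure \<mu> {z. z + x \<in> D} \<le> emeasure \<mu> D'" if "x \<in> L" for x
        using sub[OF that] compact_borel[OF D'] by (intro emeasure_mono) auto
    qed (use W V EU D D' compact_borel emeasure_compact_finite in auto)
  qed (use V A compact_borel in auto)
qed

text \<open>In an abelian group \<open>{z. z + x \<in> D}\<close> is a left translate of
  \<open>D\<close> and has the measure of \<open>D\<close> for every \<open>x\<close>, so the
  constant no longer depends on where the reflected set lies.\<close>

lemma reflection_bound_abelian:
  assumes ab: "\<And>x y :: 'g. x + y = y + x"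
  shows "\<exists>C. reflection_bound UNIV C"
proof -
  obtain W K where W: "open W" "(0::'g) \<in> W" "W \<subseteq> K" "compact K" "0 < emeasure \<mu> W" "emeasure \<mu> W < \<infinity>"
    by (rule zero_neighbourhood)
  define D where "D = (\<lambda>(x, y). x + y) ` (K \<times> uminus ` K)"
  have D: "compact D" unfolding D_def by (intro compact_add_set compact_uminus_set W)
  show ?thesis
  proof (intro exI reflection_boundI[where V=UNIV])
    show "0 < enn2real (emeasure \<mu> D) / enn2real (emeasure \<mu> W) + 1" by (auto intro!: add_nonneg_pos)
    fix E U :: "'g set" assume EU: "compact E" "open U" "E \<subseteq> U"
    \<comment> \<open>The sets \<open>V\<close> and \<open>L\<close> only provide a compact set
      around the open one; they do not enter the constant.\<close>
    obtain V L where V: "open V" "compact L" "E \<subseteq> V" "V \<subseteq> L"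
      using compact_open_neighbourhood[OF EU(1)] by metis
    have "emeasure \<mu> (uminus ` E) \<le> ennreal (enn2real (emeasure \<mu> D) / enn2real (emeasure \<mu> W) +
      1) * emeasure \<mu> (U \<inter> V)"
    proof (rule reflection_bound_aux2[OF reflection_bound_aux[where K=K and L=L and D=D]])
      show "a - b \<in> D" if "a \<in> W" "b \<in> W" for a b
        using that W unfolding D_def by (intro image_eqI[of _ _ "(a, - b)"]) auto
      show "emeasure \<mu> {z. z + x \<in> D} \<le> emeasure \<mu> D" for x
        unfolding ab[of _ x] by (simp add: emeasure_translate compact_borel[OF D])
    qed (use W V EU D compact_borel emeasure_compact_finite in auto)
    also have "\<dots> \<le> ennreal (enn2real (emeasure \<mu> D) / enn2real (emeasure \<mu> W) + 1) * emeasure \<mu> U"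
      using EU V by (intro mult_left_mono emeasure_mono) auto
    finally show "emeasure \<mu> (uminus ` E) \<le> ennreal (enn2real (emeasure \<mu> D) / enn2real (emeasure \<mu>
      W) + 1) * emeasure \<mu> U" .
  qed auto
qed

text \<open>The qualitative part of \<open>reflection_bound\<close>. It suffices to carry almost
  everywhere statements over to reflected functions, and it holds on every Borel set of finite
  measure, where a bound need not exist.\<close>

definition reflection_null :: "'g set \<Rightarrow> bool" where
  "reflection_null A \<longleftrightarrow> A \<in> sets borel \<and> (\<forall>E\<in>sets borel. emeasure \<mu> E = 0 \<longrightarrow>
    emeasure \<mu> (A \<inter> uminus -` E) = 0)"

lemma reflection_bound_imp_null: "A \<in> sets borel \<Longrightarrow> reflection_bound A C \<Longrightarrow> reflection_null A"
  unfolding reflection_null_def reflection_bound_def by (metis le_zero_eq mult_zero_right)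

text \<open>A compact subset \<open>K\<close> of the part of \<open>A\<close> that is reflected into
  a null set is itself null, by the bound for compact sets; inner regularity leaves an arbitrarily
  small remainder.\<close>

lemma reflection_null_finite:
  assumes A: "A \<in> sets borel" "emeasure \<mu> A < \<infinity>"
  shows "reflection_null A"
  unfolding reflection_null_def
proof (intro conjI A ballI impI)
  fix E :: "'g set" assume E: "E \<in> sets borel" "emeasure \<mu> E = 0"
  let ?B = "A \<inter> uminus -` E"
  have B: "?B \<in> sets borel" using A E uminus_vimage_borel by auto
  have Bf: "emeasure \<mu> ?B < \<infinity>" using emeasure_mono[of ?B A \<mu>] A by (auto intro: le_less_trans)
  have "emeasure \<mu> ?B \<le> 0 + ennreal e" if e: "0 < e" for e
  proof -
    obtain K where K: "compact K" "K \<subseteq> ?B" "emeasure \<mu> (?B - K) < ennreal e"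
      using inner_regular_finite[OF B Bf e] by blast
    obtain C where C: "reflection_bound K C" using reflection_bound_compact[OF K(1)] by blast
    have Kb: "K \<in> sets borel" by (rule compact_borel[OF K(1)])
    \<comment> \<open>The bound is applied to the reflection of \<open>K\<close>, which is contained
      in the null set \<open>E\<close> and is reflected back onto \<open>K\<close>.\<close>
    have "emeasure \<mu> (K \<inter> uminus -` (uminus -` K)) \<le> ennreal C * emeasure \<mu> (uminus -` K)"
      using C uminus_vimage_borel[OF Kb] by (simp add: reflection_bound_def)
    also have "emeasure \<mu> (uminus -` K) \<le> emeasure \<mu> E" using K E by (intro emeasure_mono) auto
    finally have "emeasure \<mu> K = 0" using E by (simp add: vimage_def mult_left_mono)
    moreover have "emeasure \<mu> ?B \<le> emeasure \<mu> K + emeasure \<mu> (?B - K)"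
      using B Kb K(2) emeasure_subadditive[of K \<mu> "?B - K"] by (auto simp: Un_absorb1)
    ultimately show ?thesis using K(3) by simp
  qed
  then have "emeasure \<mu> ?B \<le> 0" by (rule ennreal_le_epsilon)
  then show "emeasure \<mu> ?B = 0" by simp
qed

lemma AE_reflect:
  assumes A: "reflection_null A" and P: "AE x in \<mu>. P x"
  shows "AE y in \<mu>. y \<in> A \<longrightarrow> P (- y)"
proof -
  from P obtain N where N: "{x\<in>space \<mu>. \<not> P x} \<subseteq> N" "N \<in> sets \<mu>" "emeasure \<mu> N = 0" by (rule AE_E)
  show ?thesis
  proof (rule AE_I[where N="A \<inter> uminus -` N"])
    show "A \<inter> uminus -` N \<in> sets \<mu>" using A N uminus_vimage_borel by (auto simp: reflection_null_def)
  qed (use A N in \<open>auto simp: reflection_null_def\<close>)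
qed

text \<open>Reflecting the restriction of \<open>\<mu>\<close> to \<open>A\<close> gives a measure
  dominated by \<open>C\<close> times \<open>\<mu>\<close>, and the integral is monotone in the
  measure.\<close>

lemma nn_integral_reflect_le:
  assumes A: "A \<in> sets borel" "reflection_bound A C" and u: "u \<in> borel_measurable (completion \<mu>)"
  shows "(\<integral>\<^sup>+y\<in>A. u (- y) \<partial>\<mu>) \<le> ennreal C * (\<integral>\<^sup>+x. u x \<partial>\<mu>)"
proof -
  obtain v where v[measurable]: "v \<in> borel_measurable \<mu>" and uv: "AE x in \<mu>. u x = v x"
    using completion_ex_borel_measurable[OF u] by blast
  have [measurable]: "A \<in> sets borel" by fact
  have v'[measurable]: "v \<in> borel_measurable borel" using v by simp
  have "(\<integral>\<^sup>+y\<in>A. u (- y) \<partial>\<mu>) = (\<integral>\<^sup>+y\<in>A. v (- y) \<partial>\<mu>)"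
    by (rule nn_integral_cong_AE, use AE_reflect[OF reflection_bound_imp_null[OF A] uv] in
      eventually_elim)
      (auto split: split_indicator)
  also have "\<dots> = (\<integral>\<^sup>+y. v (- y) \<partial>density \<mu> (indicator A))"
    by (subst nn_integral_density) (auto simp: mult.commute)
  also have "\<dots> = (\<integral>\<^sup>+x. v x \<partial>distr (density \<mu> (indicator A)) borel uminus)"
    by (subst nn_integral_distr) auto
  also have "\<dots> \<le> (\<integral>\<^sup>+x. v x \<partial>density \<mu> (\<lambda>_. ennreal C))"
  proof (rule nn_integral_mono_measure)
    have "emeasure (distr (density \<mu> (indicator A)) borel uminus) E \<le>
      emeasure (density \<mu> (\<lambda>_. ennreal C)) E"
      if E: "E \<in> sets borel" for E
    proof -
      have "emeasure (distr (density \<mu> (indicator A)) borel uminus) E =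
        (\<integral>\<^sup>+x. indicator A x * indicator (uminus -` E) x \<partial>\<mu>)"
        using E uminus_vimage_borel[OF E] by (subst emeasure_distr) (auto simp: emeasure_density)
      also have "\<dots> = (\<integral>\<^sup>+x. indicator (A \<inter> uminus -` E) x \<partial>\<mu>)"
        by (intro nn_integral_cong) (auto split: split_indicator)
      also have "\<dots> = emeasure \<mu> (A \<inter> uminus -` E)" using A uminus_vimage_borel[OF E]
        by (intro nn_integral_indicator) auto
      also have "\<dots> \<le> ennreal C * emeasure \<mu> E" using A E by (simp add: reflection_bound_def)
      finally show ?thesis using E by (simp add: emeasure_density_const)
    qed
    then show "distr (density \<mu> (indicator A)) borel uminus \<le> density \<mu> (\<lambda>_. ennreal C)"
      by (subst le_measure) auto
  qed simp
  also have "\<dots> = ennreal C * (\<integral>\<^sup>+x. v x \<partial>\<mu>)"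
    by (subst nn_integral_density) (auto simp: nn_integral_cmult)
  also have "(\<integral>\<^sup>+x. v x \<partial>\<mu>) = (\<integral>\<^sup>+x. u x \<partial>\<mu>)"
    by (rule nn_integral_cong_AE, use uv in eventually_elim) simp
  finally show ?thesis .
qed

section \<open>Translation and reflection of strongly measurable functions\<close>

lemma Lp_iff:
  "1 \<le> p \<Longrightarrow> f \<in> Lp_functions (ennreal p) \<mu> \<longleftrightarrow> strongly_measurable \<mu> f \<and> Lp_norm_on p \<mu> UNIV f < \<infinity>"
  by (simp add: Lp_functions_iff)

lemma strongly_measurable_translate:
  assumes "strongly_measurable \<mu> f"
  shows "strongly_measurable \<mu> (\<lambda>x. f (h + x))"
proof -
  obtain s where s: "\<And>i. simple_function \<mu> (s i)" "AE x in \<mu>. (\<lambda>i. s i x) \<longlonglongrightarrow> f x"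
    using assms unfolding strongly_measurable_def by auto
  show ?thesis unfolding strongly_measurable_def
  proof (intro exI conjI allI)
    show "simple_function \<mu> (\<lambda>x. s i (h + x))" for i by (rule simple_function_comp[OF _ s(1)]) simp
    show "AE x in \<mu>. (\<lambda>i. s i (h + x)) \<longlonglongrightarrow> f (h + x)" by (rule AE_translate[OF s(2)])
  qed
qed

text \<open>The approximants are reflected along with \<open>f\<close>. Their convergence is known
  up to a null set, and the cut-off to \<open>A\<close> makes the reflection of that null set
  null.\<close>

lemma strongly_measurable_reflect:
  assumes "strongly_measurable \<mu> f" and A: "reflection_null A"
  shows "strongly_measurable \<mu> (\<lambda>y. indicator A y *\<^sub>R f (- y))"
proof -
  obtain s where s: "\<And>i. simple_function \<mu> (s i)" "AE x in \<mu>. (\<lambda>i. s i x) \<longlonglongrightarrow> f x"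
    using assms unfolding strongly_measurable_def by auto
  have "simple_function \<mu> (\<lambda>y. s i (- y))" for i by (rule simple_function_comp[OF _ s(1)]) simp
  moreover have "simple_function \<mu> (indicator A :: 'g \<Rightarrow> real)" using A by (simp add: reflection_null_def)
  ultimately have "simple_function \<mu> (\<lambda>y. indicator A y *\<^sub>R s i (- y))" for i
    by (rule simple_function_compose2[rotated])
  moreover have "AE y in \<mu>. (\<lambda>i. indicator A y *\<^sub>R s i (- y)) \<longlonglongrightarrow> indicator A y *\<^sub>R f (- y)"
    using AE_reflect[OF A s(2)] by eventually_elim (auto split: split_indicator)
  ultimately show ?thesis unfolding strongly_measurable_def
    by (intro exI[of _ "\<lambda>i y. indicator A y *\<^sub>R s i (- y)"] conjI allI)
qed

lemma Lp_norm_translate: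
  assumes "strongly_measurable \<mu> f"
  shows "Lp_norm_on p \<mu> UNIV (\<lambda>x. f (h + x)) = Lp_norm_on p \<mu> UNIV f"
proof -
  have "(\<lambda>x. ennreal (norm (f x) powr p)) \<in> borel_measurable (completion \<mu>)"
    using strongly_measurable_norm_completion[OF assms] by measurable
  from nn_integral_translate[OF this, of h] show ?thesis by (simp add: Lp_norm_on_def)
qed

section \<open>Approximation by continuous functions with compact support\<close>

lemma urysohn_compact:
  assumes K: "compact (K :: 'g set)" and U: "open U" "K \<subseteq> U"
  obtains \<phi> :: "'g \<Rightarrow> real" and L where "continuous_on UNIV \<phi>" "\<And>x. 0 \<le> \<phi> x \<and> \<phi> x \<le> 1"
    "\<And>x. x \<in> K \<Longrightarrow> \<phi> x = 1" "compact L" "L \<subseteq> U" "\<And>x. x \<notin> L \<Longrightarrow> \<phi> x = 0"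
proof -
  obtain V L where V: "open V" "compact L" "K \<subseteq> V" "V \<subseteq> L" "L \<subseteq> U"
    using compact_open_between[OF assms] by blast
  have cr: "completely_regular_space (euclidean :: 'g topology)"
    using locally_compact_regular_imp_completely_regular_space locally_compact Hausdorff_space_t2
      by blast
  have "compactin euclidean K" "closedin euclidean (- V)" "disjnt K (- V)" using K V
    by (auto simp: disjnt_def)
  from Urysohn_completely_regular_compact_closed[OF zero_le_one cr this]
  obtain \<phi> :: "'g \<Rightarrow> real" where \<phi>: "continuous_map euclidean (subtopology euclidean {0..1}) \<phi>" "\<phi> `
    (- V) \<subseteq> {0}" "\<phi> ` K \<subseteq> {1}"
    by blast
  show thesis
  proof (rule that)
    show "continuous_on UNIV \<phi>" using \<phi>(1) by (simp add: continuous_map_in_subtopology)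
    show "0 \<le> \<phi> x \<and> \<phi> x \<le> 1" for x using \<phi>(1) by (auto simp: continuous_map_in_subtopology)
    show "x \<in> K \<Longrightarrow> \<phi> x = 1" for x using \<phi>(3) by auto
    show "x \<notin> L \<Longrightarrow> \<phi> x = 0" for x using \<phi>(2) V by auto
  qed (use V in auto)
qed

definition Cc :: "'g set \<Rightarrow> ('g \<Rightarrow> 'b::real_normed_vector) set" where
  "Cc U = {g. continuous_on UNIV g \<and> strongly_measurable \<mu> g \<and> (\<exists>K. compact K \<and> K \<subseteq> U \<and> (\<forall>x. x \<notin> K \<longrightarrow>
    g x = 0))}"

lemma strongly_measurable_continuous:
  fixes f :: "'g \<Rightarrow> 'b::{real_normed_vector, second_countable_topology}"
  assumes "continuous_on UNIV f"
  shows "strongly_measurable \<mu> f"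
  using borel_measurable_continuous_onI[OF assms] by (intro strongly_measurable_borel) simp

lemma Cc_scaleR:
  assumes "continuous_on UNIV (\<phi> :: 'g \<Rightarrow> real)" "compact L" "L \<subseteq> U" "\<And>x. x \<notin> L \<Longrightarrow> \<phi> x = 0"
  shows "(\<lambda>x. \<phi> x *\<^sub>R b) \<in> Cc U"
  using assms unfolding Cc_def
  by (auto intro!: continuous_intros strongly_measurable_scaleR strongly_measurable_continuous
    strongly_measurable_const exI[of _ L])

lemma Cc_add: "f \<in> Cc U \<Longrightarrow> g \<in> Cc U \<Longrightarrow> (\<lambda>x. f x + g x) \<in> Cc U"
  unfolding Cc_def
proof (clarsimp, intro conjI)
  fix K L assume "compact K" "K \<subseteq> U" "\<forall>x. x \<notin> K \<longrightarrow> f x = 0" "compact L" "L \<subseteq> U" "\<forall>x. x \<notin> L \<longrightarrow> g x = 0"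
  then show "\<exists>K. compact K \<and> K \<subseteq> U \<and> (\<forall>x. x \<notin> K \<longrightarrow> f x + g x = 0)"
    by (intro exI[of _ "K \<union> L"]) auto
qed (auto intro!: continuous_intros strongly_measurable_add)

lemma Cc_mono: "U \<subseteq> V \<Longrightarrow> Cc U \<subseteq> Cc V"
  unfolding Cc_def by blast

definition Cc_approximable :: "real \<Rightarrow> 'g set \<Rightarrow> ('g \<Rightarrow> 'b::real_normed_vector) \<Rightarrow> bool" where
  "Cc_approximable p U f \<longleftrightarrow> (\<forall>e>0. \<exists>g\<in>Cc U. Lp_norm_on p \<mu> UNIV (\<lambda>x. f x - g x) < ennreal e)"

lemma Cc_approximable_zero:
  assumes "1 \<le> p" shows "Cc_approximable p U (\<lambda>x. 0 :: 'b::real_normed_vector)"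
  unfolding Cc_approximable_def
proof (intro allI impI)
  fix e :: real assume e: "e > 0"
  have "Lp_norm_on p \<mu> UNIV (\<lambda>x. 0 - 0 :: 'b) \<le> ennreal 0" using assms by (subst Lp_norm_on_le_iff) auto
  then show "\<exists>g\<in>Cc U. Lp_norm_on p \<mu> UNIV (\<lambda>x. 0 - g x :: 'b) < ennreal e"
    using e by (intro bexI[of _ "\<lambda>x. 0"]) (auto simp: Cc_def strongly_measurable_const intro:
      le_less_trans)
qed

lemma Cc_approximable_add:
  assumes p: "1 \<le> p" and f: "Cc_approximable p U f" "Cc_approximable p U g"
    and sm: "strongly_measurable \<mu> f" "strongly_measurable \<mu> g"
  shows "Cc_approximable p U (\<lambda>x. f x + g x)"
  unfolding Cc_approximable_def
proof (intro allI impI)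
  fix e :: real assume "e > 0"
  then have e: "e / 2 > 0" by simp
  obtain f' where f': "f' \<in> Cc U" "Lp_norm_on p \<mu> UNIV (\<lambda>x. f x - f' x) < ennreal (e / 2)"
    using f(1) e unfolding Cc_approximable_def by blast
  obtain g' where g': "g' \<in> Cc U" "Lp_norm_on p \<mu> UNIV (\<lambda>x. g x - g' x) < ennreal (e / 2)"
    using f(2) e unfolding Cc_approximable_def by blast
  have "Lp_norm_on p \<mu> UNIV (\<lambda>x. f x + g x - (f' x + g' x)) \<le>
     Lp_norm_on p \<mu> UNIV (\<lambda>x. f x - f' x) + Lp_norm_on p \<mu> UNIV (\<lambda>x. g x - g' x)"
  proof (rule Lp_norm_on_triangle_sm[OF p])
    show "norm (f x + g x - (f' x + g' x)) \<le> norm (f x - f' x) + norm (g x - g' x)" for x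
      by (metis add_diff_add norm_triangle_ineq)
  qed (use sm f' g' in \<open>auto simp: Cc_def intro: strongly_measurable_diff\<close>)
  also have "\<dots> < ennreal (e / 2) + ennreal (e / 2)" using f' g' by (intro add_strict_mono)
  also have "\<dots> = ennreal e" using e by (simp flip: ennreal_plus)
  finally show "\<exists>h\<in>Cc U. Lp_norm_on p \<mu> UNIV (\<lambda>x. f x + g x - h x) < ennreal e" 
    using Cc_add[OF f'(1) g'(1)] by (intro bexI[of _ "\<lambda>x. f' x + g' x"])
qed

lemma Cc_approximable_sum:
  assumes p: "1 \<le> p"
  shows "(\<And>i. i \<in> I \<Longrightarrow> Cc_approximable p U (f i) \<and> strongly_measurable \<mu> (f i)) \<Longrightarrow>
    Cc_approximable p U (\<lambda>x. \<Sum>i\<in>I. f i x)"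
  by (induction I rule: infinite_finite_induct)
    (auto intro!: Cc_approximable_zero[OF p] Cc_approximable_add[OF p] strongly_measurable_sum)

text \<open>A bump that is 1 on a compact \<open>K\<close> inside \<open>E\<close> and vanishes off
  an open \<open>V\<close> around \<open>K\<close> differs from the indicator only on
  \<open>E - K\<close> and \<open>V - K\<close>, which regularity makes small.\<close>

lemma Cc_approximable_indicator:
  assumes p: "1 \<le> p" and U: "open U" and E: "E \<in> sets borel" "E \<subseteq> U" "emeasure \<mu> E < \<infinity>"
  shows "Cc_approximable p U (\<lambda>x. indicator E x *\<^sub>R (b :: 'b::real_normed_vector))"
  unfolding Cc_approximable_def
proof (intro allI impI)
  fix e :: real assume e: "e > 0"
  \<comment> \<open>Two exceptional sets of measure below \<open>d\<close> contribute at most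
    \<open>norm b powr p * (2 * d)\<close>, which is at most \<open>(e / 2) powr p\<close>; the 1
    added to \<open>norm b\<close> covers the case \<open>b = 0\<close>.\<close>
  define d where "d = (e / 2 / (norm b + 1)) powr p / 2"
  have "norm b + 1 > 0" by (simp add: add_nonneg_pos)
  then have d: "d > 0" using e by (simp add: d_def)
  obtain K where K: "compact K" "K \<subseteq> E" "emeasure \<mu> (E - K) < ennreal d"
    using inner_regular_finite[OF E(1,3) d] by blast
  have Kb: "K \<in> sets borel" by (rule compact_borel[OF K(1)])
  obtain V where V: "open V" "K \<subseteq> V" "emeasure \<mu> V < emeasure \<mu> K + ennreal d"
    using outer_regular_approx[OF Kb emeasure_compact_finite[OF K(1)] d] by blast
  have VK: "emeasure \<mu> (V - K) < ennreal d"
    using V Kb emeasure_compact_finite[OF K(1)]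
    by (subst emeasure_Diff) (auto simp: borel_open minus_less_iff_ennreal emeasure_mono add.commute)
  have UV: "open (U \<inter> V)" "K \<subseteq> U \<inter> V" using U V K(2) E(2) by auto
  obtain \<phi> :: "'g \<Rightarrow> real" and L where \<phi>: "continuous_on UNIV \<phi>" "\<And>x. 0 \<le> \<phi> x \<and> \<phi> x \<le> 1"
    "\<And>x. x \<in> K \<Longrightarrow> \<phi> x = 1" "compact L" "L \<subseteq> U \<inter> V" "\<And>x. x \<notin> L \<Longrightarrow> \<phi> x = 0"
    using urysohn_compact[OF K(1) UV] by blast
  have "\<bar>indicator E x - \<phi> x\<bar> \<le> indicator ((E - K) \<union> (V - K)) x" for x
  proof -
    have "x \<notin> V \<Longrightarrow> \<phi> x = 0" using \<phi>(5,6) by blast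
    then show ?thesis using \<phi>(2)[of x] \<phi>(3)[of x] K(2) by (auto split: split_indicator)
  qed
  then have le: "norm (indicator E x *\<^sub>R b - \<phi> x *\<^sub>R b) powr p \<le>
    norm b powr p * indicator ((E - K) \<union> (V - K)) x" for x
  proof -
    have "norm (indicator E x *\<^sub>R b - \<phi> x *\<^sub>R b) powr p \<le> (norm b * indicator ((E - K) \<union> (V - K)) x)
      powr p"
      using \<open>\<And>x. \<bar>indicator E x - \<phi> x\<bar> \<le> indicator ((E - K) \<union> (V - K)) x\<close>[of x] p
      by (intro powr_mono2) (auto simp: mult.commute mult_left_mono simp flip: scaleR_diff_left)
    then show ?thesis by (auto split: split_indicator_asm split_indicator)
  qed
  have S: "(E - K) \<union> (V - K) \<in> sets borel" using E Kb V by auto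
  have "(\<integral>\<^sup>+x\<in>UNIV. ennreal (norm (indicator E x *\<^sub>R b - \<phi> x *\<^sub>R b) powr p) \<partial>\<mu>) \<le>
     (\<integral>\<^sup>+x. ennreal (norm b powr p) * indicator ((E - K) \<union> (V - K)) x \<partial>\<mu>)"
    using le by (intro nn_integral_mono) (auto split: split_indicator intro!: ennreal_leI; fastforce
      split: split_indicator_asm)
  also have "\<dots> = ennreal (norm b powr p) * emeasure \<mu> ((E - K) \<union> (V - K))"
    using S by (simp add: nn_integral_cmult_indicator)
  also have "\<dots> \<le> ennreal (norm b powr p) * ennreal (2 * d)"
  proof (rule mult_left_mono)
    have "emeasure \<mu> ((E - K) \<union> (V - K)) \<le> emeasure \<mu> (E - K) + emeasure \<mu> (V - K)"
      using E Kb V by (intro emeasure_subadditive) auto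
    also have "\<dots> \<le> ennreal d + ennreal d" using K VK by (intro add_mono) auto
    finally show "emeasure \<mu> ((E - K) \<union> (V - K)) \<le> ennreal (2 * d)" using d by (simp flip: ennreal_plus)
  qed simp
  also have "\<dots> \<le> ennreal ((e / 2) powr p)"
  proof -
    have "norm b powr p * (2 * d) = (norm b * (e / 2 / (norm b + 1))) powr p"
    proof -
      have "2 * d = (e / 2 / (norm b + 1)) powr p" unfolding d_def by linarith
      then show ?thesis by (simp only: powr_mult)
    qed
    also have "\<dots> \<le> (e / 2) powr p"
    proof (rule powr_mono2)
      show "norm b * (e / 2 / (norm b + 1)) \<le> e / 2"
      proof -
        have "norm b / (norm b + 1) \<le> 1" using \<open>norm b + 1 > 0\<close> by (subst divide_le_eq_1_pos) auto
        then have "e / 2 * (norm b / (norm b + 1)) \<le> e / 2 * 1" using e by (intro mult_left_mono) auto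
        then show ?thesis by (simp add: mult.commute)
      qed
    qed (use p e in \<open>auto intro!: mult_nonneg_nonneg divide_nonneg_nonneg\<close>)
    finally show ?thesis using d by (simp flip: ennreal_mult)
  qed
  finally have "Lp_norm_on p \<mu> UNIV (\<lambda>x. indicator E x *\<^sub>R b - \<phi> x *\<^sub>R b) \<le> ennreal (e / 2)"
    using p e by (subst Lp_norm_on_le_iff) auto
  also have "\<dots> < ennreal e" using e by (simp add: ennreal_less_iff)
  finally show "\<exists>g\<in>Cc U. Lp_norm_on p \<mu> UNIV (\<lambda>x. indicator E x *\<^sub>R b - g x) < ennreal e"
  proof (rule bexI[where x="\<lambda>x. \<phi> x *\<^sub>R b"])
    show "(\<lambda>x. \<phi> x *\<^sub>R b) \<in> Cc U" using \<phi>(5) by (intro Cc_scaleR[OF \<phi>(1,4) _ \<phi>(6)]) auto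
  qed
qed

text \<open>Simple functions reduce density to indicators. Keeping the support inside a prescribed
  open \<open>U\<close> matters for kernels: the approximating kernel may only meet those
  \<open>y\<close> on which reflection is bounded.\<close>

lemma Cc_dense:
  fixes f :: "'g \<Rightarrow> 'b::real_normed_vector"
  assumes p: "1 \<le> p" and f: "f \<in> Lp_functions (ennreal p) \<mu>"
    and U: "open U" "AE x in \<mu>. x \<notin> U \<longrightarrow> f x = 0" and e: "0 < e"
  obtains g where "g \<in> Cc U" "Lp_norm_on p \<mu> UNIV (\<lambda>x. f x - g x) < ennreal e"
proof -
  have fsm: "strongly_measurable \<mu> f" using f p by (simp add: Lp_iff)
  have "e / 2 > 0" using e by simp
  from Lp_simple_dense[OF p f this] obtain s where s: "simple_function \<mu> s"
    "Lp_norm_on p \<mu> UNIV (\<lambda>x. f x - s x) < ennreal (e / 2)" by auto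
  have ssm: "strongly_measurable \<mu> s" by (rule strongly_measurable_simple[OF s(1)])
  have "Lp_norm_on p \<mu> UNIV s \<le> Lp_norm_on p \<mu> UNIV f + Lp_norm_on p \<mu> UNIV (\<lambda>x. f x - s x)"
  proof (intro Lp_norm_on_triangle_sm[OF p] fsm ssm strongly_measurable_diff)
    show "norm (s x) \<le> norm (f x) + norm (f x - s x)" for x
      by (metis norm_minus_commute norm_triangle_sub)
  qed simp
  also have "\<dots> < \<infinity>" using f p s by (auto simp: Lp_iff intro: order_less_trans)
  finally have sfin: "(\<integral>\<^sup>+x. ennreal (norm (s x) powr p) \<partial>\<mu>) < \<infinity>"
    unfolding Lp_norm_on_finite_iff by simp
  \<comment> \<open>The level set of 0 may have infinite measure and is left out; the other levels
    have finite measure because \<open>norm (s x) powr p\<close> is integrable.\<close>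
  define E where "E v = (if v = 0 then {} else s -` {v} \<inter> U)" for v
  have Eb: "E v \<in> sets borel" for v
    using simple_functionD(2)[OF s(1), of "{v}"] U(1) by (auto simp: E_def)
  have Ef: "emeasure \<mu> (E v) < \<infinity>" for v
  proof (cases "v = 0")
    case False
    have "ennreal (norm v powr p) * emeasure \<mu> (E v) = (\<integral>\<^sup>+x. ennreal (norm v powr p) * indicator (E
      v) x \<partial>\<mu>)"
      using Eb by (simp add: nn_integral_cmult_indicator)
    also have "\<dots> \<le> (\<integral>\<^sup>+x. ennreal (norm (s x) powr p) \<partial>\<mu>)"
      using False by (intro nn_integral_mono) (auto simp: E_def split: split_indicator)
    also note sfin
    finally show ?thesis using False by (auto simp: ennreal_mult_less_top)
  qed (simp add: E_def)
  have fin: "finite (range s)" using simple_functionD(1)[OF s(1)] by simp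
  have rep: "indicator U x *\<^sub>R s x = (\<Sum>v\<in>range s. indicator (E v) x *\<^sub>R v)" for x
  proof -
    have "(\<Sum>v\<in>range s. indicator (E v) x *\<^sub>R v) = (\<Sum>v\<in>range s. if v =
      s x then indicator U x *\<^sub>R s x else 0)"
      by (intro sum.cong refl) (auto simp: E_def split: split_indicator)
    also have "\<dots> = indicator U x *\<^sub>R s x" using fin by simp
    finally show ?thesis by simp
  qed
  have "Cc_approximable p U (\<lambda>x. indicator U x *\<^sub>R s x)"
    unfolding rep
  proof (intro Cc_approximable_sum[OF p] conjI Cc_approximable_indicator[OF p U(1)] Eb Ef)
    show "E v \<subseteq> U" for v by (auto simp: E_def)
    show "strongly_measurable \<mu> (\<lambda>x. indicator (E v) x *\<^sub>R v)" for v
      using Eb by (intro strongly_measurable_scaleR strongly_measurable_const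
        strongly_measurable_indicator) simp
  qed
  then obtain g where g: "g \<in> Cc U" "Lp_norm_on p \<mu> UNIV (\<lambda>x. indicator U x *\<^sub>R s x - g x) <
    ennreal (e / 2)"
    using \<open>e / 2 > 0\<close> unfolding Cc_approximable_def by blast
  have Usm: "strongly_measurable \<mu> (\<lambda>x. indicator U x *\<^sub>R s x)"
    using U(1) by (intro strongly_measurable_scaleR ssm strongly_measurable_indicator) simp
  have "Lp_norm_on p \<mu> UNIV (\<lambda>x. f x - g x) \<le>
     Lp_norm_on p \<mu> UNIV (\<lambda>x. f x - indicator U x *\<^sub>R s x) +
       Lp_norm_on p \<mu> UNIV (\<lambda>x. indicator U x *\<^sub>R s x - g x)"
    using g(1) by (intro Lp_norm_on_triangle_sm[OF p] strongly_measurable_diff fsm Usm)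
      (auto simp: Cc_def norm_diff_triangle_le[OF order_refl order_refl])
  also have "Lp_norm_on p \<mu> UNIV (\<lambda>x. f x - indicator U x *\<^sub>R s x) \<le> Lp_norm_on p \<mu> UNIV (\<lambda>x. f x - s x)"
    using p by (intro Lp_norm_on_mono_AE, simp, use U(2) in eventually_elim) (auto split:
      split_indicator)
  also have "Lp_norm_on p \<mu> UNIV (\<lambda>x. f x - s x) + Lp_norm_on p \<mu> UNIV (\<lambda>x. indicator U x *\<^sub>R s x - g x)
     < ennreal (e / 2) + ennreal (e / 2)" using s(2) g(2) by (intro add_strict_mono)
  also have "\<dots> = ennreal e" using e by (simp flip: ennreal_plus)
  finally show thesis using that[OF g(1)] by (simp add: add_right_mono)
qed

text \<open>The tube lemma takes the place of uniform continuity: the neighbourhood of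
  \<open>h\<close> is uniform over the compact set \<open>M\<close>.\<close>

lemma uniform_neighbourhood:
  fixes F :: "'g \<Rightarrow> 'g \<Rightarrow> 'b::real_normed_vector"
  assumes F: "continuous_on UNIV (\<lambda>q. F (fst q) (snd q))" and M: "compact M" and e: "0 < e"
  shows "\<exists>V. open V \<and> h \<in> V \<and> (\<forall>h'\<in>V. \<forall>y\<in>M. norm (F h' y - F h y) < e)"
proof -
  have "continuous_on UNIV (\<lambda>q :: 'g \<times> 'g. F h (snd q) :: 'b)"
    using continuous_on_compose2[OF F, of UNIV "\<lambda>q::'g \<times> 'g. (h, snd q)"]
      by (simp add: continuous_intros)
  then have c: "continuous_on UNIV (\<lambda>q. norm (F (fst q) (snd q) - F h (snd q)))"
    by (intro continuous_intros F)
  have o: "open {q. norm (F (fst q) (snd q) - F h (snd q)) < e}"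
    using open_vimage[OF open_lessThan[of e] c] by (simp add: vimage_def)
  have "{h} \<times> M \<subseteq> {q. norm (F (fst q) (snd q) - F h (snd q)) < e}" using e by auto
  from Elementary_Topology.tube_lemma[OF M o this]
  obtain V where "h \<in> V" "open V" "V \<times> M \<subseteq> {q. norm (F (fst q) (snd q) - F h (snd q)) < e}"
    by (elim exE conjE)
  then show ?thesis by (intro exI[of _ V]) auto
qed

text \<open>Translation is isometric, so \<open>f\<close> may be exchanged for a continuous
  \<open>g\<close> of compact support. Its translates by small \<open>h\<close> are supported in one
  compact set, on which they are uniformly close to \<open>g\<close>.\<close>

lemma Lp_translation_continuous:
  fixes f :: "'g \<Rightarrow> 'b::real_normed_vector"
  assumes p: "1 \<le> p" and f: "f \<in> Lp_functions (ennreal p) \<mu>" and e: "0 < e"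
  shows "\<exists>\<Theta>. open \<Theta> \<and> 0 \<in> \<Theta> \<and> (\<forall>h\<in>\<Theta>. Lp_norm_on p \<mu> UNIV (\<lambda>x. translate h f x - f x) < ennreal e)"
proof -
  have fsm: "strongly_measurable \<mu> f" using f p by (simp add: Lp_iff)
  have e3: "e / 4 > 0" using e by simp
  obtain g where g: "g \<in> Cc UNIV" "Lp_norm_on p \<mu> UNIV (\<lambda>x. f x - g x) < ennreal (e / 4)"
    using Cc_dense[OF p f open_UNIV _ e3] by auto
  obtain K where K: "compact K" "\<And>x. x \<notin> K \<Longrightarrow> g x = 0" using g(1) by (auto simp: Cc_def)
  have gsm: "strongly_measurable \<mu> g" and gc: "continuous_on UNIV g" using g(1) by (auto simp: Cc_def)
  obtain W L where W: "open W" "(0::'g) \<in> W" "W \<subseteq> L" "compact L" by (rule zero_neighbourhood)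
  \<comment> \<open>Because of \<open>W \<subseteq> L\<close>, the set \<open>M\<close> contains the
    supports of all translates of \<open>g\<close> by elements of \<open>W\<close>, and
    \<open>0 \<in> W\<close> gives the support of \<open>g\<close> itself.\<close>
  define M where "M = (\<lambda>(x, y). x + y) ` (L \<times> K)"
  have M: "compact M" unfolding M_def by (intro compact_add_set W K)
  have KM: "K \<subseteq> M" unfolding M_def using W by (auto intro!: image_eqI[of _ _ "(0, _)"])
  have Mb: "M \<in> sets \<mu>" using compact_borel[OF M] by simp
  obtain d where d: "d > 0" "\<And>f :: 'g \<Rightarrow> 'b. (\<And>x. x \<in> M \<Longrightarrow> norm (f x) \<le> d) \<Longrightarrow> Lp_norm_on p \<mu> M f \<le>
    ennreal (e / 4)"
    using Lp_norm_on_const_le[OF p Mb emeasure_compact_finite[OF M] e3] by blast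
  have "continuous_on UNIV (\<lambda>q. g (- fst q + snd q))"
    by (intro continuous_on_compose2[OF gc] continuous_intros) auto
  from uniform_neighbourhood[where F="\<lambda>h y. g (- h + y)" and h=0, OF this M d(1)]
  obtain V where V: "open V" "0 \<in> V" and V3: "\<forall>h\<in>V. \<forall>y\<in>M. norm (g (- h + y) - g y) < d"
    by (elim exE conjE) simp
  show ?thesis
  proof (intro exI[of _ "V \<inter> W"] conjI ballI)
    fix h assume h: "h \<in> V \<inter> W"
    have "Lp_norm_on p \<mu> UNIV (\<lambda>x. g (- h + x) - g x) = Lp_norm_on p \<mu> UNIV (\<lambda>x. indicator M x *\<^sub>R (g
      (- h + x) - g x))"
    proof (rule Lp_norm_on_cong_AE, rule AE_I2, rule impI)
      fix x
      have "- h + x \<notin> K" if "x \<notin> M"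
      proof
        assume "- h + x \<in> K"
        then have "x \<in> M" unfolding M_def using h W
          by (intro image_eqI[of _ _ "(h, - h + x)"]) (auto simp: add.assoc[symmetric])
        then show False using that by simp
      qed
      then show "norm (g (- h + x) - g x) = norm (indicator M x *\<^sub>R (g (- h + x) - g x))"
        using K(2) KM by (auto split: split_indicator)
    qed
    also have "\<dots> = Lp_norm_on p \<mu> M (\<lambda>x. g (- h + x) - g x)" by (simp add: Lp_norm_on_indicator)
    also have "\<dots> \<le> ennreal (e / 4)" using V3 h by (intro d(2)) (auto intro: less_imp_le)
    finally have gg: "Lp_norm_on p \<mu> UNIV (\<lambda>x. g (- h + x) - g x) \<le> ennreal (e / 4)" .
    have sm: "strongly_measurable \<mu> (\<lambda>x. f x - g x)" by (intro strongly_measurable_diff fsm gsm)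
    have "Lp_norm_on p \<mu> UNIV (\<lambda>x. f (- h + x) - f x) \<le>
       Lp_norm_on p \<mu> UNIV (\<lambda>x. f (- h + x) - g (- h + x)) + Lp_norm_on p \<mu> UNIV (\<lambda>x. g (- h + x) - f x)"
      by (intro Lp_norm_on_triangle_sm[OF p] strongly_measurable_diff strongly_measurable_translate
        fsm gsm)
        (auto simp: norm_diff_triangle_le[OF order_refl order_refl])
    also have "Lp_norm_on p \<mu> UNIV (\<lambda>x. f (- h + x) - g (- h + x)) = Lp_norm_on p \<mu> UNIV (\<lambda>x. f x - g x)"
      by (rule Lp_norm_translate[OF sm])
    also have "Lp_norm_on p \<mu> UNIV (\<lambda>x. g (- h + x) - f x) \<le>
       Lp_norm_on p \<mu> UNIV (\<lambda>x. g (- h + x) - g x) + Lp_norm_on p \<mu> UNIV (\<lambda>x. f x - g x)"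
      by (intro Lp_norm_on_triangle_sm[OF p] strongly_measurable_diff strongly_measurable_translate
        fsm gsm)
        (auto simp: norm_minus_commute[of "f _" "g _"] norm_diff_triangle_le[OF order_refl order_refl])
    also have "Lp_norm_on p \<mu> UNIV (\<lambda>x. f x - g x) + (Lp_norm_on p \<mu> UNIV (\<lambda>x. g (- h + x) - g x) +
      Lp_norm_on p \<mu> UNIV (\<lambda>x. f x - g x))
       \<le> ennreal (e / 4) + (ennreal (e / 4) + ennreal (e / 4))"
      using g(2) gg by (intro add_mono) auto
    also have "\<dots> = ennreal (3 * e / 4)" using e by (simp flip: ennreal_plus)
    also have "\<dots> < ennreal e" using e by (simp add: ennreal_less_iff)
    finally show "Lp_norm_on p \<mu> UNIV (\<lambda>x. translate h f x - f x) < ennreal e"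
      by (simp add: translate_def add_left_mono)
  qed (use V W in auto)
qed

section \<open>Averages of reflected functions\<close>

text \<open>The inequality \<open>t \<le> 1 + t powr p\<close> for \<open>t \<ge> 0\<close> does the
  work of Hoelder's inequality: \<open>A\<close> has finite measure, and the reflected
  \<open>p\<close>-th power is controlled by the reflection bound on \<open>A\<close>.\<close>

lemma Lp_average_finite:
  fixes g :: "'g \<Rightarrow> 'b::real_normed_vector"
  assumes p: "1 \<le> p" and A: "compact A" and g: "g \<in> Lp_functions (ennreal p) \<mu>"
  shows "(\<integral>\<^sup>+y\<in>A. ennreal (norm (g (- y))) \<partial>\<mu>) < \<infinity>"
proof -
  have Ab: "A \<in> sets borel" by (rule compact_borel[OF A])
  obtain C where C: "reflection_bound A C" using reflection_bound_compact[OF A] by blast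
  have gsm: "strongly_measurable \<mu> g" using g p by (simp add: Lp_iff)
  have m: "(\<lambda>x. ennreal (norm (g x) powr p)) \<in> borel_measurable (completion \<mu>)"
    using strongly_measurable_norm_completion[OF gsm] by measurable
  have "(\<lambda>y. norm (indicator A y *\<^sub>R g (- y))) \<in> borel_measurable (completion \<mu>)"
    using gsm reflection_bound_imp_null[OF Ab C]
      by (intro strongly_measurable_norm_completion strongly_measurable_reflect)
  then have "(\<lambda>y. ennreal (norm (indicator A y *\<^sub>R g (- y)) powr p)) \<in> borel_measurable (completion
    \<mu>)" by measurable
  then have m2: "(\<lambda>y. ennreal (norm (g (- y)) powr p) * indicator A y) \<in> borel_measurable (completion \<mu>)"
    by (rule measurable_cong[THEN iffD1, rotated]) (auto split: split_indicator)
  have "(\<integral>\<^sup>+y\<in>A. ennreal (norm (g (- y))) \<partial>\<mu>) \<le> (\<integral>\<^sup>+y. indicator A y +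
    ennreal (norm (g (- y)) powr p) * indicator A y \<partial>\<mu>)"
  proof (rule nn_integral_mono)
    fix y
    have "norm (g (- y)) \<le> 1 + norm (g (- y)) powr p"
    proof (cases "norm (g (- y)) \<le> 1")
      case False
      then show ?thesis using powr_mono[of 1 p "norm (g (- y))"] p by simp
    qed (simp add: add_increasing2)
    from ennreal_leI[OF this] have "ennreal (norm (g (- y))) \<le> 1 + ennreal (norm (g (- y)) powr p)"
      by simp
    then show "ennreal (norm (g (- y))) * indicator A y \<le> indicator A y +
      ennreal (norm (g (- y)) powr p) * indicator A y"
      by (auto split: split_indicator)
  qed
  also have "\<dots> = emeasure \<mu> A + (\<integral>\<^sup>+y\<in>A. ennreal (norm (g (- y)) powr p) \<partial>\<mu>)"
  proof (subst nn_integral_add_completion[OF _ m2])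
    show "indicator A \<in> borel_measurable (completion \<mu>)"
      using Ab by (intro measurable_completion borel_measurable_indicator) simp
  qed (use Ab in simp)
  also have "\<dots> \<le> emeasure \<mu> A + ennreal C * (\<integral>\<^sup>+x. ennreal (norm (g x) powr p) \<partial>\<mu>)"
    using nn_integral_reflect_le[OF Ab C m] by (rule add_left_mono)
  also have "\<dots> < \<infinity>"
    using emeasure_compact_finite[OF A] g p Lp_norm_on_finite_iff[of p \<mu> UNIV g]
    by (auto simp: Lp_iff ennreal_mult_less_top)
  finally show ?thesis .
qed

text \<open>A uniform boundedness principle: if the bound fails along normalised functions \<open>u n\<close>, it fails
  for the single function \<open>(\<Sum>n. 2\<^sup>-\<^sup>n u n\<^sup>p)\<^sup>1\<^sup>/\<^sup>p\<close>, which dominates every \<open>u n\<close> up to a factor \<open>2\<^sup>n\<close>.\<close>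

lemma Lp_average_bound:
  assumes p: "1 \<le> p" and A: "reflection_null A"
    and fin: "\<And>g :: 'g \<Rightarrow> 'b::real_normed_vector. g \<in> Lp_functions (ennreal p) \<mu> \<Longrightarrow>
      (\<integral>\<^sup>+y\<in>A. ennreal (norm (g (- y))) \<partial>\<mu>) < \<infinity>"
  shows "\<exists>C\<ge>0. \<forall>g :: 'g \<Rightarrow> 'b. g \<in> Lp_functions (ennreal p) \<mu> \<longrightarrow>
    (\<integral>\<^sup>+y\<in>A. ennreal (norm (g (- y))) \<partial>\<mu>) \<le> ennreal C * Lp_norm_on p \<mu> UNIV g"
proof (rule ccontr)
  assume contr: "\<not> ?thesis"
  \<comment> \<open>The factor \<open>2^n\<close> compensates for the domination of the
    \<open>n\<close>-th function by \<open>2^n\<close> times the combined one, so that the failure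
    of this bound forces the average of the combined function to be at least
    \<open>n\<close>.\<close>
  have "\<exists>g :: 'g \<Rightarrow> 'b. g \<in> Lp_functions (ennreal p) \<mu> \<and>
     \<not> (\<integral>\<^sup>+y\<in>A. ennreal (norm (g (- y))) \<partial>\<mu>) \<le> ennreal (real n * 2^n) * Lp_norm_on p \<mu> UNIV g" for n
       :: nat
    using contr by (metis mult_nonneg_nonneg of_nat_0_le_iff zero_le_numeral zero_le_power)
  then obtain g :: "nat \<Rightarrow> 'g \<Rightarrow> 'b" where g: "\<And>n. g n \<in> Lp_functions (ennreal p) \<mu>"
    and big: "\<And>n. \<not> (\<integral>\<^sup>+y\<in>A. ennreal (norm (g n (- y))) \<partial>\<mu>) \<le>
      ennreal (real n * 2^n) * Lp_norm_on p \<mu> UNIV (g n)"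
    by metis
  have gsm: "strongly_measurable \<mu> (g n)" for n using g p by (simp add: Lp_iff)
  define r where "r n = enn2real (Lp_norm_on p \<mu> UNIV (g n))" for n
  have r: "Lp_norm_on p \<mu> UNIV (g n) = ennreal (r n)" for n
    using g[of n] p by (simp add: Lp_iff r_def)
  \<comment> \<open>A function of norm 0 vanishes almost everywhere, and so does its reflection on
    \<open>A\<close>; the bound would then hold trivially.\<close>
  have r0: "r n > 0" for n
  proof (rule ccontr)
    assume "\<not> r n > 0"
    then have "Lp_norm_on p \<mu> (space \<mu>) (g n) = 0" using r[of n] by (simp add: ennreal_neg)
    from AE_reflect[OF A Lp_norm_on_eq_0[OF p gsm this]]
    have "(\<integral>\<^sup>+y\<in>A. ennreal (norm (g n (- y))) \<partial>\<mu>) = (\<integral>\<^sup>+y. 0 \<partial>\<mu>)"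
      by (intro nn_integral_cong_AE, eventually_elim) (auto split: split_indicator)
    then show False using big[of n] by simp
  qed
  have "\<exists>v. v \<in> borel_measurable \<mu> \<and> (AE x in \<mu>. norm (g n x) = v x)" for n
    using strongly_measurable_imp_borel_AE[OF strongly_measurable_norm[OF gsm[of n]]] by blast
  then obtain v where v: "\<And>n. v n \<in> borel_measurable \<mu>"
    and gv: "\<And>n. AE x in \<mu>. norm (g n x) = v n x" by metis
  note v[measurable]
  define u where "u n x = \<bar>v n x\<bar> / r n" for n x
  have [measurable]: "u n \<in> borel_measurable \<mu>" for n unfolding u_def by measurable
  have u0: "0 \<le> u n x" for n x using r0[of n] by (simp add: u_def)
  have uint: "(\<integral>\<^sup>+x. ennreal (u n x powr p) \<partial>\<mu>) \<le> 1" for n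
  proof -
    have "(\<integral>\<^sup>+x. ennreal (u n x powr p) \<partial>\<mu>) = (\<integral>\<^sup>+x. ennreal (1 / r n powr p) * ennreal (norm (g n x)
      powr p) \<partial>\<mu>)"
    proof (rule nn_integral_cong_AE, use gv[of n] in eventually_elim)
      case (elim x)
      have "\<bar>v n x\<bar> = norm (g n x)" using elim by (metis abs_norm_cancel)
      then show ?case using r0[of n] by (simp add: u_def powr_divide flip: ennreal_mult)
    qed
    also have "\<dots> = ennreal (1 / r n powr p) * (\<integral>\<^sup>+x. ennreal (norm (g n x) powr p) \<partial>\<mu>)"
    proof (rule nn_integral_cmult_completion)
      show "(\<lambda>x. ennreal (norm (g n x) powr p)) \<in> borel_measurable (completion \<mu>)"
        using strongly_measurable_norm_completion[OF gsm[of n]] by measurable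
    qed
    also have "(\<integral>\<^sup>+x. ennreal (norm (g n x) powr p) \<partial>\<mu>) \<le> ennreal (r n powr p)"
      using Lp_norm_on_le_iff[of p "r n" \<mu> UNIV "g n"] p r0[of n] r[of n] by simp
    also have "ennreal (1 / r n powr p) * ennreal (r n powr p) = 1"
      using r0[of n] by (simp flip: ennreal_mult)
    finally show ?thesis by (simp add: mult_left_mono)
  qed
  define S where "S x = (\<Sum>n. ennreal ((1/2)^n * u n x powr p))" for x
  have [measurable]: "S \<in> borel_measurable \<mu>" unfolding S_def by measurable
  have Sint: "(\<integral>\<^sup>+x. S x \<partial>\<mu>) \<le> ennreal 2"
  proof -
    have "(\<integral>\<^sup>+x. S x \<partial>\<mu>) = (\<Sum>n. \<integral>\<^sup>+x. ennreal ((1/2)^n * u n x powr p) \<partial>\<mu>)"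
      unfolding S_def by (rule nn_integral_suminf) measurable
    also have "\<dots> \<le> (\<Sum>n. ennreal ((1/2)^n))"
    proof (rule suminf_le)
      fix n
      have "(\<integral>\<^sup>+x. ennreal ((1/2)^n * u n x powr p) \<partial>\<mu>) =
        ennreal ((1/2)^n) * (\<integral>\<^sup>+x. ennreal (u n x powr p) \<partial>\<mu>)"
        by (subst nn_integral_cmult[symmetric]) (auto simp: ennreal_mult)
      also have "\<dots> \<le> ennreal ((1/2)^n) * 1" by (intro mult_left_mono uint) simp
      finally show "(\<integral>\<^sup>+x. ennreal ((1/2)^n * u n x powr p) \<partial>\<mu>) \<le> ennreal ((1/2)^n)" by simp
    qed auto
    also have "\<dots> = ennreal (\<Sum>n. (1/2)^n)" by (rule suminf_ennreal2) (auto simp: summable_geometric)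
    also have "(\<Sum>n. (1/2)^n :: real) = 2" by (simp add: suminf_geometric)
    finally show ?thesis .
  qed
  have Sfin: "AE x in \<mu>. S x \<noteq> \<infinity>" using Sint by (intro nn_integral_PInf_AE) (auto simp: top_unique)
  \<comment> \<open>A unit vector turns the scalar sum into a function with values in
    \<open>'b\<close>; the space is nonzero because it admits functions of positive norm.\<close>
  obtain b :: 'b where b: "norm b = 1"
  proof -
    have "\<exists>b :: 'b. b \<noteq> 0"
    proof (rule ccontr)
      assume "\<not> (\<exists>b :: 'b. b \<noteq> 0)"
      then have "g 0 x = 0" for x by blast
      then have "Lp_norm_on p \<mu> UNIV (g 0) \<le> ennreal 0" using p by (subst Lp_norm_on_le_iff) auto
      then show False using r[of 0] r0[of 0] by simp
    qed
    then obtain b :: 'b where "b \<noteq> 0" by blast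
    then show thesis by (intro that[of "(1 / norm b) *\<^sub>R b"]) simp
  qed
  define G where "G x = enn2real (S x) powr (1 / p)" for x
  define w where "w x = G x *\<^sub>R b" for x
  have [measurable]: "G \<in> borel_measurable \<mu>" unfolding G_def by measurable
  have wn: "norm (w x) = G x" for x using b by (simp add: w_def G_def)
  have "w \<in> Lp_functions (ennreal p) \<mu>"
    unfolding Lp_iff[OF p]
  proof
    show "strongly_measurable \<mu> w" unfolding w_def
      by (intro strongly_measurable_scaleR strongly_measurable_const strongly_measurable_borel)
        measurable
    have "(\<integral>\<^sup>+x\<in>UNIV. ennreal (norm (w x) powr p) \<partial>\<mu>) \<le> (\<integral>\<^sup>+x. S x \<partial>\<mu>)"
    proof (rule nn_integral_mono)
      fix x show "ennreal (norm (w x) powr p) * indicator UNIV x \<le> S x"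
        using p by (cases "S x" rule: ennreal_cases) (auto simp: wn G_def powr_powr)
    qed
    also note Sint
    finally show "Lp_norm_on p \<mu> UNIV w < \<infinity>" unfolding Lp_norm_on_finite_iff
      by (metis ennreal_less_top infinity_ennreal_def le_less_trans)
  qed
  from fin[OF this] obtain l where l: "(\<integral>\<^sup>+y\<in>A. ennreal (norm (w (- y))) \<partial>\<mu>) = ennreal l" "l \<ge> 0"
    by (cases "\<integral>\<^sup>+y\<in>A. ennreal (norm (w (- y))) \<partial>\<mu>" rule: ennreal_cases) auto
  have wm: "(\<lambda>y. ennreal (norm (w (- y))) * indicator A y) \<in> borel_measurable \<mu>"
  proof -
    have [measurable]: "A \<in> sets borel" using A by (simp add: reflection_null_def)
    show ?thesis unfolding wn by measurable
  qed
  have n_le: "real n \<le> l" for n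
  proof -
    have "AE x in \<mu>. norm (g n x) \<le> r n * 2^n * norm (w x)"
      using gv[of n] Sfin
    proof eventually_elim
      case (elim x)
      have "ennreal ((1/2)^n * u n x powr p) \<le> S x" unfolding S_def
        by (rule sum_le_suminf[of _ "{n}", simplified]) auto
      then have le: "(1/2)^n * u n x powr p \<le> enn2real (S x)"
        using elim u0 by (cases "S x" rule: ennreal_cases) auto
      have "u n x = (u n x powr p) powr (1 / p)" using p u0 by (simp add: powr_powr)
      also have "\<dots> \<le> (2^n * enn2real (S x)) powr (1 / p)"
        using le p by (intro powr_mono2) (auto simp: field_simps)
      also have "\<dots> = (2^n) powr (1 / p) * G x" by (simp add: powr_mult G_def)
      also have "\<dots> \<le> 2^n * G x"
        using powr_mono[of "1 / p" 1 "2^n"] p by (intro mult_right_mono) (auto simp: G_def)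
      finally have "\<bar>v n x\<bar> \<le> r n * (2^n * G x)" using r0[of n] by (simp add: u_def field_simps)
      then show ?case using elim wn[of x] by (simp add: mult.assoc)
    qed
    from AE_reflect[OF A this]
    have "(\<integral>\<^sup>+y\<in>A. ennreal (norm (g n (- y))) \<partial>\<mu>) \<le> (\<integral>\<^sup>+y. ennreal (r n * 2^n) * (ennreal (norm (w (-
      y))) * indicator A y) \<partial>\<mu>)"
      by (intro nn_integral_mono_AE, eventually_elim)
        (use r0[of n] in \<open>auto split: split_indicator simp flip: ennreal_mult intro!: ennreal_leI\<close>)
    also have "\<dots> = ennreal (r n * 2^n) * ennreal l" using wm by (subst nn_integral_cmult) (auto simp: l)
    finally have "\<not> ennreal (r n * 2^n) * ennreal l \<le> ennreal (real n * 2^n) * ennreal (r n)"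
      using big[of n] r[of n] by (auto intro: order_trans)
    then have "real n * 2^n * r n < r n * 2^n * l" using r0[of n] l(2)
      by (simp flip: ennreal_mult add: not_le ennreal_less_iff)
    then show ?thesis using r0[of n] by (simp add: mult.commute mult.left_commute)
  qed
  then show False using reals_Archimedean2[of l] by (auto simp: not_le[symmetric])
qed

lemma Lp_average_bound_compact:
  assumes p: "1 \<le> p" and A: "compact A"
  obtains C where "0 \<le> C" "\<And>g :: 'g \<Rightarrow> 'b::real_normed_vector. g \<in> Lp_functions (ennreal p) \<mu> \<Longrightarrow>
    (\<integral>\<^sup>+y\<in>A. ennreal (norm (g (- y))) \<partial>\<mu>) \<le> ennreal C * Lp_norm_on p \<mu> UNIV g"
proof -
  have "reflection_null A"
    using reflection_bound_compact[OF A] reflection_bound_imp_null[OF compact_borel[OF A]] by blast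
  from Lp_average_bound[OF p this Lp_average_finite[OF p A]] show thesis using that by blast
qed

lemma bochner_integrable_on_reflect:
  fixes g :: "'g \<Rightarrow> 'b::banach"
  assumes "strongly_measurable \<mu> g" "reflection_null A" "(\<integral>\<^sup>+y\<in>A. ennreal (norm (g (- y))) \<partial>\<mu>) < \<infinity>"
  shows "bochner_integrable_on \<mu> A (\<lambda>y. g (- y))"
  unfolding bochner_integrable_on_def
proof (rule has_bochner_int_exists[OF strongly_measurable_reflect[OF assms(1,2)]])
  have "(\<integral>\<^sup>+y. ennreal (norm (indicator A y *\<^sub>R g (- y))) \<partial>\<mu>) = (\<integral>\<^sup>+y\<in>A. ennreal (norm (g (- y))) \<partial>\<mu>)"
    by (intro nn_integral_cong) (auto split: split_indicator)
  then show "(\<integral>\<^sup>+y. ennreal (norm (indicator A y *\<^sub>R g (- y))) \<partial>\<mu>) < \<infinity>" using assms(3) by simp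
qed

lemma bochner_integral_on_reflect_diff:
  fixes f g :: "'g \<Rightarrow> 'b::banach"
  assumes "bochner_integrable_on \<mu> A (\<lambda>y. f (- y))" "bochner_integrable_on \<mu> A (\<lambda>y. g (- y))"
  shows "ennreal (norm (bochner_integral_on \<mu> A (\<lambda>y. f (- y)) - bochner_integral_on \<mu> A (\<lambda>y. g (- y)))) \<le>
    (\<integral>\<^sup>+y\<in>A. ennreal (norm (f (- y) - g (- y))) \<partial>\<mu>)"
proof -
  have "ennreal (norm (bochner_integral_on \<mu> A (\<lambda>y. f (- y)) - bochner_integral_on \<mu> A (\<lambda>y. g (- y)))) \<le>
    (\<integral>\<^sup>+y. ennreal (norm (indicator A y *\<^sub>R f (- y) - indicator A y *\<^sub>R g (- y))) \<partial>\<mu>)"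
    by (intro has_bochner_int_norm_le has_bochner_int_diff has_bochner_int_bochner_integral_on assms)
  also have "\<dots> = (\<integral>\<^sup>+y\<in>A. ennreal (norm (f (- y) - g (- y))) \<partial>\<mu>)"
    by (intro nn_integral_cong) (auto split: split_indicator)
  finally show ?thesis .
qed

section \<open>Necessity\<close>

text \<open>Outside the support of an approximating function of compact support, \<open>f\<close>
  coincides with the error of the approximation.\<close>

lemma Lp_tail_small:
  fixes f :: "'g \<Rightarrow> 'b::real_normed_vector"
  assumes p: "1 \<le> p" and f: "f \<in> Lp_functions (ennreal p) \<mu>" and e: "0 < e"
  obtains S where "compact S" "Lp_norm_on p \<mu> (- S) f < ennreal e"
proof -
  obtain g where g: "g \<in> Cc UNIV" "Lp_norm_on p \<mu> UNIV (\<lambda>x. f x - g x) < ennreal e"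
    using Cc_dense[OF p f open_UNIV _ e] by auto
  then obtain K where K: "compact K" "\<And>x. x \<notin> K \<Longrightarrow> g x = 0" by (auto simp: Cc_def)
  have "Lp_norm_on p \<mu> (- K) f \<le> Lp_norm_on p \<mu> (- K) (\<lambda>x. f x - g x)"
    using p K(2) by (intro Lp_norm_on_mono) auto
  also have "\<dots> \<le> Lp_norm_on p \<mu> UNIV (\<lambda>x. f x - g x)" using p by (intro Lp_norm_on_mono_set) auto
  finally show thesis using that[OF K(1)] g(2) by simp
qed

text \<open>Closed balls of half the radius have a closed finite union, which therefore covers the
  closure too.\<close>

lemma compact_closure_of_finite_nets:
  fixes T :: "'b::banach set"
  assumes "\<And>e. 0 < e \<Longrightarrow> \<exists>K. finite K \<and> T \<subseteq> (\<Union>x\<in>K. ball x e)"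
  shows "compact (closure T)"
  unfolding compact_eq_totally_bounded
proof (intro conjI allI impI)
  show "complete (closure T)" by (simp add: complete_eq_closed)
  fix e :: real assume e: "0 < e"
  then obtain K where K: "finite K" "T \<subseteq> (\<Union>x\<in>K. ball x (e / 2))" using assms[of "e / 2"] by auto
  have "T \<subseteq> (\<Union>x\<in>K. cball x (e / 2))" using K(2) ball_subset_cball by blast
  moreover have "closed (\<Union>x\<in>K. cball x (e / 2))" using K(1) by (intro closed_UN) auto
  ultimately have "closure T \<subseteq> (\<Union>x\<in>K. cball x (e / 2))" by (rule closure_minimal)
  also have "\<dots> \<subseteq> (\<Union>x\<in>K. ball x e)" using e by (intro UN_mono) auto
  finally show "\<exists>k. finite k \<and> closure T \<subseteq> (\<Union>x\<in>k. ball x e)" using K(1) by blast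
qed

text \<open>On a set of finite measure reflection may be unbounded. The existence of the average on
  all of \<open>L\<^sup>p\<close> still makes averaging a bounded operator, and this carries finite
  nets of functions to finite nets of averages.\<close>

lemma necessary_averages:
  fixes \<Gamma> :: "('g \<Rightarrow> 'b::banach) set set"
  assumes p: "1 \<le> p" and \<Gamma>: "\<Gamma> \<subseteq> Lp_space p \<mu>"
    and tb: "Metric_space.mtotally_bounded (Lp_space p \<mu>) (Lp_dist p \<mu>) \<Gamma>"
    and A: "A \<in> sets borel" "emeasure \<mu> A < \<infinity>"
    and int: "\<And>g :: 'g \<Rightarrow> 'b. g \<in> Lp_functions (ennreal p) \<mu> \<Longrightarrow> bochner_integrable_on \<mu> A (\<lambda>y. g (- y))"
  shows "compact (closure {bochner_integral_on \<mu> A (\<lambda>y. f (- y)) | F f. F \<in> \<Gamma> \<and> f \<in> F})"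
proof (rule compact_closure_of_finite_nets)
  fix e :: real assume e: "0 < e"
  have An: "reflection_null A" by (rule reflection_null_finite[OF A])
  have fin: "(\<integral>\<^sup>+y\<in>A. ennreal (norm (g (- y))) \<partial>\<mu>) < \<infinity>"
    if g: "g \<in> Lp_functions (ennreal p) \<mu>" for g :: "'g \<Rightarrow> 'b"
  proof -
    have "(\<integral>\<^sup>+y\<in>A. ennreal (norm (g (- y))) \<partial>\<mu>) = (\<integral>\<^sup>+y. ennreal (norm (indicator A y *\<^sub>R g (- y))) \<partial>\<mu>)"
      by (intro nn_integral_cong) (auto split: split_indicator)
    then show ?thesis
      using has_bochner_int_finite[OF has_bochner_int_bochner_integral_on[OF int[OF g]]] by simp
  qed
  obtain C where C: "0 \<le> C" "\<And>g :: 'g \<Rightarrow> 'b. g \<in> Lp_functions (ennreal p) \<mu> \<Longrightarrow>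
    (\<integral>\<^sup>+y\<in>A. ennreal (norm (g (- y))) \<partial>\<mu>) \<le> ennreal C * Lp_norm_on p \<mu> UNIV g"
    using Lp_average_bound[OF p An fin] by blast
  have e': "0 < e / (C + 1)" using e C by simp
  obtain K where K: "finite K" "K \<subseteq> Lp_functions (ennreal p) \<mu>"
    "\<And>F f. F \<in> \<Gamma> \<Longrightarrow> f \<in> F \<Longrightarrow> \<exists>g\<in>K. Lp_norm_on p \<mu> (space \<mu>) (\<lambda>x. f x - g x) < ennreal (e / (C + 1))"
    using Lp_totally_bounded_imp_net[OF p tb e'] by metis
  let ?I = "\<lambda>f. bochner_integral_on \<mu> A (\<lambda>y. f (- y))"
  have "{?I f | F f. F \<in> \<Gamma> \<and> f \<in> F} \<subseteq> (\<Union>x\<in>?I ` K. ball x e)"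
  proof clarify
    fix F f assume Ff: "F \<in> \<Gamma>" "f \<in> F"
    then have f: "f \<in> Lp_functions (ennreal p) \<mu>" using \<Gamma> Lp_space_imp_function by blast
    obtain g where g: "g \<in> K" "Lp_norm_on p \<mu> UNIV (\<lambda>x. f x - g x) < ennreal (e / (C + 1))"
      using K(3)[OF Ff] by auto
    have gL: "g \<in> Lp_functions (ennreal p) \<mu>" using g K by auto
    have "ennreal (norm (?I g - ?I f)) \<le> (\<integral>\<^sup>+y\<in>A. ennreal (norm (g (- y) - f (- y))) \<partial>\<mu>)"
      by (intro bochner_integral_on_reflect_diff int f gL)
    also have "\<dots> \<le> ennreal C * Lp_norm_on p \<mu> UNIV (\<lambda>x. g x - f x)"
      using C(2)[OF Lp_functions_diff[OF p gL f]] .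
    also have "\<dots> \<le> ennreal C * ennreal (e / (C + 1))"
      using g(2) by (intro mult_left_mono) (auto simp: Lp_norm_on_minus_commute[of p \<mu> UNIV g f])
    also have "\<dots> = ennreal (C * (e / (C + 1)))" using C(1) e by (simp flip: ennreal_mult)
    finally have "norm (?I g - ?I f) \<le> C * (e / (C + 1))" using C(1) e by (simp add: ennreal_le_iff)
    also have "\<dots> < e" using C(1) e by (simp add: divide_less_eq algebra_simps)
    finally show "?I f \<in> (\<Union>x\<in>?I ` K. ball x e)" using g(1) by (auto simp: dist_norm)
  qed
  then show "\<exists>K. finite K \<and> {?I f | F f. F \<in> \<Gamma> \<and> f \<in> F} \<subseteq> (\<Union>x\<in>K. ball x e)"
    using K(1) by (intro exI[of _ "?I ` K"]) auto
qed

text \<open>Compact sets and neighbourhoods for the finitely many functions of a net are united and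
  intersected. Passing from the net to \<open>\<Gamma>\<close> costs one net error for a tail and
  two for a translation, which is isometric.\<close>

lemma necessary_translations:
  fixes \<Gamma> :: "('g \<Rightarrow> 'b::banach) set set"
  assumes p: "1 \<le> p" and \<Gamma>: "\<Gamma> \<subseteq> Lp_space p \<mu>"
    and tb: "Metric_space.mtotally_bounded (Lp_space p \<mu>) (Lp_dist p \<mu>) \<Gamma>" and e: "0 < e"
  shows "\<exists>S \<Theta>. compact S \<and> 0 \<in> interior \<Theta> \<and>
    (\<forall>F\<in>\<Gamma>. \<forall>f\<in>F. Lp_norm_on p \<mu> (- S) f < ennreal e) \<and>
    (\<forall>F\<in>\<Gamma>. \<forall>f\<in>F. \<forall>h\<in>\<Theta>. Lp_norm_on p \<mu> S (\<lambda>x. translate h f x - f x) < ennreal e)"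
proof -
  have e3: "0 < e / 3" using e by simp
  obtain K where K: "finite K" "K \<subseteq> Lp_functions (ennreal p) \<mu>"
    "\<And>F f. F \<in> \<Gamma> \<Longrightarrow> f \<in> F \<Longrightarrow> \<exists>g\<in>K. Lp_norm_on p \<mu> (space \<mu>) (\<lambda>x. f x - g x) < ennreal (e / 3)"
    using Lp_totally_bounded_imp_net[OF p tb e3] by metis
  have "\<exists>S. compact S \<and> Lp_norm_on p \<mu> (- S) g < ennreal (e / 3)" if "g \<in> K" for g
    using Lp_tail_small[OF p _ e3, of g] that K(2) by blast
  then obtain S where S: "\<And>g. g \<in> K \<Longrightarrow> compact (S g) \<and> Lp_norm_on p \<mu> (- S g) g < ennreal (e / 3)"
    by metis
  have "\<exists>\<Theta>. open \<Theta> \<and> 0 \<in> \<Theta> \<and> (\<forall>h\<in>\<Theta>. Lp_norm_on p \<mu> UNIV (\<lambda>x. translate h g x - g x) <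
    ennreal (e / 3))" if "g \<in> K" for g
    using that K(2) by (intro Lp_translation_continuous[OF p _ e3]) auto
  then obtain \<Theta> where \<Theta>: "\<And>g. g \<in> K \<Longrightarrow> open (\<Theta> g) \<and> 0 \<in> \<Theta> g \<and>
    (\<forall>h\<in>\<Theta> g. Lp_norm_on p \<mu> UNIV (\<lambda>x. translate h g x - g x) < ennreal (e / 3))"
    by metis
  define S' where "S' = (\<Union>g\<in>K. S g)"
  define \<Theta>' where "\<Theta>' = (\<Inter>g\<in>K. \<Theta> g)"
  have S': "compact S'" unfolding S'_def using K(1) S by (intro compact_UN) auto
  have \<Theta>': "open \<Theta>'" "0 \<in> \<Theta>'" unfolding \<Theta>'_def using K(1) \<Theta> by (auto intro: open_INT)
  have sum3: "ennreal (e / 3) + (ennreal (e / 3) + ennreal (e / 3)) = ennreal e" using e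
    by (simp flip: ennreal_plus)
  have main: "Lp_norm_on p \<mu> (- S') f < ennreal e \<and> (\<forall>h\<in>\<Theta>'. Lp_norm_on p \<mu> S' (\<lambda>x. translate h f x -
    f x) < ennreal e)"
    if Ff: "F \<in> \<Gamma>" "f \<in> F" for F f
  proof -
    obtain g where g: "g \<in> K" "Lp_norm_on p \<mu> UNIV (\<lambda>x. f x - g x) < ennreal (e / 3)"
      using K(3)[OF Ff] by auto
    have gsm: "strongly_measurable \<mu> g" using g K(2) p by (auto simp: Lp_iff)
    have fsm: "strongly_measurable \<mu> f" using Ff \<Gamma> Lp_space_imp_function p by (metis Lp_iff subsetD)
    have S'b: "- S' \<in> sets \<mu>" using compact_borel[OF S'] by auto
    have "Lp_norm_on p \<mu> (- S') f \<le> Lp_norm_on p \<mu> (- S') g + Lp_norm_on p \<mu> (- S') (\<lambda>x. f x - g x)"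
      by (intro Lp_norm_on_triangle_sm[OF p S'b] fsm gsm strongly_measurable_diff norm_triangle_sub)
    also have "Lp_norm_on p \<mu> (- S') (\<lambda>x. f x - g x) \<le> Lp_norm_on p \<mu> UNIV (\<lambda>x. f x - g x)"
      using p by (intro Lp_norm_on_mono_set) auto
    also have "Lp_norm_on p \<mu> (- S') g \<le> Lp_norm_on p \<mu> (- S g) g"
      using p g(1) by (intro Lp_norm_on_mono_set) (auto simp: S'_def)
    also have "Lp_norm_on p \<mu> (- S g) g + Lp_norm_on p \<mu> UNIV (\<lambda>x. f x - g x) < ennreal (e / 3) +
      ennreal (e / 3)"
      using S[OF g(1)] g(2) by (intro add_strict_mono) auto
    also have "\<dots> \<le> ennreal e" using e by (simp flip: ennreal_plus)
    finally have 1: "Lp_norm_on p \<mu> (- S') f < ennreal e" by (simp add: add_left_mono add_right_mono)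
    have "Lp_norm_on p \<mu> S' (\<lambda>x. translate h f x - f x) < ennreal e" if h: "h \<in> \<Theta>'" for h
    proof -
      have "Lp_norm_on p \<mu> S' (\<lambda>x. translate h f x - f x) \<le> Lp_norm_on p \<mu> UNIV (\<lambda>x. f (- h + x) - f x)"
        unfolding translate_def using p by (intro Lp_norm_on_mono_set) auto
      also have "\<dots> \<le> Lp_norm_on p \<mu> UNIV (\<lambda>x. f (- h + x) - g (- h + x)) +
        Lp_norm_on p \<mu> UNIV (\<lambda>x. g (- h + x) - f x)"
        by (intro Lp_norm_on_triangle_sm[OF p] strongly_measurable_diff
          strongly_measurable_translate fsm gsm)
          (auto simp: norm_diff_triangle_le[OF order_refl order_refl])
      also have "Lp_norm_on p \<mu> UNIV (\<lambda>x. f (- h + x) - g (- h + x)) =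
        Lp_norm_on p \<mu> UNIV (\<lambda>x. f x - g x)"
        by (rule Lp_norm_translate[OF strongly_measurable_diff[OF fsm gsm]])
      also have "Lp_norm_on p \<mu> UNIV (\<lambda>x. g (- h + x) - f x) \<le>
         Lp_norm_on p \<mu> UNIV (\<lambda>x. g (- h + x) - g x) + Lp_norm_on p \<mu> UNIV (\<lambda>x. f x - g x)"
        by (intro Lp_norm_on_triangle_sm[OF p] strongly_measurable_diff
          strongly_measurable_translate fsm gsm)
          (auto simp: norm_minus_commute[of "f _" "g _"] norm_diff_triangle_le[OF order_refl order_refl])
      also have "Lp_norm_on p \<mu> UNIV (\<lambda>x. f x - g x) + (Lp_norm_on p \<mu> UNIV (\<lambda>x. g (- h +
        x) - g x) + Lp_norm_on p \<mu> UNIV (\<lambda>x. f x - g x))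
         < ennreal (e / 3) + (ennreal (e / 3) + ennreal (e / 3))"
        using g(2) \<Theta>[OF g(1)] h g(1) by (intro add_strict_mono) (auto simp: \<Theta>'_def translate_def)
      finally show ?thesis unfolding sum3 by (simp add: add_left_mono)
    qed
    with 1 show ?thesis by blast
  qed
  show ?thesis
    using S' \<Theta>' main by (intro exI[of _ S'] exI[of _ \<Theta>']) (auto simp: interior_open)
qed

section \<open>Convolution\<close>

text \<open>The integrand is strongly measurable although reflection is controlled only on
  \<open>A\<close>: elsewhere the kernel vanishes almost everywhere, so \<open>f\<close> may be cut
  off to \<open>A\<close>.\<close>

lemma convolve_has_bochner_int:
  fixes f :: "'g \<Rightarrow> 'b::complex_banach"
  assumes j: "strongly_measurable \<mu> j" and f: "strongly_measurable \<mu> f" and A: "reflection_null A"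
    and off: "AE y in \<mu>. y \<notin> A \<longrightarrow> j (x + y) = 0"
    and fin: "(\<integral>\<^sup>+y. ennreal (cmod (j (x + y)) * norm (f (- y))) \<partial>\<mu>) < \<infinity>"
  shows "has_bochner_int \<mu> (\<lambda>y. j (x + y) *\<^sub>C f (- y)) (convolve \<mu> j f x)"
proof -
  have "strongly_measurable \<mu> (\<lambda>y. j (x + y) *\<^sub>C f (- y))"
  proof (rule strongly_measurable_cong_AE)
    show "strongly_measurable \<mu> (\<lambda>y. j (x + y) *\<^sub>C (indicator A y *\<^sub>R f (- y)))"
      by (intro strongly_measurable_scaleC strongly_measurable_translate strongly_measurable_reflect
        j f A)
    show "AE y in \<mu>. j (x + y) *\<^sub>C (indicator A y *\<^sub>R f (- y)) = j (x + y) *\<^sub>C f (- y)"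
      using off by eventually_elim (auto split: split_indicator simp: scaleC.zero_left scaleC.zero_right)
  qed
  then obtain I where I: "has_bochner_int \<mu> (\<lambda>y. j (x + y) *\<^sub>C f (- y)) I"
    using has_bochner_int_exists[of \<mu> "\<lambda>y. j (x + y) *\<^sub>C f (- y)"] fin by (auto simp: norm_scaleC)
  moreover have "convolve \<mu> j f x = I"
    unfolding convolve_def by (rule bochner_integral_on_eqI) (use I in simp)
  ultimately show ?thesis by simp
qed

lemma convolve_diff_le:
  fixes f :: "'g \<Rightarrow> 'b::complex_banach"
  assumes "has_bochner_int \<mu> (\<lambda>y. j (x + y) *\<^sub>C f (- y)) (convolve \<mu> j f x)"
    "has_bochner_int \<mu> (\<lambda>y. k (x + y) *\<^sub>C f (- y)) (convolve \<mu> k f x)"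
  shows "ennreal (norm (convolve \<mu> j f x - convolve \<mu> k f x)) \<le>
    (\<integral>\<^sup>+y. ennreal (cmod (j (x + y) - k (x + y)) * norm (f (- y))) \<partial>\<mu>)"
  using has_bochner_int_norm_le[OF has_bochner_int_diff[OF assms]]
  by (simp add: norm_scaleC flip: scaleC.diff_left)

text \<open>The bound on the kernel is an essential one, which left invariance moves from
  \<open>h\<close> to \<open>x + y\<close>; this covers the kernels of (2a) for
  \<open>p = 1\<close>.\<close>

lemma nn_integral_bounded_kernel_le:
  fixes g :: "'g \<Rightarrow> 'b::real_normed_vector"
  assumes g: "strongly_measurable \<mu> g" and \<kappa>: "AE h in \<mu>. \<kappa> h \<le> J" and A: "reflection_null A"
    and off: "AE y in \<mu>. y \<notin> A \<longrightarrow> \<kappa> (x + y) = 0" and J: "0 \<le> J"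
  shows "(\<integral>\<^sup>+y. ennreal (\<kappa> (x + y) * norm (g (- y))) \<partial>\<mu>) \<le>
    ennreal J * (\<integral>\<^sup>+y\<in>A. ennreal (norm (g (- y))) \<partial>\<mu>)"
proof -
  have m: "(\<lambda>y. norm (indicator A y *\<^sub>R g (- y))) \<in> borel_measurable (completion \<mu>)"
    by (intro strongly_measurable_norm_completion strongly_measurable_reflect g A)
  have "(\<integral>\<^sup>+y. ennreal (\<kappa> (x + y) * norm (g (- y))) \<partial>\<mu>) \<le>
    (\<integral>\<^sup>+y. ennreal J * ennreal (norm (indicator A y *\<^sub>R g (- y))) \<partial>\<mu>)"
  proof (rule nn_integral_mono_AE, use AE_translate[OF \<kappa>, of x] off in eventually_elim)
    case (elim y)
    then show ?case using J by (auto split: split_indicator simp flip: ennreal_mult intro!: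
      ennreal_leI mult_right_mono)
  qed
  also have "\<dots> = ennreal J * (\<integral>\<^sup>+y. ennreal (norm (indicator A y *\<^sub>R g (- y))) \<partial>\<mu>)"
    by (intro nn_integral_cmult_completion measurable_compose[OF m measurable_ennreal])
  also have "(\<integral>\<^sup>+y. ennreal (norm (indicator A y *\<^sub>R g (- y))) \<partial>\<mu>) = (\<integral>\<^sup>+y\<in>A. ennreal (norm (g (- y))) \<partial>\<mu>)"
    by (intro nn_integral_cong) (auto split: split_indicator)
  finally show ?thesis .
qed

text \<open>Minkowski's integral inequality \<open>\<parallel>\<integral> \<kappa>(h) |c f - T\<^sup>h f| dh\<parallel>\<^sub>p \<le> \<integral> \<kappa>(h) \<parallel>c f - T\<^sup>h f\<parallel>\<^sub>p dh\<close> up to \<open>\<epsilon>\<close>.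
  Measurability on the product is avoided by replacing \<open>f\<close> with a continuous \<open>g\<close>, for which the
  integral over \<open>h\<close> is a uniform limit of finite sums.\<close>

lemma convolution_Minkowski:
  fixes f :: "'g \<Rightarrow> 'b::real_normed_vector" and \<kappa> :: "'g \<Rightarrow> real"
  assumes p: "1 \<le> p" and f: "f \<in> Lp_functions (ennreal p) \<mu>" and S: "compact S" and K: "compact K"
    and \<kappa>: "strongly_measurable \<mu> \<kappa>" "\<And>h. 0 \<le> \<kappa> h" "AE h in \<mu>. \<kappa> h \<le> J" "AE h in \<mu>. h \<notin> K \<longrightarrow> \<kappa> h = 0"
    and W: "(\<integral>\<^sup>+h. ennreal (\<kappa> h) \<partial>\<mu>) \<le> ennreal W" "0 \<le> W" and J: "0 \<le> J"
    and E: "\<And>h. h \<in> K \<Longrightarrow> Lp_norm_on p \<mu> S (\<lambda>x. c *\<^sub>R f x - f (- h + x)) \<le> ennreal E" "0 \<le> E"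
    and \<epsilon>: "0 < \<epsilon>"
  obtains m where "m \<in> borel_measurable (completion \<mu>)" "\<And>x. 0 \<le> m x"
    "\<And>x. x \<in> S \<Longrightarrow> (\<integral>\<^sup>+y. ennreal (\<kappa> (x + y) * norm (c *\<^sub>R f x - f (- y))) \<partial>\<mu>) \<le> ennreal (m x)"
    "Lp_norm_on p \<mu> S m \<le> ennreal (W * E + \<epsilon>)"
proof -
  have fsm: "strongly_measurable \<mu> f" using f p by (simp add: Lp_iff)
  have Sb: "S \<in> sets \<mu>" using compact_borel[OF S] by simp
  define M where "M = (\<lambda>(x, y). x + y) ` (uminus ` S \<times> K)"
  have M: "compact M" unfolding M_def by (intro compact_add_set compact_uminus_set S K)
  have Mb: "M \<in> sets borel" by (rule compact_borel[OF M])
  have Mn: "reflection_null M" using reflection_bound_compact[OF M] reflection_bound_imp_null[OF Mb]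
    by blast
  have inM: "y \<in> M" if "x \<in> S" "x + y \<in> K" for x y
    unfolding M_def using that by (intro image_eqI[of _ _ "(- x, x +
      y)"]) (auto simp: add.assoc[symmetric])
  obtain C where C: "0 \<le> C" "\<And>g :: 'g \<Rightarrow> 'b. g \<in> Lp_functions (ennreal p) \<mu> \<Longrightarrow>
    (\<integral>\<^sup>+y\<in>M. ennreal (norm (g (- y))) \<partial>\<mu>) \<le> ennreal C * Lp_norm_on p \<mu> UNIV g"
    using Lp_average_bound_compact[OF p M] by blast
  have \<epsilon>2: "0 < \<epsilon> / 2" using \<epsilon> by simp
  obtain d0 where d0: "d0 > 0" "\<And>f :: 'g \<Rightarrow> real. (\<And>x. x \<in> S \<Longrightarrow> norm (f x) \<le> d0) \<Longrightarrow>
    Lp_norm_on p \<mu> S f \<le> ennreal (\<epsilon> / 2)"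
    using Lp_norm_on_const_le[OF p Sb emeasure_compact_finite[OF S] \<epsilon>2] by blast
  \<comment> \<open>Collects the coefficients of the error \<open>\<delta>\<close> of replacing
    \<open>f\<close> with \<open>g\<close>: \<open>W * \<bar>c\<bar>\<close> at the point
    \<open>x\<close>, \<open>W * (\<bar>c\<bar> + 1)\<close> in the finite sum, and
    \<open>J * C\<close> in the integral over \<open>M\<close>.\<close>
  define D where "D = W * \<bar>c\<bar> + W * (\<bar>c\<bar> + 1) + J * C + 1"
  have D: "D > 0" using W C J by (auto simp: D_def intro!: add_nonneg_pos add_nonneg_nonneg
    mult_nonneg_nonneg)
  define \<delta> where "\<delta> = min (\<epsilon> / 2) (d0 / 2) / D"
  have \<delta>: "\<delta> > 0" using \<epsilon> d0 D by (simp add: \<delta>_def)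
  have D\<delta>: "D * \<delta> \<le> \<epsilon> / 2" "D * \<delta> \<le> d0 / 2" using D by (auto simp: \<delta>_def)
  have D1: "(W * \<bar>c\<bar> + W * (\<bar>c\<bar> + 1)) * \<delta> \<le> \<epsilon> / 2"
  proof -
    have "(W * \<bar>c\<bar> + W * (\<bar>c\<bar> + 1)) * \<delta> \<le> D * \<delta>" using \<delta> J C
      by (intro mult_right_mono) (auto simp: D_def)
    then show ?thesis using D\<delta> by simp
  qed
  have D2: "J * C * \<delta> \<le> d0 / 2"
  proof -
    have "J * C * \<delta> \<le> D * \<delta>" using \<delta> W by (intro mult_right_mono) (auto simp: D_def)
    then show ?thesis using D\<delta> by simp
  qed
  obtain g where g: "g \<in> Cc UNIV" "Lp_norm_on p \<mu> UNIV (\<lambda>x. f x - g x) < ennreal \<delta>"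
    using Cc_dense[OF p f open_UNIV _ \<delta>] by auto
  have gc: "continuous_on UNIV g" and gsm: "strongly_measurable \<mu> g" using g(1) by (auto simp: Cc_def)
  have fgsm: "strongly_measurable \<mu> (\<lambda>x. f x - g x)" by (intro strongly_measurable_diff fsm gsm)
  have fgL: "(\<lambda>x. f x - g x) \<in> Lp_functions (ennreal p) \<mu>"
    using fgsm g(2) p by (auto simp: Lp_iff intro: order_less_trans)
  \<comment> \<open>Half of \<open>d0\<close> is reserved for the oscillation of \<open>g\<close> on
    the pieces, whose total weight is at most \<open>W\<close>; the other half is for
    \<open>J * C * \<delta>\<close>.\<close>
  define d where "d = d0 / 2 / (W + 1)"
  have d: "d > 0" using d0 W by (simp add: d_def add_nonneg_pos)
  have Wd: "W * d \<le> d0 / 2"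
  proof -
    have "W * d = d0 / 2 * (W / (W + 1))" by (simp add: d_def)
    also have "\<dots> \<le> d0 / 2 * 1" using d0 W by (intro mult_left_mono) auto
    finally show ?thesis by simp
  qed
  have "continuous_on UNIV (\<lambda>q. g (- fst q + snd q))"
    by (intro continuous_on_compose2[OF gc] continuous_intros) auto
  then have "\<exists>V. open V \<and> h \<in> V \<and> (\<forall>h'\<in>V. \<forall>y\<in>S. norm (g (- h' + y) - g (- h + y)) < d)" for h
    by (rule uniform_neighbourhood[where F="\<lambda>h y. g (- h + y)", OF _ S d])
  then obtain V where V: "\<And>h. open (V h) \<and> h \<in> V h"
    "\<And>h h' y. h' \<in> V h \<Longrightarrow> y \<in> S \<Longrightarrow> norm (g (- h' + y) - g (- h + y)) < d" by metis
  obtain n :: nat and xs P where P: "\<And>i. i < n \<Longrightarrow> xs i \<in> K" "\<And>i. P i \<in> sets borel"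
    "\<And>i. i < n \<Longrightarrow> P i \<subseteq> V (xs i)" "disjoint_family P" "(\<Union>i<n. P i) = K"
    using finite_borel_partition[where N=V, OF K V(1) compact_borel[OF K] order_refl] by metis
  have \<kappa>m: "\<kappa> \<in> borel_measurable (completion \<mu>)" by (rule strongly_measurable_imp_completion[OF \<kappa>(1)])
  have Pm: "indicator (P i) \<in> borel_measurable (completion \<mu>)" for i
    using P(2) by (intro measurable_completion borel_measurable_indicator) simp
  have \<kappa>Pm: "(\<lambda>h. ennreal (\<kappa> h) * indicator (P i) h) \<in> borel_measurable (completion \<mu>)" for i
    using \<kappa>m Pm[of i] by measurable
  \<comment> \<open>The mass of the kernel on the piece \<open>P i\<close>. Translations by
    \<open>xs i\<close> with these weights form the finite sum that replaces the integral over
    \<open>h\<close>.\<close>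
  define w where "w i = enn2real (\<integral>\<^sup>+h\<in>P i. ennreal (\<kappa> h) \<partial>\<mu>)" for i
  have w0: "0 \<le> w i" for i by (simp add: w_def)
  have wsum': "(\<Sum>i<n. \<integral>\<^sup>+h\<in>P i. ennreal (\<kappa> h) \<partial>\<mu>) \<le> ennreal W"
  proof -
    have "(\<Sum>i<n. \<integral>\<^sup>+h\<in>P i. ennreal (\<kappa> h) \<partial>completion \<mu>) =
      (\<integral>\<^sup>+h. (\<Sum>i<n. ennreal (\<kappa> h) * indicator (P i) h) \<partial>completion \<mu>)"
      using \<kappa>Pm by (intro nn_integral_sum[symmetric]) auto
    also have "\<dots> \<le> (\<integral>\<^sup>+h. ennreal (\<kappa> h) \<partial>completion \<mu>)"
    proof (rule nn_integral_mono)
      fix h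
      have "(\<Sum>i<n. indicator (P i) h :: ennreal) = indicator (\<Union>i<n. P i) h"
        using P(4) by (intro indicator_UN_disjoint[symmetric]) (auto simp: disjoint_family_on_def)
      then show "(\<Sum>i<n. ennreal (\<kappa> h) * indicator (P i) h) \<le> ennreal (\<kappa> h)"
        by (simp add: sum_distrib_left[symmetric] indicator_def)
    qed
    finally show ?thesis using W by (simp add: nn_integral_completion)
  qed
  have wi: "(\<integral>\<^sup>+h\<in>P i. ennreal (\<kappa> h) \<partial>\<mu>) = ennreal (w i)" if "i < n" for i
  proof -
    have "(\<integral>\<^sup>+h\<in>P i. ennreal (\<kappa> h) \<partial>\<mu>) \<le> (\<Sum>i<n. \<integral>\<^sup>+h\<in>P i. ennreal (\<kappa> h) \<partial>\<mu>)"
      using that by (intro member_le_sum) auto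
    also note wsum'
    finally have "(\<integral>\<^sup>+h\<in>P i. ennreal (\<kappa> h) \<partial>\<mu>) < top" by (rule le_less_trans) simp
    then show ?thesis by (simp add: w_def)
  qed
  have wsum: "(\<Sum>i<n. w i) \<le> W"
  proof -
    have "(\<Sum>i<n. ennreal (w i)) \<le> ennreal W" using wsum' wi by simp
    then show ?thesis using w0 W by (simp add: sum_nonneg)
  qed
  define u where "u i x = norm (c *\<^sub>R g x - g (- xs i + x))" for i x
  have um: "u i \<in> borel_measurable (completion \<mu>)" for i
    unfolding u_def by (intro strongly_measurable_norm_completion strongly_measurable_diff
      strongly_measurable_scaleR
        strongly_measurable_const strongly_measurable_translate gsm)
  define s where "s x = (\<Sum>i<n. w i * u i x)" for x
  have sm: "s \<in> borel_measurable (completion \<mu>)" unfolding s_def using um by measurable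
  have s0: "0 \<le> s x" for x by (auto simp: s_def u_def intro!: sum_nonneg mult_nonneg_nonneg w0)
  have fgm: "(\<lambda>x. norm (f x - g x)) \<in> borel_measurable (completion \<mu>)"
    by (rule strongly_measurable_norm_completion[OF fgsm])
  \<comment> \<open>The majorant consists of the replacement error at \<open>x\<close>, the finite
    sum for \<open>g\<close>, and a constant for the oscillation of \<open>g\<close> and the
    replacement error under the integral.\<close>
  define m where "m x = W * \<bar>c\<bar> * norm (f x - g x) + (s x + (W * d + J * C * \<delta>))" for x
  have const0: "0 \<le> W * d + J * C * \<delta>" using W d J C \<delta> by auto
  show thesis
  proof (rule that)
    show "m \<in> borel_measurable (completion \<mu>)" unfolding m_def using fgm sm by measurable
    show "0 \<le> m x" for x using s0[of x] const0 W by (simp add: m_def)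
    show "Lp_norm_on p \<mu> S m \<le> ennreal (W * E + \<epsilon>)"
    proof -
      have uS: "Lp_norm_on p \<mu> S (u i) \<le> ennreal (E + (\<bar>c\<bar> + 1) * \<delta>)" if i: "i < n" for i
      proof -
        let ?T = "\<lambda>f x. f (- xs i + x)"
        have sm1: "strongly_measurable \<mu> (\<lambda>x. c *\<^sub>R f x - ?T f x)" "strongly_measurable \<mu> (\<lambda>x. c *\<^sub>R
          (f x - g x))"
          "strongly_measurable \<mu> (\<lambda>x. f (- xs i + x) - g (- xs i + x))"
          by (intro strongly_measurable_diff strongly_measurable_scaleR strongly_measurable_const
            strongly_measurable_translate fsm gsm)+
        have "Lp_norm_on p \<mu> S (u i) \<le> Lp_norm_on p \<mu> S (\<lambda>x. c *\<^sub>R f x - ?T f x) +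
           Lp_norm_on p \<mu> S (\<lambda>x. \<bar>c\<bar> * norm (f x - g x) + norm (?T f x - ?T g x))"
        proof (rule Lp_norm_on_triangle[OF p Sb, of "\<lambda>x. norm (c *\<^sub>R f x - ?T f x)",
          unfolded Lp_norm_on_norm])
          show "AE x in \<mu>. x \<in> S \<longrightarrow> norm (u i x) \<le> \<bar>norm (c *\<^sub>R f x - ?T f x)\<bar> +
            \<bar>\<bar>c\<bar> * norm (f x - g x) + norm (?T f x - ?T g x)\<bar>"
          proof (intro AE_I2 impI)
            fix x
            have "c *\<^sub>R g x - ?T g x = (c *\<^sub>R f x - ?T f x) - c *\<^sub>R (f x - g x) + (?T f x - ?T g x)"
              by (simp add: algebra_simps)
            then have "u i x \<le> norm ((c *\<^sub>R f x - ?T f x) - c *\<^sub>R (f x - g x)) + norm (?T f x - ?T g x)"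
              unfolding u_def by (metis norm_triangle_ineq)
            also have "norm ((c *\<^sub>R f x - ?T f x) - c *\<^sub>R (f x - g x)) \<le> norm (c *\<^sub>R f x - ?T f x) +
              \<bar>c\<bar> * norm (f x - g x)"
              by (metis norm_triangle_ineq4 norm_scaleR)
            finally show "norm (u i x) \<le> \<bar>norm (c *\<^sub>R f x - ?T f x)\<bar> + \<bar>\<bar>c\<bar> * norm (f x - g x) +
              norm (?T f x - ?T g x)\<bar>"
              by (simp add: u_def)
          qed
        qed (use strongly_measurable_norm_completion[OF sm1(1)] fgm
          strongly_measurable_norm_completion[OF sm1(3)] in measurable)
        also have "Lp_norm_on p \<mu> S (\<lambda>x. \<bar>c\<bar> * norm (f x - g x) + norm (?T f x - ?T g x)) \<le>
           Lp_norm_on p \<mu> S (\<lambda>x. \<bar>c\<bar> * norm (f x - g x)) + Lp_norm_on p \<mu> S (\<lambda>x. ?T f x - ?T g x)"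
          by (rule Lp_norm_on_add[OF p Sb, of _ "\<lambda>x. norm (?T f x - ?T g x)", unfolded Lp_norm_on_norm])
            (use fgm strongly_measurable_norm_completion[OF sm1(3)] in measurable)
        also have "Lp_norm_on p \<mu> S (\<lambda>x. \<bar>c\<bar> * norm (f x - g x)) \<le>
          ennreal \<bar>c\<bar> * Lp_norm_on p \<mu> S (\<lambda>x. f x - g x)"
          using Lp_norm_on_scaleR[OF p Sb, of "\<lambda>x. norm (f x - g x)" "\<bar>c\<bar>"] fgm by simp
        also have "Lp_norm_on p \<mu> S (\<lambda>x. f x - g x) \<le> ennreal \<delta>"
          using Lp_norm_on_mono_set[of p S UNIV \<mu> "\<lambda>x. f x - g x"] g(2) p by simp
        also have "Lp_norm_on p \<mu> S (\<lambda>x. ?T f x - ?T g x) \<le> Lp_norm_on p \<mu> UNIV (\<lambda>x. ?T f x - ?T g x)"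
          using p by (intro Lp_norm_on_mono_set) auto
        also have "Lp_norm_on p \<mu> UNIV (\<lambda>x. ?T f x - ?T g x) = Lp_norm_on p \<mu> UNIV (\<lambda>x. f x - g x)"
          by (rule Lp_norm_translate[OF fgsm])
        also have "\<dots> \<le> ennreal \<delta>" using g(2) by simp
        also have "Lp_norm_on p \<mu> S (\<lambda>x. c *\<^sub>R f x - ?T f x) \<le> ennreal E" by (rule E(1)[OF P(1)[OF i]])
        finally have "Lp_norm_on p \<mu> S (u i) \<le> ennreal E + (ennreal \<bar>c\<bar> * ennreal \<delta> + ennreal \<delta>)"
          by (simp add: add_left_mono add_right_mono mult_left_mono)
        also have "\<dots> = ennreal (E + (\<bar>c\<bar> + 1) * \<delta>)" using E(2) \<delta>
          by (simp add: algebra_simps flip: ennreal_mult ennreal_plus)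
        finally show ?thesis .
      qed
      have sS: "Lp_norm_on p \<mu> S s \<le> ennreal (W * (E + (\<bar>c\<bar> + 1) * \<delta>))"
      proof -
        have "Lp_norm_on p \<mu> S s \<le> (\<Sum>i<n. ennreal (w i) * Lp_norm_on p \<mu> S (u i))"
          unfolding s_def by (rule Lp_norm_on_sum[OF p Sb um w0])
        also have "\<dots> \<le> (\<Sum>i<n. ennreal (w i) * ennreal (E + (\<bar>c\<bar> + 1) * \<delta>))"
          using uS by (intro sum_mono mult_left_mono) auto
        also have "\<dots> = ennreal ((\<Sum>i<n. w i) * (E + (\<bar>c\<bar> + 1) * \<delta>))"
        proof -
          have B0: "0 \<le> E + (\<bar>c\<bar> + 1) * \<delta>" using E(2) \<delta> by simp
          show ?thesis unfolding ennreal_mult[OF w0 B0, symmetric] sum_distrib_right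
            by (rule sum_ennreal) (intro mult_nonneg_nonneg w0 B0)
        qed
        also have "\<dots> \<le> ennreal (W * (E + (\<bar>c\<bar> + 1) * \<delta>))"
          using wsum E(2) \<delta> by (intro ennreal_leI mult_right_mono) auto
        finally show ?thesis .
      qed
      have "Lp_norm_on p \<mu> S m \<le> Lp_norm_on p \<mu> S (\<lambda>x. W * \<bar>c\<bar> * norm (f x - g x)) +
        Lp_norm_on p \<mu> S (\<lambda>x. s x + (W * d + J * C * \<delta>))"
        unfolding m_def by (rule Lp_norm_on_add[OF p Sb]) (use fgm sm in measurable)
      also have "Lp_norm_on p \<mu> S (\<lambda>x. s x + (W * d + J * C * \<delta>)) \<le> Lp_norm_on p \<mu> S s +
        Lp_norm_on p \<mu> S (\<lambda>x. W * d + J * C * \<delta>)"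
        by (rule Lp_norm_on_add[OF p Sb]) (use sm in measurable)
      also have "Lp_norm_on p \<mu> S (\<lambda>x. W * d + J * C * \<delta>) \<le> ennreal (\<epsilon> / 2)"
        using Wd D2 const0 by (intro d0(2)) simp
      also note sS
      also have "Lp_norm_on p \<mu> S (\<lambda>x. W * \<bar>c\<bar> * norm (f x - g x)) \<le>
        ennreal (W * \<bar>c\<bar>) * Lp_norm_on p \<mu> S (\<lambda>x. f x - g x)"
        using Lp_norm_on_scaleR[OF p Sb, of "\<lambda>x. norm (f x - g x)" "W * \<bar>c\<bar>"] fgm W
          by (simp add: abs_mult)
      also have "Lp_norm_on p \<mu> S (\<lambda>x. f x - g x) \<le> ennreal \<delta>"
        using Lp_norm_on_mono_set[of p S UNIV \<mu> "\<lambda>x. f x - g x"] g(2) p by simp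
      finally have "Lp_norm_on p \<mu> S m \<le> ennreal (W * \<bar>c\<bar>) * ennreal \<delta> + (ennreal (W * (E + (\<bar>c\<bar> +
        1) * \<delta>)) + ennreal (\<epsilon> / 2))"
        by (simp add: add_left_mono add_right_mono mult_left_mono)
      also have "\<dots> = ennreal (W * \<bar>c\<bar> * \<delta> + (W * (E + (\<bar>c\<bar> + 1) * \<delta>) + \<epsilon> / 2))"
        using W E(2) \<delta> \<epsilon> by (simp flip: ennreal_mult ennreal_plus)
      also have "\<dots> \<le> ennreal (W * E + \<epsilon>)" using D1 by (intro ennreal_leI) (simp add: algebra_simps)
      finally show ?thesis .
    qed
    fix x assume x: "x \<in> S"
    have off: "AE y in \<mu>. y \<notin> M \<longrightarrow> \<kappa> (x + y) = 0"
      using AE_translate[OF \<kappa>(4), of x] by eventually_elim (use inM[OF x] in blast)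
    have k1: "(\<lambda>y. \<kappa> (x + y)) \<in> borel_measurable (completion \<mu>)"
      by (intro strongly_measurable_imp_completion strongly_measurable_translate \<kappa>)
    have "continuous_on UNIV (\<lambda>h. norm (c *\<^sub>R g x - g (- h + x)))"
      by (intro continuous_intros continuous_on_compose2[OF gc]) auto
    then have gm: "(\<lambda>h. norm (c *\<^sub>R g x - g (- h + x))) \<in> borel_measurable (completion \<mu>)"
      by (intro strongly_measurable_imp_completion strongly_measurable_continuous)
    then have um': "(\<lambda>h. ennreal (\<kappa> h * norm (c *\<^sub>R g x - g (- h +
      x)))) \<in> borel_measurable (completion \<mu>)"
      using \<kappa>m by measurable
    have "continuous_on UNIV (\<lambda>y. norm (c *\<^sub>R g x - g (- y)))"
      by (intro continuous_intros continuous_on_compose2[OF gc]) auto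
    then have gm2: "(\<lambda>y. norm (c *\<^sub>R g x - g (- y))) \<in> borel_measurable (completion \<mu>)"
      by (intro strongly_measurable_imp_completion strongly_measurable_continuous)
    have m3: "(\<lambda>y. ennreal (norm (indicator M y *\<^sub>R (f (- y) - g (- y))))) \<in> borel_measurable
      (completion \<mu>)"
      using measurable_compose[OF strongly_measurable_norm_completion[OF
        strongly_measurable_reflect[OF fgsm Mn]] measurable_ennreal] .
    have I1: "(\<integral>\<^sup>+y. ennreal (\<kappa> (x + y) * (\<bar>c\<bar> * norm (f x - g x))) \<partial>\<mu>) \<le>
      ennreal (W * \<bar>c\<bar> * norm (f x - g x))"
    proof -
      have "(\<integral>\<^sup>+y. ennreal (\<kappa> (x + y) * (\<bar>c\<bar> * norm (f x - g x))) \<partial>\<mu>) =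
         (\<integral>\<^sup>+y. ennreal (\<bar>c\<bar> * norm (f x - g x)) * ennreal (\<kappa> (x + y)) \<partial>\<mu>)"
        using \<kappa>(2) by (intro nn_integral_cong) (simp add: mult.commute flip: ennreal_mult)
      also have "\<dots> = ennreal (\<bar>c\<bar> * norm (f x - g x)) * (\<integral>\<^sup>+y. ennreal (\<kappa> (x + y)) \<partial>\<mu>)"
        using k1 by (intro nn_integral_cmult_completion) measurable
      also have "(\<integral>\<^sup>+y. ennreal (\<kappa> (x + y)) \<partial>\<mu>) = (\<integral>\<^sup>+y. ennreal (\<kappa> y) \<partial>\<mu>)"
        using \<kappa>m by (intro nn_integral_translate) measurable
      also have "ennreal (\<bar>c\<bar> * norm (f x - g x)) * \<dots> \<le> ennreal (\<bar>c\<bar> * norm (f x - g x)) * ennreal W"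
        by (intro mult_left_mono W) simp
      also have "\<dots> = ennreal (W * \<bar>c\<bar> * norm (f x - g x))" using W
        by (simp add: ac_simps flip: ennreal_mult)
      finally show ?thesis .
    qed
    \<comment> \<open>With \<open>h = x + y\<close> the argument \<open>- y\<close> becomes
      \<open>- h + x\<close>, and left invariance permits integration over \<open>h\<close>; on the
      piece \<open>P i\<close> the point \<open>h\<close> is then frozen at \<open>xs i\<close> at a
      cost of \<open>d\<close>.\<close>
    have I2: "(\<integral>\<^sup>+y. ennreal (\<kappa> (x + y) * norm (c *\<^sub>R g x - g (- y))) \<partial>\<mu>) \<le> ennreal (s x + W * d)"
    proof -
      have "(\<integral>\<^sup>+y. ennreal (\<kappa> (x + y) * norm (c *\<^sub>R g x - g (- y))) \<partial>\<mu>) =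
         (\<integral>\<^sup>+y. ennreal (\<kappa> (x + y) * norm (c *\<^sub>R g x - g (- (x + y) + x))) \<partial>\<mu>)"
        by (simp add: minus_add add.assoc)
      also have "\<dots> = (\<integral>\<^sup>+h. ennreal (\<kappa> h * norm (c *\<^sub>R g x - g (- h + x))) \<partial>\<mu>)"
        by (rule nn_integral_translate[OF um'])
      also have "\<dots> \<le> (\<integral>\<^sup>+h. (\<Sum>i<n. ennreal (u i x + d) * (ennreal (\<kappa> h) * indicator (P i) h)) \<partial>\<mu>)"
      proof (rule nn_integral_mono_AE, use \<kappa>(4) in eventually_elim)
        case (elim h)
        show ?case
        proof (cases "h \<in> K")
          case True
          then obtain i where i: "i < n" "h \<in> P i" using P(5) by auto
          have "norm (g (- h + x) - g (- xs i + x)) < d"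
            using V(2)[of h "xs i" x] P(3)[OF i(1)] i(2) x by auto
          moreover have "norm (c *\<^sub>R g x - g (- h + x)) \<le> norm (c *\<^sub>R g x - g (- xs i + x)) +
            norm (g (- h + x) - g (- xs i + x))"
            by (metis norm_diff_triangle_le norm_minus_commute order_refl)
          ultimately have "\<kappa> h * norm (c *\<^sub>R g x - g (- h + x)) \<le> (u i x + d) * \<kappa> h"
            using \<kappa>(2)[of h] by (subst mult.commute, intro mult_right_mono) (auto simp: u_def)
          then have "ennreal (\<kappa> h * norm (c *\<^sub>R g x - g (- h + x))) \<le> ennreal (u i x +
            d) * (ennreal (\<kappa> h) * indicator (P i) h)"
          proof -
            have "0 \<le> u i x + d" using d by (simp add: u_def)
            from ennreal_leI[OF \<open>\<kappa> h * _ \<le> _\<close>] show ?thesis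
              using i(2) by (simp only: ennreal_mult[OF \<open>0 \<le> u i x + d\<close> \<kappa>(2)]) simp
          qed
          also have "\<dots> \<le> (\<Sum>i<n. ennreal (u i x + d) * (ennreal (\<kappa> h) * indicator (P i) h))"
            using i(1) by (intro member_le_sum) auto
          finally show ?thesis .
        qed (use elim in simp)
      qed
      also have "\<dots> = (\<integral>\<^sup>+h. (\<Sum>i<n. ennreal (u i x + d) * (ennreal (\<kappa> h) * indicator (P i) h))
        \<partial>completion \<mu>)"
        by (simp add: nn_integral_completion)
      also have "\<dots> = (\<Sum>i<n. ennreal (u i x + d) * (\<integral>\<^sup>+h\<in>P i. ennreal (\<kappa> h) \<partial>completion \<mu>))"
        using \<kappa>Pm by (simp add: nn_integral_sum nn_integral_cmult)
      also have "\<dots> = (\<Sum>i<n. ennreal (u i x + d) * ennreal (w i))"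
        by (simp add: nn_integral_completion wi)
      also have "\<dots> = ennreal (\<Sum>i<n. (u i x + d) * w i)"
        using w0 d by (subst sum_ennreal[symmetric]) (auto simp: u_def ennreal_mult)
      also have "\<dots> \<le> ennreal (s x + W * d)"
      proof (rule ennreal_leI)
        have "(\<Sum>i<n. (u i x + d) * w i) = s x + (\<Sum>i<n. w i) * d"
          by (simp add: s_def algebra_simps sum.distrib sum_distrib_left)
        also have "\<dots> \<le> s x + W * d" using wsum d by (intro add_left_mono mult_right_mono) auto
        finally show "(\<Sum>i<n. (u i x + d) * w i) \<le> s x + W * d" .
      qed
      finally show ?thesis .
    qed
    \<comment> \<open>The difference of \<open>f\<close> and \<open>g\<close> is small in
      \<open>L\<^sup>p\<close> only; the bound \<open>J\<close> on the kernel and the bound for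
      averages over \<open>M\<close> make its contribution uniform in \<open>x\<close>.\<close>
    have I3: "(\<integral>\<^sup>+y. ennreal J * ennreal (norm (indicator M y *\<^sub>R (f (- y) - g (- y)))) \<partial>\<mu>) \<le>
      ennreal (J * C * \<delta>)"
    proof -
      have "(\<integral>\<^sup>+y. ennreal J * ennreal (norm (indicator M y *\<^sub>R (f (- y) - g (- y)))) \<partial>\<mu>) =
         ennreal J * (\<integral>\<^sup>+y. ennreal (norm (indicator M y *\<^sub>R (f (- y) - g (- y)))) \<partial>\<mu>)"
        by (rule nn_integral_cmult_completion[OF m3])
      also have "(\<integral>\<^sup>+y. ennreal (norm (indicator M y *\<^sub>R (f (- y) - g (- y)))) \<partial>\<mu>) =
        (\<integral>\<^sup>+y\<in>M. ennreal (norm (f (- y) - g (- y))) \<partial>\<mu>)"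
        by (intro nn_integral_cong) (auto split: split_indicator)
      also have "\<dots> \<le> ennreal C * Lp_norm_on p \<mu> UNIV (\<lambda>x. f x - g x)" by (rule C(2)[OF fgL])
      also have "Lp_norm_on p \<mu> UNIV (\<lambda>x. f x - g x) \<le> ennreal \<delta>" using g(2) by simp
      finally show ?thesis using J C(1) \<delta> by (simp add: mult_left_mono ennreal_mult mult.assoc)
    qed
    have "(\<integral>\<^sup>+y. ennreal (\<kappa> (x + y) * norm (c *\<^sub>R f x - f (- y))) \<partial>\<mu>) \<le>
      (\<integral>\<^sup>+y. ennreal (\<kappa> (x + y) * (\<bar>c\<bar> * norm (f x - g x))) + (ennreal (\<kappa> (x +
        y) * norm (c *\<^sub>R g x - g (- y))) +
        ennreal J * ennreal (norm (indicator M y *\<^sub>R (f (- y) - g (- y))))) \<partial>\<mu>)"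
    proof (rule nn_integral_mono_AE, use off AE_translate[OF \<kappa>(3), of x] in eventually_elim)
      case (elim y)
      show ?case
      proof (cases "y \<in> M")
        case True
        have "c *\<^sub>R f x - f (- y) = c *\<^sub>R (f x - g x) + ((c *\<^sub>R g x - g (- y)) - (f (- y) - g (- y)))"
          by (simp add: algebra_simps)
        also have "norm \<dots> \<le> norm (c *\<^sub>R (f x - g x)) + norm ((c *\<^sub>R g x - g (- y)) - (f (- y) - g (- y)))"
          by (rule norm_triangle_ineq)
        also have "\<dots> \<le> \<bar>c\<bar> * norm (f x - g x) + (norm (c *\<^sub>R g x - g (- y)) + norm (f (- y) - g (- y)))"
          by (intro add_mono norm_triangle_ineq4) simp
        finally have "\<kappa> (x + y) * norm (c *\<^sub>R f x - f (- y)) \<le>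
            \<kappa> (x + y) * (\<bar>c\<bar> * norm (f x - g x) + (norm (c *\<^sub>R g x - g (- y)) +
              norm (f (- y) - g (- y))))"
          using \<kappa>(2) by (intro mult_left_mono)
        also have "\<dots> \<le> \<kappa> (x + y) * (\<bar>c\<bar> * norm (f x - g x)) + (\<kappa> (x +
          y) * norm (c *\<^sub>R g x - g (- y)) + J * norm (f (- y) - g (- y)))"
          using elim(2) by (simp add: distrib_left mult_right_mono)
        finally show ?thesis using True \<kappa>(2) J by (simp add: ennreal_leI flip: ennreal_mult ennreal_plus)
      qed (use elim in simp)
    qed
    also have "\<dots> = (\<integral>\<^sup>+y. ennreal (\<kappa> (x + y) * (\<bar>c\<bar> * norm (f x - g x))) \<partial>\<mu>) +
       ((\<integral>\<^sup>+y. ennreal (\<kappa> (x + y) * norm (c *\<^sub>R g x - g (- y))) \<partial>\<mu>) +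
        (\<integral>\<^sup>+y. ennreal J * ennreal (norm (indicator M y *\<^sub>R (f (- y) - g (- y)))) \<partial>\<mu>))"
    proof -
      have m1: "(\<lambda>y. ennreal (\<kappa> (x + y) * (\<bar>c\<bar> * norm (f x - g x)))) \<in> borel_measurable (completion \<mu>)"
        using k1 by measurable
      have m2: "(\<lambda>y. ennreal (\<kappa> (x + y) * norm (c *\<^sub>R g x - g (- y)))) \<in> borel_measurable (completion \<mu>)"
        by (rule measurable_compose[OF borel_measurable_times[OF k1 gm2] measurable_ennreal])
      have m3': "(\<lambda>y. ennreal J * ennreal (norm (indicator M y *\<^sub>R (f (- y) - g (- y))))) \<in>
        borel_measurable (completion \<mu>)"
        by (intro borel_measurable_times_ennreal borel_measurable_const m3)
      show ?thesis
        by (simp only: nn_integral_add_completion[OF m2 m3'] nn_integral_add_completion[OF m1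
          borel_measurable_add[OF m2 m3']])
    qed
    also have "\<dots> \<le> ennreal (W * \<bar>c\<bar> * norm (f x - g x)) + (ennreal (s x + W * d) + ennreal (J * C * \<delta>))"
      by (intro add_mono I1 I2 I3)
    also have "\<dots> = ennreal (m x)"
      using W s0[of x] d J C \<delta> by (simp add: m_def add.assoc flip: ennreal_plus)
    finally show "(\<integral>\<^sup>+y. ennreal (\<kappa> (x + y) * norm (c *\<^sub>R f x - f (- y))) \<partial>\<mu>) \<le> ennreal (m x)" .
  qed
qed

section \<open>Finite rank approximation\<close>

lemma Cc_bounded:
  assumes "g \<in> Cc U"
  obtains J where "0 \<le> J" "\<And>x. norm (g x) \<le> J"
proof -
  obtain K where K: "compact K" "\<And>x. x \<notin> K \<Longrightarrow> g x = 0" and c: "continuous_on UNIV g"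
    using assms by (auto simp: Cc_def)
  have "compact (g ` K)" by (rule compact_continuous_image[OF continuous_on_subset[OF c] K(1)]) simp
  then obtain B where B: "\<And>x. x \<in> K \<Longrightarrow> norm (g x) \<le> B"
    using compact_imp_bounded bounded_iff by (metis imageI)
  show thesis
  proof (rule that)
    show "norm (g x) \<le> max 0 B" for x using B[of x] K(2)[of x] by (cases "x \<in> K") auto
  qed simp
qed

text \<open>For \<open>x \<in> S\<close> a kernel supported in \<open>K\<close> meets reflected
  values on \<open>M\<close> only, and being compact \<open>M\<close> has a reflection
  bound.\<close>

lemma kernel_support:
  fixes S K :: "'g set"
  assumes "compact S" "compact K"
  obtains M where "compact M" "reflection_null M" "\<And>x y. x \<in> S \<Longrightarrow> x + y \<in> K \<Longrightarrow> y \<in> M"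
proof (rule that)
  let ?M = "(\<lambda>(x, y). x + y) ` (uminus ` S \<times> K)"
  show M: "compact ?M" by (intro compact_add_set compact_uminus_set assms)
  show "reflection_null ?M"
    using reflection_bound_compact[OF M] reflection_bound_imp_null[OF compact_borel[OF M]] by blast
  show "y \<in> ?M" if "x \<in> S" "x + y \<in> K" for x y
    using that by (intro image_eqI[of _ _ "(- x, x + y)"]) (auto simp: add.assoc[symmetric])
qed

text \<open>The integral operator whose kernel is constantly \<open>c i l\<close> on
  \<open>Q i \<times> R l\<close>. It sees \<open>f\<close> only through finitely many averages,
  which are what condition (1) controls.\<close>

definition averaging_operator ::
    "nat \<Rightarrow> nat \<Rightarrow> (nat \<Rightarrow> 'g set) \<Rightarrow> (nat \<Rightarrow> 'g set) \<Rightarrow> (nat \<Rightarrow> nat \<Rightarrow> complex) \<Rightarrow> ('g \<Rightarrow> 'b::complex_banach)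
      \<Rightarrow> 'g \<Rightarrow> 'b"
  where "averaging_operator n m Q R c f x =
    (\<Sum>i<n. indicator (Q i) x *\<^sub>R (\<Sum>l<m. c i l *\<^sub>C bochner_integral_on \<mu> (R l) (\<lambda>y. f (- y))))"

lemma strongly_measurable_averaging_operator:
  "(\<And>i. Q i \<in> sets borel) \<Longrightarrow> strongly_measurable \<mu> (averaging_operator n m Q R c f)"
  unfolding averaging_operator_def
  by (intro strongly_measurable_sum strongly_measurable_scaleR strongly_measurable_const
    strongly_measurable_indicator) simp

lemma sum_indicator_disjoint:
  fixes v :: "nat \<Rightarrow> 'b::real_vector"
  assumes "disjoint_family Q" "i < n" "x \<in> Q i"
  shows "(\<Sum>k<n. indicator (Q k) x *\<^sub>R v k) = v i"
proof -
  have "(\<Sum>k<n. indicator (Q k) x *\<^sub>R v k) = (\<Sum>k<n. if k = i then v i else 0)"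
    using assms by (intro sum.cong refl) (auto simp: disjoint_family_on_def indicator_def)
  then show ?thesis using assms(2) by simp
qed

text \<open>The kernel \<open>j (x + y)\<close> is compared with \<open>j (xs i + ys l)\<close>: a
  partition of \<open>S\<close> makes it nearly constant in \<open>x\<close>, uniformly for
  \<open>y \<in> M\<close>, and a partition of \<open>M\<close> makes the finitely many functions
  \<open>j (xs i + y)\<close> nearly constant in \<open>y\<close>. The partitions depend on the norm
  bound \<open>r\<close>, but not on \<open>f\<close>.\<close>

lemma averaging_operator_approx:
  fixes j :: "'g \<Rightarrow> complex"
  assumes p: "1 \<le> p" and j: "j \<in> Cc UNIV" and S: "compact S" and r: "0 \<le> r" and \<eta>: "0 < \<eta>"
  obtains n m Q R c M where "compact M" "\<And>l. R l \<in> sets borel" "\<And>l. l < m \<Longrightarrow>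
    R l \<subseteq> M" "\<And>i. Q i \<in> sets borel"
    "disjoint_family Q"
    "\<And>f :: 'g \<Rightarrow> 'b::complex_banach. \<And>x. f \<in> Lp_functions (ennreal p) \<mu> \<Longrightarrow> Lp_norm_on p \<mu> UNIV f \<le>
      ennreal r \<Longrightarrow> x \<in> S \<Longrightarrow>
       norm (convolve \<mu> j f x - averaging_operator n m Q R c f x) \<le> \<eta>"
proof -
  obtain K where K: "compact K" "\<And>x. x \<notin> K \<Longrightarrow> j x = 0" and jc: "continuous_on UNIV j"
    and jsm: "strongly_measurable \<mu> j"
    using j by (auto simp: Cc_def)
  obtain J where J: "0 \<le> J" "\<And>x. cmod (j x) \<le> J" using Cc_bounded[OF j] by blast
  obtain M where M: "compact M" "reflection_null M" and inM: "\<And>x y. x \<in> S \<Longrightarrow> x + y \<in> K \<Longrightarrow> y \<in> M"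
    using kernel_support[OF S K(1)] by blast
  obtain C where C: "0 \<le> C" "\<And>g :: 'g \<Rightarrow> 'b. g \<in> Lp_functions (ennreal p) \<mu> \<Longrightarrow>
    (\<integral>\<^sup>+y\<in>M. ennreal (norm (g (- y))) \<partial>\<mu>) \<le> ennreal C * Lp_norm_on p \<mu> UNIV g"
    using Lp_average_bound_compact[OF p M(1)] by blast
  \<comment> \<open>The kernel error is at most \<open>2 * \<delta>\<close> and the integral over
    \<open>M\<close> at most \<open>C * r\<close>; the added 1 covers a vanishing product.\<close>
  define \<delta> where "\<delta> = \<eta> / (C * r + 1) / 2"
  have Cr: "0 < C * r + 1" using C(1) r by (simp add: add_nonneg_pos)
  have \<delta>: "\<delta> > 0" using \<eta> Cr by (simp add: \<delta>_def)
  have \<delta>\<eta>: "2 * \<delta> * (C * r) \<le> \<eta>"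
  proof -
    have "2 * (a / 2) = a" for a :: real by simp
    then have "2 * \<delta> = \<eta> / (C * r + 1)" unfolding \<delta>_def .
    then have "2 * \<delta> * (C * r) = \<eta> * ((C * r) / (C * r + 1))" by simp
    also have "\<dots> \<le> \<eta> * 1" using \<eta> Cr by (intro mult_left_mono) (auto simp: divide_le_eq_1_pos)
    finally show ?thesis by simp
  qed
  have "continuous_on UNIV (\<lambda>q. j (fst q + snd q))"
    by (intro continuous_on_compose2[OF jc] continuous_intros) auto
  then have "\<exists>V. open V \<and> h \<in> V \<and> (\<forall>h'\<in>V. \<forall>y\<in>M. norm (j (h' + y) - j (h + y)) < \<delta>)" for h
    by (rule uniform_neighbourhood[where F="\<lambda>h y. j (h + y)", OF _ M(1) \<delta>])
  then obtain V where V: "\<And>h. open (V h) \<and> h \<in> V h"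
    "\<And>h h' y. h' \<in> V h \<Longrightarrow> y \<in> M \<Longrightarrow> norm (j (h' + y) - j (h + y)) < \<delta>" by metis
  obtain n :: nat and xs Q where Q: "\<And>i. i < n \<Longrightarrow> xs i \<in> S" "\<And>i. Q i \<in> sets borel"
    "\<And>i. i < n \<Longrightarrow> Q i \<subseteq> V (xs i)" "disjoint_family Q" "(\<Union>i<n. Q i) = S"
    using finite_borel_partition[where N=V, OF S V(1) compact_borel[OF S] order_refl] by metis
  \<comment> \<open>One neighbourhood serves all \<open>n\<close> points \<open>xs i\<close> at
    once, so that a single partition of \<open>M\<close> fits every piece of
    \<open>S\<close>.\<close>
  define O' where "O' y = {y'. \<forall>i<n. cmod (j (xs i + y') - j (xs i + y)) < \<delta>}" for y
  have O': "open (O' y) \<and> y \<in> O' y" for y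
  proof -
    have "O' y = (\<Inter>i\<in>{..<n}. {y'. cmod (j (xs i + y') - j (xs i + y)) < \<delta>})" by (auto simp: O'_def)
    moreover have "open {y'. cmod (j (xs i + y') - j (xs i + y)) < \<delta>}" for i
    proof -
      have "continuous_on UNIV (\<lambda>y'. cmod (j (xs i + y') - j (xs i + y)))"
        by (intro continuous_intros continuous_on_compose2[OF jc]) auto
      from open_vimage[OF open_lessThan[of \<delta>] this] show ?thesis by (simp add: vimage_def)
    qed
    ultimately have "open (O' y)" by (simp add: open_INT)
    then show ?thesis using \<delta> by (simp add: O'_def)
  qed
  obtain m :: nat and ys R where R: "\<And>l. l < m \<Longrightarrow> ys l \<in> M" "\<And>l. R l \<in> sets borel"
    "\<And>l. l < m \<Longrightarrow> R l \<subseteq> O' (ys l)" "disjoint_family R" "(\<Union>l<m. R l) = M"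
    using finite_borel_partition[where N=O', OF M(1) O' compact_borel[OF M(1)] order_refl] by metis
  define c where "c i l = j (xs i + ys l)" for i l
  have RM: "R l \<subseteq> M" if "l < m" for l using R(5) that by auto
  show thesis
  proof (rule that[of M R m Q n c])
    fix f :: "'g \<Rightarrow> 'b" and x
    assume f: "f \<in> Lp_functions (ennreal p) \<mu>" and fr: "Lp_norm_on p \<mu> UNIV f \<le> ennreal r" and x: "x \<in> S"
    have fsm: "strongly_measurable \<mu> f" using f p by (simp add: Lp_iff)
    obtain i where i: "i < n" "x \<in> Q i" using Q(5) x by auto
    have jM: "j (x + y) = 0" if "y \<notin> M" for y using inM[OF x] K(2) that by blast
    have A: "averaging_operator n m Q R c f x = (\<Sum>l<m. c i l *\<^sub>C bochner_integral_on \<mu> (R l) (\<lambda>y. f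
      (- y)))"
      unfolding averaging_operator_def by (rule sum_indicator_disjoint[OF Q(4) i])
    have "(\<integral>\<^sup>+y. ennreal (cmod (j (x + y)) * norm (f (- y))) \<partial>\<mu>) \<le>
      ennreal J * (\<integral>\<^sup>+y\<in>M. ennreal (norm (f (- y))) \<partial>\<mu>)"
      using J jM by (intro nn_integral_bounded_kernel_le[where \<kappa>="\<lambda>x. cmod (j x)"] fsm M) auto
    also have "\<dots> < \<infinity>" using Lp_average_finite[OF p M(1) f] by (simp add: ennreal_mult_less_top)
    finally have 1: "has_bochner_int \<mu> (\<lambda>y. j (x + y) *\<^sub>C f (- y)) (convolve \<mu> j f x)"
      using jM by (intro convolve_has_bochner_int[OF jsm fsm M(2)]) auto
    have 2: "has_bochner_int \<mu> (\<lambda>y. indicator (R l) y *\<^sub>R f (- y)) (bochner_integral_on \<mu> (R l) (\<lambda>y.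
      f (- y)))" if "l < m" for l
    proof (intro has_bochner_int_bochner_integral_on bochner_integrable_on_reflect fsm)
      have "(\<integral>\<^sup>+y\<in>R l. ennreal (norm (f (- y))) \<partial>\<mu>) \<le> (\<integral>\<^sup>+y\<in>M. ennreal (norm (f (- y))) \<partial>\<mu>)"
        using RM[OF that] by (intro nn_integral_mono) (auto split: split_indicator)
      also have "\<dots> < \<infinity>" by (rule Lp_average_finite[OF p M(1) f])
      finally show "(\<integral>\<^sup>+y\<in>R l. ennreal (norm (f (- y))) \<partial>\<mu>) < \<infinity>" .
      have "emeasure \<mu> (R l) \<le> emeasure \<mu> M" using RM[OF that] compact_borel[OF M(1)]
        by (intro emeasure_mono) auto
      also have "\<dots> < \<infinity>" by (rule emeasure_compact_finite[OF M(1)])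
      finally show "reflection_null (R l)" using R(2) by (intro reflection_null_finite)
    qed
    have "has_bochner_int \<mu> (\<lambda>y. j (x + y) *\<^sub>C f (- y) - (\<Sum>l<m. c i l *\<^sub>C (indicator (R l) y *\<^sub>R f (- y))))
      (convolve \<mu> j f x - averaging_operator n m Q R c f x)"
      unfolding A
    proof (intro has_bochner_int_diff 1 has_bochner_int_sum)
      fix l assume "l \<in> {..<m}"
      then show "has_bochner_int \<mu> (\<lambda>y. c i l *\<^sub>C (indicator (R l) y *\<^sub>R f (- y))) (c i l *\<^sub>C
        bochner_integral_on \<mu> (R l) (\<lambda>y. f (- y)))"
        by (intro has_bochner_int_bounded_linear[OF scaleC.bounded_linear_right] 2) simp
    qed
    from has_bochner_int_norm_le[OF this]
    have "ennreal (norm (convolve \<mu> j f x - averaging_operator n m Q R c f x)) \<le>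
      (\<integral>\<^sup>+y. ennreal (norm (j (x + y) *\<^sub>C f (- y) - (\<Sum>l<m. c i l *\<^sub>C (indicator (R l) y *\<^sub>R f (- y)))))
        \<partial>\<mu>)" .
    also have "\<dots> \<le> (\<integral>\<^sup>+y. ennreal (2 * \<delta>) * ennreal (norm (indicator M y *\<^sub>R f (- y))) \<partial>\<mu>)"
    proof (rule nn_integral_mono)
      fix y
      have s: "(\<Sum>l<m. c i l *\<^sub>C (indicator (R l) y *\<^sub>R f (- y))) =
        (\<Sum>l<m. indicator (R l) y *\<^sub>R (c i l *\<^sub>C f (- y)))"
        by (simp add: scaleC.scaleR_right)
      show "ennreal (norm (j (x + y) *\<^sub>C f (- y) - (\<Sum>l<m. c i l *\<^sub>C (indicator (R l) y *\<^sub>R f (- y)))))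
        \<le> ennreal (2 * \<delta>) * ennreal (norm (indicator M y *\<^sub>R f (- y)))"
      proof (cases "y \<in> M")
        case True
        then obtain l where l: "l < m" "y \<in> R l" using R(5) by auto
        have "cmod (j (x + y) - j (xs i + y)) < \<delta>" using V(2)[of x "xs i" y] Q(3)[OF i(1)] i(2) True
          by auto
        moreover have "cmod (j (xs i + y) - j (xs i + ys l)) < \<delta>" using R(3)[OF l(1)] l(2) i(1)
          by (auto simp: O'_def)
        ultimately have "cmod (j (x + y) - c i l) \<le> 2 * \<delta>"
          using norm_diff_triangle_less[of "j (x + y)" "j (xs i + y)" \<delta> "c i l" \<delta>] by (simp add: c_def)
        then have "norm ((j (x + y) - c i l) *\<^sub>C f (- y)) \<le> 2 * \<delta> * norm (f (- y))"
          unfolding norm_scaleC by (intro mult_right_mono) auto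
        then show ?thesis
          unfolding s sum_indicator_disjoint[OF R(4) l] using True \<delta>
          by (simp add: scaleC.diff_left ennreal_leI flip: ennreal_mult)
      next
        case False
        have "(\<Sum>l<m. indicator (R l) y *\<^sub>R (c i l *\<^sub>C f (- y))) = 0"
          using False RM by (intro sum.neutral) (auto simp: indicator_def)
        then show ?thesis using False jM[of y] by (simp add: s scaleC.zero_left)
      qed
    qed
    also have "\<dots> = ennreal (2 * \<delta>) * (\<integral>\<^sup>+y. ennreal (norm (indicator M y *\<^sub>R f (- y))) \<partial>\<mu>)"
      by (intro nn_integral_cmult_completion measurable_compose[OF
        strongly_measurable_norm_completion measurable_ennreal]
          strongly_measurable_reflect fsm M)
    also have "(\<integral>\<^sup>+y. ennreal (norm (indicator M y *\<^sub>R f (- y))) \<partial>\<mu>) =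
      (\<integral>\<^sup>+y\<in>M. ennreal (norm (f (- y))) \<partial>\<mu>)"
      by (intro nn_integral_cong) (auto split: split_indicator)
    also have "\<dots> \<le> ennreal C * Lp_norm_on p \<mu> UNIV f" by (rule C(2)[OF f])
    also have "\<dots> \<le> ennreal C * ennreal r" by (intro mult_left_mono fr) simp
    also have "ennreal (2 * \<delta>) * (ennreal C * ennreal r) = ennreal (2 * \<delta> * (C * r))"
      using \<delta> C(1) r by (simp flip: ennreal_mult)
    also have "\<dots> \<le> ennreal \<eta>" using \<delta>\<eta> by (rule ennreal_leI)
    finally show "norm (convolve \<mu> j f x - averaging_operator n m Q R c f x) \<le> \<eta>"
      using \<eta> by (simp add: mult_left_mono ennreal_le_iff)
  qed (use M Q R RM in auto)
qed

lemma Lp_norm_split: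
  assumes p: "1 \<le> p" and S: "S \<in> sets borel" and f: "strongly_measurable \<mu> f"
  shows "Lp_norm_on p \<mu> UNIV f \<le> Lp_norm_on p \<mu> S f + Lp_norm_on p \<mu> (- S) f"
proof -
  have "Lp_norm_on p \<mu> UNIV f \<le> Lp_norm_on p \<mu> UNIV (\<lambda>x. indicator S x *\<^sub>R f x) +
    Lp_norm_on p \<mu> UNIV (\<lambda>x. indicator (- S) x *\<^sub>R f x)"
    by (intro Lp_norm_on_triangle_sm[OF p] strongly_measurable_scaleR strongly_measurable_indicator f)
      (use S in \<open>auto split: split_indicator\<close>)
  then show ?thesis by (simp add: Lp_norm_on_indicator)
qed

section \<open>Sufficiency\<close>

definition averages_compact :: "real \<Rightarrow> ('g \<Rightarrow> 'b::banach) set set \<Rightarrow> bool" where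
  "averages_compact p \<Gamma> \<longleftrightarrow> (\<forall>A\<in>sets \<mu>. emeasure \<mu> A < \<infinity> \<and>
     (\<forall>g \<in> (Lp_functions (ennreal p) \<mu> :: ('g \<Rightarrow> 'b) set). bochner_integrable_on \<mu> A (\<lambda>y. g (- y))) \<longrightarrow>
     compact (closure {bochner_integral_on \<mu> A (\<lambda>y. f (- y)) | F f. F \<in> \<Gamma> \<and> f \<in> F}))"

text \<open>A Borel set inside a compact set satisfies the integrability requirement of condition
  (1), because averages over compact sets are finite on all of \<open>L\<^sup>p\<close>.\<close>

lemma averages_finite_net:
  fixes \<Gamma> :: "('g \<Rightarrow> 'b::banach) set set"
  assumes p: "1 \<le> p" and av: "averages_compact p \<Gamma>" and A: "A \<in> sets borel" "A \<subseteq> M" "compact M"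
    and \<delta>: "0 < \<delta>"
  shows "\<exists>D. finite D \<and> (\<forall>F\<in>\<Gamma>. \<forall>f\<in>F. \<exists>d\<in>D. dist d (bochner_integral_on \<mu> A (\<lambda>y. f (- y))) < \<delta>)"
proof -
  have "emeasure \<mu> A \<le> emeasure \<mu> M" using A compact_borel[OF A(3)] by (intro emeasure_mono) auto
  also have "\<dots> < \<infinity>" by (rule emeasure_compact_finite[OF A(3)])
  finally have Af: "emeasure \<mu> A < \<infinity>" .
  have "bochner_integrable_on \<mu> A (\<lambda>y. g (- y))" if g: "g \<in> Lp_functions (ennreal p) \<mu>"
    for g :: "'g \<Rightarrow> 'b"
  proof (rule bochner_integrable_on_reflect[OF _ reflection_null_finite[OF A(1) Af]])
    have "(\<integral>\<^sup>+y\<in>A. ennreal (norm (g (- y))) \<partial>\<mu>) \<le> (\<integral>\<^sup>+y\<in>M. ennreal (norm (g (- y))) \<partial>\<mu>)"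
      using A by (intro nn_integral_mono) (auto split: split_indicator)
    also have "\<dots> < \<infinity>" by (rule Lp_average_finite[OF p A(3) g])
    finally show "(\<integral>\<^sup>+y\<in>A. ennreal (norm (g (- y))) \<partial>\<mu>) < \<infinity>" .
  qed (use g p in \<open>simp add: Lp_iff\<close>)
  then have "compact (closure {bochner_integral_on \<mu> A (\<lambda>y. f (- y)) | F f. F \<in> \<Gamma> \<and> f \<in> F})"
    using av A(1) Af unfolding averages_compact_def by simp
  then obtain D where D: "finite D" "closure {bochner_integral_on \<mu> A (\<lambda>y. f (- y)) | F f. F \<in> \<Gamma> \<and>
    f \<in> F} \<subseteq> (\<Union>d\<in>D. ball d \<delta>)"
    using \<delta> unfolding compact_eq_totally_bounded by blast
  show ?thesis
  proof (intro exI conjI ballI)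
    fix F f assume "F \<in> \<Gamma>" "f \<in> F"
    then have "bochner_integral_on \<mu> A (\<lambda>y. f (- y)) \<in> {bochner_integral_on \<mu> A (\<lambda>y. f (- y)) | F f.
      F \<in> \<Gamma> \<and> f \<in> F}"
      by auto
    then have "bochner_integral_on \<mu> A (\<lambda>y. f (- y)) \<in> (\<Union>d\<in>D. ball d \<delta>)"
      by (rule D(2)[THEN subsetD, OF closure_subset[THEN subsetD]])
    then show "\<exists>d\<in>D. dist d (bochner_integral_on \<mu> A (\<lambda>y. f (- y))) < \<delta>" by auto
  qed (rule D(1))
qed

lemma averaging_operator_dist:
  assumes Q: "disjoint_family Q" and d: "\<And>l. l < m \<Longrightarrow>
      dist (bochner_integral_on \<mu> (R l) (\<lambda>y. f (- y))) (bochner_integral_on \<mu> (R l) (\<lambda>y. g (- y))) \<le> \<delta>"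
    and \<delta>: "0 \<le> \<delta>"
  shows "norm (averaging_operator n m Q R c f x - averaging_operator n m Q R c g x) \<le>
    (\<Sum>i<n. \<Sum>l<m. cmod (c i l)) * \<delta>"
proof -
  have "averaging_operator n m Q R c f x - averaging_operator n m Q R c g x =
    (\<Sum>i<n. indicator (Q i) x *\<^sub>R (\<Sum>l<m. c i l *\<^sub>C (bochner_integral_on \<mu> (R l) (\<lambda>y. f (- y)) -
      bochner_integral_on \<mu> (R l) (\<lambda>y. g (- y)))))"
    unfolding averaging_operator_def by (simp add: sum_subtractf scaleC.diff_right scaleR_diff_right)
  also have "norm \<dots> \<le> (\<Sum>i<n. \<Sum>l<m. cmod (c i l) * \<delta>)"
  proof (rule sum_norm_le)
    fix i
    have "norm (\<Sum>l<m. c i l *\<^sub>C (bochner_integral_on \<mu> (R l) (\<lambda>y. f (- y)) - bochner_integral_on \<mu> (R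
      l) (\<lambda>y. g (- y))))
      \<le> (\<Sum>l<m. cmod (c i l) * \<delta>)"
    proof (rule sum_norm_le)
      fix l assume "l \<in> {..<m}"
      then show "norm (c i l *\<^sub>C (bochner_integral_on \<mu> (R l) (\<lambda>y. f (- y)) - bochner_integral_on \<mu>
        (R l) (\<lambda>y. g (- y)))) \<le> cmod (c i l) * \<delta>"
        using d[of l] by (auto simp: norm_scaleC dist_norm intro!: mult_left_mono)
    qed
    moreover have "0 \<le> (\<Sum>l<m. cmod (c i l) * \<delta>)" using \<delta> by (intro sum_nonneg) auto
    ultimately show "norm (indicator (Q i) x *\<^sub>R (\<Sum>l<m. c i l *\<^sub>C (bochner_integral_on \<mu> (R l) (\<lambda>y. f
      (- y)) - bochner_integral_on \<mu> (R l) (\<lambda>y. g (- y)))))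
      \<le> (\<Sum>l<m. cmod (c i l) * \<delta>)" by (auto split: split_indicator)
  qed
  also have "\<dots> = (\<Sum>i<n. \<Sum>l<m. cmod (c i l)) * \<delta>" by (simp add: sum_distrib_right)
  finally show ?thesis .
qed

text \<open>The function \<open>u\<close> need not be measurable; \<open>j * f\<close> is never shown to be, unless \<open>j\<close> is continuous.\<close>

definition Lp_dominated :: "real \<Rightarrow> 'g set \<Rightarrow> real \<Rightarrow> ('g \<Rightarrow> 'b::real_normed_vector) \<Rightarrow> bool" where
  "Lp_dominated p S e g \<longleftrightarrow> (\<exists>u :: 'g \<Rightarrow> 'b. \<exists>m. m \<in> borel_measurable (completion \<mu>) \<and> (\<forall>x. 0 \<le> m x) \<and>
     (\<forall>x\<in>S. norm (g x) \<le> norm (u x) + m x) \<and> Lp_norm_on p \<mu> S u \<le> ennreal e \<and> Lp_norm_on p \<mu> S m \<le>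
       ennreal e)"

text \<open>The common consequence of (2a) and (2b). The kernel is continuous with compact support,
  as the finite rank approximation requires; the domination leaves room for the error given by (2a)
  and for the one caused by a change of kernel.\<close>

definition approximable_by_convolution :: "real \<Rightarrow> ('g \<Rightarrow> 'b::complex_banach) set set \<Rightarrow> bool" where
  "approximable_by_convolution p \<Gamma> \<longleftrightarrow> (\<forall>e>0. \<exists>S. \<exists>j\<in>Cc UNIV. compact S \<and>
    (\<forall>F\<in>\<Gamma>. \<forall>f\<in>F. Lp_norm_on p \<mu> (- S) f < ennreal e \<and>
     Lp_dominated p S e (\<lambda>x. f x - convolve \<mu> j f x)))"

text \<open>Each class is coded by net points close to its averages over the sets
  \<open>R l\<close>. Equal codes force close averages, hence close images under the finite rank
  operator, and so close functions on \<open>S\<close>; off \<open>S\<close> both functions are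
  small.\<close>

lemma sufficient_totally_bounded:
  fixes \<Gamma> :: "('g \<Rightarrow> 'b::complex_banach) set set"
  assumes p: "1 \<le> p" and \<Gamma>: "\<Gamma> \<subseteq> Lp_space p \<mu>"
    and r: "\<And>F f. F \<in> \<Gamma> \<Longrightarrow> f \<in> F \<Longrightarrow> Lp_norm_on p \<mu> UNIV f \<le> ennreal r" "0 \<le> r"
    and av: "averages_compact p \<Gamma>" and ap: "approximable_by_convolution p \<Gamma>"
  shows "Metric_space.mtotally_bounded (Lp_space p \<mu>) (Lp_dist p \<mu>) \<Gamma>"
proof (rule Lp_totally_boundedI[OF p \<Gamma>, where 'c="'b list"])
  fix e0 :: real assume e0: "0 < e0"
  \<comment> \<open>Nine errors add up, 3 + 1 + 3 on \<open>S\<close> and 1 + 1 off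
    \<open>S\<close>, which leaves a strict margin.\<close>
  define e where "e = e0 / 10"
  have e: "0 < e" using e0 by (simp add: e_def)
  obtain S j where S: "compact S" and j: "j \<in> Cc UNIV"
    and ap': "\<forall>F\<in>\<Gamma>. \<forall>f\<in>F. Lp_norm_on p \<mu> (- S) f < ennreal e \<and>
     Lp_dominated p S e (\<lambda>x. f x - convolve \<mu> j f x)"
    using ap[unfolded approximable_by_convolution_def, rule_format, OF e] by blast
  have Sb: "S \<in> sets \<mu>" using compact_borel[OF S] by simp
  obtain d where d: "d > 0" "\<And>f :: 'g \<Rightarrow> real. (\<And>x. x \<in> S \<Longrightarrow> norm (f x) \<le> d) \<Longrightarrow> Lp_norm_on p \<mu> S f \<le>
    ennreal e"
    using Lp_norm_on_const_le[OF p Sb emeasure_compact_finite[OF S] e] by blast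
  obtain n m Q R c M where M: "compact M" and R: "\<And>l. R l \<in> sets borel" "\<And>l. l < m \<Longrightarrow> R l \<subseteq> M"
    and Q: "\<And>i. Q i \<in> sets borel" "disjoint_family Q"
    and A: "\<And>f :: 'g \<Rightarrow> 'b. \<And>x. f \<in> Lp_functions (ennreal p) \<mu> \<Longrightarrow> Lp_norm_on p \<mu> UNIV f \<le> ennreal r \<Longrightarrow>
      x \<in> S \<Longrightarrow>
       norm (convolve \<mu> j f x - averaging_operator n m Q R c f x) \<le> d"
    by (rule averaging_operator_approx[OF p j S r(2) d(1)]) (rule that)
  let ?A = "averaging_operator n m Q R c :: ('g \<Rightarrow> 'b) \<Rightarrow> 'g \<Rightarrow> 'b"
  let ?I = "\<lambda>l f. bochner_integral_on \<mu> (R l) (\<lambda>y. f (- y)) :: 'b"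
  have Asm: "strongly_measurable \<mu> (?A f)" for f
    by (rule strongly_measurable_averaging_operator[OF Q(1)])
  have fL: "f \<in> Lp_functions (ennreal p) \<mu>" if "F \<in> \<Gamma>" "f \<in> F" for F f
    using that \<Gamma> Lp_space_imp_function by blast
  have fsm: "strongly_measurable \<mu> f" if "F \<in> \<Gamma>" "f \<in> F" for F f using fL[OF that] p
    by (simp add: Lp_iff)
  \<comment> \<open>The three errors are the two parts of \<open>Lp_dominated\<close> and the
    uniform distance \<open>d\<close> between the convolution and the finite rank operator.\<close>
  have fA: "Lp_norm_on p \<mu> S (\<lambda>x. f x - ?A f x) \<le> ennreal (3 * e)" if Ff: "F \<in> \<Gamma>" "f \<in> F" for F f
  proof -
    obtain u :: "'g \<Rightarrow> 'b" and v where "v \<in> borel_measurable (completion \<mu>) \<and> (\<forall>x. 0 \<le> v x) \<and>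
        (\<forall>x\<in>S. norm (f x - convolve \<mu> j f x) \<le> norm (u x) + v x) \<and>
        Lp_norm_on p \<mu> S u \<le> ennreal e \<and> Lp_norm_on p \<mu> S v \<le> ennreal e"
      using conjunct2[OF bspec[OF bspec[OF ap' Ff(1)] Ff(2)]] unfolding Lp_dominated_def by (elim exE)
    then have uv: "v \<in> borel_measurable (completion \<mu>)" "\<And>x. 0 \<le> v x"
      "\<And>x. x \<in> S \<Longrightarrow> norm (f x - convolve \<mu> j f x) \<le> norm (u x) + v x"
      "Lp_norm_on p \<mu> S u \<le> ennreal e" "Lp_norm_on p \<mu> S v \<le> ennreal e"
      by simp_all
    have vd: "(\<lambda>x. v x + d) \<in> borel_measurable (completion \<mu>)" using uv(1) by measurable
    have a: "Lp_norm_on p \<mu> S (\<lambda>x. f x - ?A f x) \<le> Lp_norm_on p \<mu> S u + Lp_norm_on p \<mu> S (\<lambda>x. v x + d)"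
    proof (rule Lp_norm_on_triangle_left[OF p Sb _ vd])
      show "(\<lambda>x. norm (f x - ?A f x)) \<in> borel_measurable (completion \<mu>)"
        by (intro strongly_measurable_norm_completion strongly_measurable_diff fsm[OF Ff] Asm)
      fix x assume x: "x \<in> S"
      have "norm (f x - ?A f x) \<le> norm (f x - convolve \<mu> j f x) + norm (convolve \<mu> j f x - ?A f x)"
        by (rule norm_diff_triangle_le[OF order_refl order_refl])
      then show "norm (f x - ?A f x) \<le> norm (u x) + \<bar>v x + d\<bar>"
        using uv(3)[OF x] A[OF fL[OF Ff] r(1)[OF Ff] x] uv(2)[of x] d(1) by linarith
    qed
    have b: "Lp_norm_on p \<mu> S (\<lambda>x. v x + d) \<le> Lp_norm_on p \<mu> S v + Lp_norm_on p \<mu> S (\<lambda>x. d)"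
      by (rule Lp_norm_on_add[OF p Sb uv(1)]) simp
    have "Lp_norm_on p \<mu> S (\<lambda>x. d) \<le> ennreal e" using d by simp
    from order_trans[OF a add_mono[OF uv(4) order_trans[OF b add_mono[OF uv(5) this]]]]
    show ?thesis using e by (simp flip: ennreal_plus)
  qed
  define B where "B = (\<Sum>i<n. \<Sum>l<m. cmod (c i l))"
  have B: "0 \<le> B" unfolding B_def by (intro sum_nonneg) auto
  \<comment> \<open>Averages with equal codes differ by at most \<open>2 * \<delta>\<close>, and the
    operator multiplies this by at most \<open>B\<close>, the sum of the moduli of its
    coefficients.\<close>
  define \<delta> where "\<delta> = d / (2 * (B + 1))"
  have \<delta>: "0 < \<delta>" using d B by (simp add: \<delta>_def add_nonneg_pos)
  have B\<delta>: "B * (2 * \<delta>) \<le> d"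
  proof -
    have "B * (2 * \<delta>) = d * (B / (B + 1))" using B by (simp add: \<delta>_def field_simps)
    also have "\<dots> \<le> d * 1" using d B by (intro mult_left_mono) auto
    finally show ?thesis by simp
  qed
  have "\<exists>D. finite D \<and> (\<forall>F\<in>\<Gamma>. \<forall>f\<in>F. \<exists>b\<in>D. dist b (?I l f) < \<delta>)" if "l < m" for l
    by (rule averages_finite_net[OF p av R(1) R(2)[OF that] M \<delta>])
  then obtain D where D: "\<And>l. l < m \<Longrightarrow> finite (D l)"
    "\<And>l F f. l < m \<Longrightarrow> F \<in> \<Gamma> \<Longrightarrow> f \<in> F \<Longrightarrow> \<exists>b\<in>D l. dist b (?I l f) < \<delta>" by metis
  define rep where "rep F = (SOME f. f \<in> F)" for F :: "('g \<Rightarrow> 'b) set"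
  have rep: "rep F \<in> F" if "F \<in> \<Gamma>" for F using Lp_space_SOME \<Gamma> that unfolding rep_def by blast
  define near where "near F l = (SOME b. b \<in> D l \<and> dist b (?I l (rep F)) < \<delta>)" for F l
  have near: "near F l \<in> D l \<and> dist (near F l) (?I l (rep F)) < \<delta>" if "F \<in> \<Gamma>" "l < m" for F l
    unfolding near_def by (rule someI_ex) (use D(2)[OF that(2,1) rep[OF that(1)]] in blast)
  define code where "code F = map (near F) [0..<m]" for F
  show "\<exists>code :: ('g \<Rightarrow> 'b) set \<Rightarrow> 'b list. finite (code ` \<Gamma>) \<and> (\<forall>F\<in>\<Gamma>. \<forall>G\<in>\<Gamma>. code F = code G \<longrightarrow>
       (\<exists>f\<in>F. \<exists>g\<in>G. Lp_norm_on p \<mu> (space \<mu>) (\<lambda>x. f x - g x) < ennreal e0))"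
  proof (intro exI[of _ code] conjI ballI impI)
    have "code ` \<Gamma> \<subseteq> {xs. set xs \<subseteq> (\<Union>l<m. D l) \<and> length xs = m}"
      using near by (auto simp: code_def) (metis lessThan_iff)
    moreover have "finite {xs. set xs \<subseteq> (\<Union>l<m. D l) \<and> length xs = m}"
      using D(1) by (intro finite_lists_length_eq) auto
    ultimately show "finite (code ` \<Gamma>)" by (rule finite_subset)
    fix F G assume FG: "F \<in> \<Gamma>" "G \<in> \<Gamma>" "code F = code G"
    let ?f = "rep F" and ?g = "rep G"
    have nn: "near F l = near G l" if "l < m" for l
      using FG(3) that unfolding code_def by (auto simp: list_eq_iff_nth_eq)
    have dl: "dist (?I l ?f) (?I l ?g) \<le> 2 * \<delta>" if "l < m" for l
      using near[OF FG(1) that] near[OF FG(2) that] nn[OF that]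
        dist_triangle[of "?I l ?f" "?I l ?g" "near F l"] by (simp add: dist_commute)
    have fs: "strongly_measurable \<mu> ?f" "strongly_measurable \<mu> ?g"
      by (rule fsm[OF FG(1) rep[OF FG(1)]], rule fsm[OF FG(2) rep[OF FG(2)]])
    have AA: "Lp_norm_on p \<mu> S (\<lambda>x. ?A ?f x - ?A ?g x) \<le> ennreal e"
    proof -
      have "norm (?A ?f x - ?A ?g x) \<le> d" for x
        using averaging_operator_dist[where c=c and n=n and x=x, OF Q(2) dl] \<delta> B\<delta> unfolding B_def
          by force
      then have "Lp_norm_on p \<mu> S (\<lambda>x. norm (?A ?f x - ?A ?g x)) \<le> ennreal e" by (intro d(2)) simp
      then show ?thesis by simp
    qed
    have "Lp_norm_on p \<mu> S (\<lambda>x. ?f x - ?g x) \<le> Lp_norm_on p \<mu> S (\<lambda>x. ?f x - ?A ?f x) +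
      Lp_norm_on p \<mu> S (\<lambda>x. ?A ?f x - ?g x)"
      by (intro Lp_norm_on_triangle_sm[OF p Sb] strongly_measurable_diff fs Asm
        norm_diff_triangle_le[OF order_refl order_refl])
    also have "Lp_norm_on p \<mu> S (\<lambda>x. ?A ?f x - ?g x) \<le> Lp_norm_on p \<mu> S (\<lambda>x. ?A ?f x - ?A ?g x) +
      Lp_norm_on p \<mu> S (\<lambda>x. ?A ?g x - ?g x)"
      by (intro Lp_norm_on_triangle_sm[OF p Sb] strongly_measurable_diff fs Asm
        norm_diff_triangle_le[OF order_refl order_refl])
    also have "Lp_norm_on p \<mu> S (\<lambda>x. ?A ?g x - ?g x) \<le> ennreal (3 * e)"
      using fA[OF FG(2) rep[OF FG(2)]] by (simp add: Lp_norm_on_minus_commute[of p \<mu> S "?A ?g"])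
    also note AA
    also note fA[OF FG(1) rep[OF FG(1)]]
    finally have 1: "Lp_norm_on p \<mu> S (\<lambda>x. ?f x - ?g x) \<le> ennreal (3 * e) + (ennreal e +
      ennreal (3 * e))"
      by (simp add: add_left_mono add_right_mono)
    have Sb': "- S \<in> sets \<mu>" using compact_borel[OF S] by auto
    have "Lp_norm_on p \<mu> (- S) (\<lambda>x. ?f x - ?g x) \<le> Lp_norm_on p \<mu> (- S) ?f + Lp_norm_on p \<mu> (- S) ?g"
      by (intro Lp_norm_on_triangle_sm[OF p Sb'] fs norm_triangle_ineq4)
    also have "\<dots> \<le> ennreal e + ennreal e"
      using ap' FG rep[OF FG(1)] rep[OF FG(2)] by (intro add_mono less_imp_le) auto
    finally have 2: "Lp_norm_on p \<mu> (- S) (\<lambda>x. ?f x - ?g x) \<le> ennreal e + ennreal e" .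
    have "Lp_norm_on p \<mu> UNIV (\<lambda>x. ?f x - ?g x) \<le> Lp_norm_on p \<mu> S (\<lambda>x. ?f x - ?g x) +
      Lp_norm_on p \<mu> (- S) (\<lambda>x. ?f x - ?g x)"
      by (intro Lp_norm_split[OF p compact_borel[OF S]] strongly_measurable_diff fs)
    also have "\<dots> \<le> ennreal (3 * e) + (ennreal e + ennreal (3 * e)) + (ennreal e + ennreal e)"
      by (intro add_mono 1 2)
    also have "\<dots> = ennreal (9 * e)" using e by (simp flip: ennreal_plus)
    also have "\<dots> < ennreal e0" using e0 by (simp add: e_def ennreal_less_iff)
    finally show "\<exists>f\<in>F. \<exists>g\<in>G. Lp_norm_on p \<mu> (space \<mu>) (\<lambda>x. f x - g x) < ennreal e0"
      using rep[OF FG(1)] rep[OF FG(2)] by auto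
  qed
qed

section \<open>Reduction of (2a) and (2b) to continuous kernels of compact support\<close>

lemma nn_integral_cmod_diff_less:
  fixes j k :: "'g \<Rightarrow> complex"
  assumes q: "1 \<le> q" and d: "0 \<le> d" and l: "Lp_norm_on q \<mu> UNIV (\<lambda>x. j x - k x) < ennreal d"
  shows "(\<integral>\<^sup>+x. ennreal (cmod (j x - k x) powr q) \<partial>\<mu>) \<le> ennreal (d powr q)"
  using Lp_norm_on_le_iff[of q d \<mu> UNIV "\<lambda>x. j x - k x"] q d less_imp_le[OF l] by simp

text \<open>Young's inequality in place of Hoelder's keeps roots of integrals out of the estimate.
  The parameter \<open>t\<close> shifts weight between kernel and function; the factors
  \<open>1 / p\<close> and \<open>1 / q\<close> are estimated by 1.\<close>

lemma Young_kernel: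
  fixes k :: "'g \<Rightarrow> complex" and f :: "'g \<Rightarrow> 'b::real_normed_vector"
  assumes pq: "1 < p" "1 < q" "1 / p + 1 / q = 1"
    and k: "strongly_measurable \<mu> k" and f: "strongly_measurable \<mu> f"
    and A: "A \<in> sets borel" "reflection_bound A C" and off: "AE y in \<mu>. y \<notin> A \<longrightarrow> k (x + y) = 0"
      and t: "0 < t"
  shows "(\<integral>\<^sup>+y. ennreal (cmod (k (x + y)) * norm (f (- y))) \<partial>\<mu>) \<le>
    ennreal (t powr q) * (\<integral>\<^sup>+h. ennreal (cmod (k h) powr q) \<partial>\<mu>) +
    ennreal (1 / t powr p) * (ennreal C * (\<integral>\<^sup>+h. ennreal (norm (f h) powr p) \<partial>\<mu>))"
proof -
  have km: "(\<lambda>h. ennreal (cmod (k h) powr q)) \<in> borel_measurable (completion \<mu>)"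
    using strongly_measurable_norm_completion[OF k] by measurable
  have km': "(\<lambda>y. ennreal (cmod (k (x + y)) powr q)) \<in> borel_measurable (completion \<mu>)"
    using strongly_measurable_norm_completion[OF strongly_measurable_translate[OF k]] by measurable
  have fm: "(\<lambda>h. ennreal (norm (f h) powr p)) \<in> borel_measurable (completion \<mu>)"
    using strongly_measurable_norm_completion[OF f] by measurable
  have An: "reflection_null A" by (rule reflection_bound_imp_null[OF A])
  have "(\<lambda>y. norm (indicator A y *\<^sub>R f (- y))) \<in> borel_measurable (completion \<mu>)"
    by (intro strongly_measurable_norm_completion strongly_measurable_reflect f An)
  from measurable_compose[OF this, of "\<lambda>r. ennreal (r powr p)" borel]
  have fm': "(\<lambda>y. ennreal (norm (indicator A y *\<^sub>R f (- y)) powr p)) \<in> borel_measurable (completion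
    \<mu>)" by simp
  have "(\<integral>\<^sup>+y. ennreal (cmod (k (x + y)) * norm (f (- y))) \<partial>\<mu>) \<le>
    (\<integral>\<^sup>+y. ennreal (t powr q) * ennreal (cmod (k (x + y)) powr q) +
      ennreal (1 / t powr p) * ennreal (norm (indicator A y *\<^sub>R f (- y)) powr p) \<partial>\<mu>)"
  proof (rule nn_integral_mono_AE, use off in eventually_elim)
    case (elim y)
    show ?case
    proof (cases "y \<in> A")
      case True
      let ?a = "cmod (k (x + y))" and ?b = "norm (f (- y))"
      have "?a * ?b = (t * ?a) * (?b / t)" using t by simp
      also have "\<dots> \<le> (t * ?a) powr q / q + (?b / t) powr p / p"
        using pq t by (intro Youngs_inequality) auto
      also have "\<dots> \<le> (t * ?a) powr q / 1 + (?b / t) powr p / 1"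
        using pq by (intro add_mono divide_left_mono) auto
      also have "\<dots> = t powr q * ?a powr q + 1 / t powr p * ?b powr p" using t
        by (simp add: powr_mult powr_divide)
      finally have "ennreal (?a * ?b) \<le> ennreal (t powr q * ?a powr q + 1 / t powr p * ?b powr p)"
        by (rule ennreal_leI)
      then show ?thesis using True by (simp add: ennreal_mult[symmetric] ennreal_plus[symmetric]
        del: ennreal_plus)
    qed (use elim in simp)
  qed
  also have "\<dots> = ennreal (t powr q) * (\<integral>\<^sup>+y. ennreal (cmod (k (x + y)) powr q) \<partial>\<mu>) +
      ennreal (1 / t powr p) * (\<integral>\<^sup>+y. ennreal (norm (indicator A y *\<^sub>R f (- y)) powr p) \<partial>\<mu>)"
    by (simp only: nn_integral_cmult_completion[OF km'] nn_integral_cmult_completion[OF fm']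
        nn_integral_add_completion[OF borel_measurable_times_ennreal[OF borel_measurable_const km']
          borel_measurable_times_ennreal[OF borel_measurable_const fm']])
  also have "(\<integral>\<^sup>+y. ennreal (cmod (k (x + y)) powr q) \<partial>\<mu>) = (\<integral>\<^sup>+h. ennreal (cmod (k h) powr q) \<partial>\<mu>)"
    by (rule nn_integral_translate[OF km])
  also have "(\<integral>\<^sup>+y. ennreal (norm (indicator A y *\<^sub>R f (- y)) powr p) \<partial>\<mu>) =
    (\<integral>\<^sup>+y\<in>A. ennreal (norm (f (- y)) powr p) \<partial>\<mu>)"
    using pq by (intro nn_integral_cong) (auto split: split_indicator)
  also have "\<dots> \<le> ennreal C * (\<integral>\<^sup>+h. ennreal (norm (f h) powr p) \<partial>\<mu>)"
    by (rule nn_integral_reflect_le[OF A fm])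
  finally show ?thesis by (simp add: add_left_mono mult_left_mono)
qed

text \<open>For finite \<open>q\<close> the kernel is a limit in \<open>L\<^sup>q\<close> of
  continuous kernels supported in \<open>U\<close>, and the error is uniform in
  \<open>x \<in> S\<close> and in \<open>f\<close> from a ball. The parameter \<open>t\<close> makes
  the contribution of \<open>f\<close> in \<open>Young_kernel\<close> at most \<open>d / 2\<close>,
  and the distance of the kernels is chosen to match.\<close>

lemma convolve_approx_conjugate:
  fixes j :: "'g \<Rightarrow> complex"
  assumes pq: "1 < p" "1 < q" "1 / p + 1 / q = 1" and j: "j \<in> Lp_functions (ennreal q) \<mu>"
    and U: "open U" "AE h in \<mu>. h \<notin> U \<longrightarrow> j h = 0"
    and A: "A \<in> sets borel" "reflection_bound A C" "\<forall>x\<in>S. \<forall>y. x + y \<in> U \<longrightarrow> y \<in> A"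
    and r: "0 \<le> r" and d: "0 < d"
  obtains k where "k \<in> Cc UNIV"
    "\<And>f :: 'g \<Rightarrow> 'b::complex_banach. \<And>x. f \<in> Lp_functions (ennreal p) \<mu> \<Longrightarrow> Lp_norm_on p \<mu> UNIV f \<le>
      ennreal r \<Longrightarrow> x \<in> S \<Longrightarrow>
       norm (convolve \<mu> j f x - convolve \<mu> k f x) \<le> d"
proof -
  have p: "1 \<le> p" and q: "1 \<le> q" using pq by auto
  have C: "0 < C" using A(2) by (simp add: reflection_bound_def)
  have An: "reflection_null A" by (rule reflection_bound_imp_null[OF A(1,2)])
  \<comment> \<open>Makes \<open>t powr p\<close> larger than \<open>2 * C * r powr p / d\<close>;
    the added 1 keeps \<open>t\<close> positive if \<open>r\<close> is 0.\<close>
  define t where "t = (2 * C * r powr p / d + 1) powr (1 / p)"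
  have t1: "0 < 2 * C * r powr p / d + 1" using C d by (intro add_nonneg_pos) auto
  have t: "t > 0" using t1 by (simp add: t_def)
  have tp: "t powr p = 2 * C * r powr p / d + 1" using pq t1 by (simp add: t_def powr_powr)
  have t2: "1 / t powr p * (C * r powr p) \<le> d / 2"
  proof -
    have "C * r powr p \<le> d / 2 * t powr p" unfolding tp using d by (simp add: field_simps)
    then show ?thesis using t by (simp add: field_simps)
  qed
  \<comment> \<open>The solution of \<open>t powr q * \<delta> powr q = d / 2\<close>.\<close>
  define \<delta> where "\<delta> = (d / 2) powr (1 / q) / t"
  have \<delta>: "\<delta> > 0" using d t by (simp add: \<delta>_def)
  have "(D powr (1 / q) / t) powr q = D / t powr q" if "0 < D" for D
    using that t pq by (simp add: powr_divide powr_powr)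
  from this[of "d / 2"] have t\<delta>: "t powr q * \<delta> powr q = d / 2" using d t by (simp add: \<delta>_def)
  obtain k where k: "k \<in> Cc U" "Lp_norm_on q \<mu> UNIV (\<lambda>x. j x - k x) < ennreal \<delta>"
    by (rule Cc_dense[OF q j U \<delta>])
  have k': "k \<in> Cc UNIV" using k(1) Cc_mono[of U UNIV] by auto
  have ksm: "strongly_measurable \<mu> k" and kU: "\<And>h. h \<notin> U \<Longrightarrow> k h = 0" using k(1) by (auto simp: Cc_def)
  have jsm: "strongly_measurable \<mu> j" using j q by (simp add: Lp_iff)
  have jfin: "(\<integral>\<^sup>+h. ennreal (cmod (j h) powr q) \<partial>\<mu>) < \<infinity>"
    using j q Lp_norm_on_finite_iff[of q \<mu> UNIV j] by (simp add: Lp_iff)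
  have jk: "(\<integral>\<^sup>+h. ennreal (cmod (j h - k h) powr q) \<partial>\<mu>) \<le> ennreal (\<delta> powr q)"
    using nn_integral_cmod_diff_less[OF q _ k(2)] \<delta> by simp
  have kfin: "(\<integral>\<^sup>+h. ennreal (cmod (k h) powr q) \<partial>\<mu>) < \<infinity>"
  proof -
    have "Lp_norm_on q \<mu> UNIV k \<le> Lp_norm_on q \<mu> UNIV j + Lp_norm_on q \<mu> UNIV (\<lambda>x. j x - k x)"
    proof (intro Lp_norm_on_triangle_sm[OF q] jsm strongly_measurable_diff ksm)
      show "cmod (k x) \<le> cmod (j x) + cmod (j x - k x)" for x
        by (metis norm_minus_commute norm_triangle_sub)
    qed simp
    also have "\<dots> < \<infinity>" using j k(2) q by (auto simp: Lp_iff intro: order_less_trans)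
    finally show ?thesis using Lp_norm_on_finite_iff[of q \<mu> UNIV k] by simp
  qed
  show thesis
  proof (rule that[OF k'])
    fix f :: "'g \<Rightarrow> 'b" and x
    assume f: "f \<in> Lp_functions (ennreal p) \<mu>" and fr: "Lp_norm_on p \<mu> UNIV f \<le> ennreal r" and x: "x \<in> S"
    have fsm: "strongly_measurable \<mu> f" using f p by (simp add: Lp_iff)
    have fI: "(\<integral>\<^sup>+h. ennreal (norm (f h) powr p) \<partial>\<mu>) \<le> ennreal (r powr p)"
      using fr Lp_norm_on_le_iff[of p r \<mu> UNIV f] p r by simp
    have ffin: "(\<integral>\<^sup>+h. ennreal (norm (f h) powr p) \<partial>\<mu>) < \<infinity>" using fI by (auto intro: le_less_trans)
    have offj: "AE y in \<mu>. y \<notin> A \<longrightarrow> j (x + y) = 0"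
      using AE_translate[OF U(2), of x] by eventually_elim (use A(3) x in blast)
    have offk: "AE y in \<mu>. y \<notin> A \<longrightarrow> k (x + y) = 0" using kU A(3) x by (intro AE_I2) blast
    have offjk: "AE y in \<mu>. y \<notin> A \<longrightarrow> j (x + y) - k (x + y) = 0" using offj offk by eventually_elim simp
    have hj: "has_bochner_int \<mu> (\<lambda>y. j (x + y) *\<^sub>C f (- y)) (convolve \<mu> j f x)"
    proof (rule convolve_has_bochner_int[OF jsm fsm An offj])
      show "(\<integral>\<^sup>+y. ennreal (cmod (j (x + y)) * norm (f (- y))) \<partial>\<mu>) < \<infinity>"
        by (rule le_less_trans[OF Young_kernel[OF pq jsm fsm A(1,2) offj zero_less_one]])
          (use jfin ffin in \<open>simp add: ennreal_mult_less_top\<close>)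
    qed
    have hk: "has_bochner_int \<mu> (\<lambda>y. k (x + y) *\<^sub>C f (- y)) (convolve \<mu> k f x)"
    proof (rule convolve_has_bochner_int[OF ksm fsm An offk])
      show "(\<integral>\<^sup>+y. ennreal (cmod (k (x + y)) * norm (f (- y))) \<partial>\<mu>) < \<infinity>"
        by (rule le_less_trans[OF Young_kernel[OF pq ksm fsm A(1,2) offk zero_less_one]])
          (use kfin ffin in \<open>simp add: ennreal_mult_less_top\<close>)
    qed
    have "ennreal (norm (convolve \<mu> j f x - convolve \<mu> k f x)) \<le>
      (\<integral>\<^sup>+y. ennreal (cmod (j (x + y) - k (x + y)) * norm (f (- y))) \<partial>\<mu>)" by (rule
        convolve_diff_le[OF hj hk])
    also have "\<dots> \<le> ennreal (t powr q) * (\<integral>\<^sup>+h. ennreal (cmod (j h - k h) powr q) \<partial>\<mu>) +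
       ennreal (1 / t powr p) * (ennreal C * (\<integral>\<^sup>+h. ennreal (norm (f h) powr p) \<partial>\<mu>))"
      by (rule Young_kernel[OF pq strongly_measurable_diff[OF jsm ksm] fsm A(1,2) offjk t])
    also have "\<dots> \<le> ennreal (t powr q) * ennreal (\<delta> powr q) +
      ennreal (1 / t powr p) * (ennreal C * ennreal (r powr p))"
      by (intro add_mono mult_left_mono jk fI) auto
    also have "\<dots> = ennreal (t powr q * \<delta> powr q) + ennreal (1 / t powr p * (C * r powr p))"
    proof -
      have "ennreal (t powr q) * ennreal (\<delta> powr q) = ennreal (t powr q * \<delta> powr q)"
        "ennreal C * ennreal (r powr p) = ennreal (C * r powr p)"
        "ennreal (1 / t powr p) * ennreal (C * r powr p) = ennreal (1 / t powr p * (C * r powr p))"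
        by (rule ennreal_mult[symmetric]; use C in simp)+
      then show ?thesis by (simp only:)
    qed
    also have "\<dots> \<le> ennreal (d / 2) + ennreal (d / 2)"
      unfolding t\<delta> by (intro add_left_mono ennreal_leI t2)
    also have "\<dots> = ennreal d" using d by (simp flip: ennreal_plus)
    finally show "norm (convolve \<mu> j f x - convolve \<mu> k f x) \<le> d" using d by (simp add: ennreal_le_iff)
  qed
qed

text \<open>The kernel is only essentially bounded, but with compact support it is integrable and
  can be approximated in \<open>L\<^sup>1\<close>. Minkowski's inequality for the modulus of
  \<open>j - k\<close> bounds the error in \<open>L\<^sup>1(S)\<close> and not pointwise by a
  constant; hence the majorant \<open>m\<close>.\<close>

lemma convolve_approx_one:
  fixes j :: "'g \<Rightarrow> complex"
  assumes j: "strongly_measurable \<mu> j" "AE h in \<mu>. cmod (j h) \<le> J"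
    and K: "compact K" "AE h in \<mu>. h \<notin> K \<longrightarrow> j h = 0"
    and S: "compact S" and r: "0 \<le> r" and e: "0 < e"
  obtains k where "k \<in> Cc UNIV"
    "\<And>f :: 'g \<Rightarrow> 'b::complex_banach. f \<in> Lp_functions (ennreal 1) \<mu> \<Longrightarrow> Lp_norm_on 1 \<mu> UNIV f \<le> ennreal r \<Longrightarrow>
       \<exists>m. m \<in> borel_measurable (completion \<mu>) \<and> (\<forall>x. 0 \<le> m x) \<and>
         (\<forall>x\<in>S. norm (convolve \<mu> j f x - convolve \<mu> k f x) \<le> m x) \<and> Lp_norm_on 1 \<mu> S m \<le> ennreal e"
proof -
  obtain U L where U: "open U" "compact L" "K \<subseteq> U" "U \<subseteq> L" by (rule compact_open_neighbourhood[OF K(1)])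
  have offU: "AE h in \<mu>. h \<notin> U \<longrightarrow> j h = 0" using K(2) by eventually_elim (use U(3) in auto)
  have Kb: "K \<in> sets \<mu>" using compact_borel[OF K(1)] by simp
  have jL: "j \<in> Lp_functions (ennreal 1) \<mu>"
    unfolding Lp_iff[OF order_refl] Lp_norm_on_finite_iff
  proof
    have "(\<integral>\<^sup>+x\<in>UNIV. ennreal (cmod (j x) powr 1) \<partial>\<mu>) \<le> (\<integral>\<^sup>+x. ennreal (max 0 J) * indicator K x \<partial>\<mu>)"
      by (rule nn_integral_mono_AE, use j(2) K(2) in eventually_elim) (auto split: split_indicator
        intro!: ennreal_leI)
    also have "\<dots> < \<infinity>" using Kb emeasure_compact_finite[OF K(1)]
      by (simp add: nn_integral_cmult_indicator ennreal_mult_less_top)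
    finally show "(\<integral>\<^sup>+x\<in>UNIV. ennreal (cmod (j x) powr 1) \<partial>\<mu>) < \<infinity>" .
  qed (rule j(1))
  \<comment> \<open>The kernel mass \<open>\<delta>\<close> times the norm bound \<open>r\<close>
    stays below \<open>e / 2\<close>; the rest of \<open>e\<close> is the slack in
    \<open>convolution_Minkowski\<close>.\<close>
  define \<delta> where "\<delta> = e / 2 / (r + 1)"
  have \<delta>: "\<delta> > 0" using e r by (simp add: \<delta>_def)
  have \<delta>r: "\<delta> * r + e / 2 \<le> e"
  proof -
    have "\<delta> * r = e / 2 * (r / (r + 1))" by (simp add: \<delta>_def)
    also have "\<dots> \<le> e / 2 * 1" using e r by (intro mult_left_mono) auto
    finally show ?thesis by simp
  qed
  obtain k where k: "k \<in> Cc U" "Lp_norm_on 1 \<mu> UNIV (\<lambda>x. j x - k x) < ennreal \<delta>"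
    by (rule Cc_dense[OF order_refl jL U(1) offU \<delta>])
  have k': "k \<in> Cc UNIV" using k(1) Cc_mono[of U UNIV] by auto
  have ksm: "strongly_measurable \<mu> k" and kU: "\<And>h. h \<notin> U \<Longrightarrow> k h = 0" using k(1) by (auto simp: Cc_def)
  obtain J' where J': "0 \<le> J'" "\<And>x. cmod (k x) \<le> J'" using Cc_bounded[OF k(1)] by blast
  obtain M where M: "compact M" "reflection_null M" and inM: "\<And>x y. x \<in> S \<Longrightarrow> x + y \<in> L \<Longrightarrow> y \<in> M"
    using kernel_support[OF S U(2)] by blast
  define \<kappa> where "\<kappa> h = cmod (j h - k h)" for h
  have \<kappa>sm: "strongly_measurable \<mu> \<kappa>" unfolding \<kappa>_def
    by (intro strongly_measurable_norm strongly_measurable_diff j ksm)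
  have \<kappa>J: "AE h in \<mu>. \<kappa> h \<le> max 0 J + J'" using j(2)
  proof eventually_elim
    case (elim h)
    show ?case unfolding \<kappa>_def using norm_triangle_ineq4[of "j h" "k h"] elim J'(2)[of h] by linarith
  qed
  have \<kappa>L: "AE h in \<mu>. h \<notin> L \<longrightarrow> \<kappa> h = 0" using offU
  proof eventually_elim
    case (elim h)
    show ?case
    proof
      assume "h \<notin> L"
      then have "h \<notin> U" using U(4) by blast
      then show "\<kappa> h = 0" using elim kU by (simp add: \<kappa>_def)
    qed
  qed
  have \<kappa>I: "(\<integral>\<^sup>+h. ennreal (\<kappa> h) \<partial>\<mu>) \<le> ennreal \<delta>"
    using nn_integral_cmod_diff_less[OF order_refl _ k(2)] \<delta> by (simp add: \<kappa>_def)
  show thesis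
  proof (rule that[OF k'])
    fix f :: "'g \<Rightarrow> 'b"
    assume f: "f \<in> Lp_functions (ennreal 1) \<mu>" and fr: "Lp_norm_on 1 \<mu> UNIV f \<le> ennreal r"
    have fsm: "strongly_measurable \<mu> f" using f Lp_iff[OF order_refl] by blast
    \<comment> \<open>With \<open>c = 0\<close> the translates themselves are estimated, and their
      norm is at most \<open>r\<close> for every \<open>h\<close>.\<close>
    have E: "Lp_norm_on 1 \<mu> S (\<lambda>x. 0 *\<^sub>R f x - f (- h + x)) \<le> ennreal r" for h
    proof -
      have "Lp_norm_on 1 \<mu> S (\<lambda>x. 0 *\<^sub>R f x - f (- h + x)) \<le>
        Lp_norm_on 1 \<mu> UNIV (\<lambda>x. 0 *\<^sub>R f x - f (- h + x))"
        by (rule Lp_norm_on_mono_set) auto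
      also have "\<dots> \<le> Lp_norm_on 1 \<mu> UNIV (\<lambda>x. f (- h + x))" by (rule Lp_norm_on_mono) auto
      also have "\<dots> = Lp_norm_on 1 \<mu> UNIV f" by (rule Lp_norm_translate[OF fsm])
      finally show ?thesis using fr by simp
    qed
    have e2: "0 < e / 2" and J0: "0 \<le> max 0 J + J'" using e J' by auto
    obtain m where m: "m \<in> borel_measurable (completion \<mu>)" "\<And>x. 0 \<le> m x"
      "\<And>x. x \<in> S \<Longrightarrow> (\<integral>\<^sup>+y. ennreal (\<kappa> (x + y) * norm (0 *\<^sub>R f x - f (- y))) \<partial>\<mu>) \<le> ennreal (m x)"
      "Lp_norm_on 1 \<mu> S m \<le> ennreal (\<delta> * r + e / 2)"
      by (rule convolution_Minkowski[where c=0, OF order_refl f S U(2) \<kappa>sm _ \<kappa>J \<kappa>L \<kappa>I less_imp_le[OF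
        \<delta>] J0 E r e2])
        (auto simp: \<kappa>_def)
    show "\<exists>m. m \<in> borel_measurable (completion \<mu>) \<and> (\<forall>x. 0 \<le> m x) \<and>
         (\<forall>x\<in>S. norm (convolve \<mu> j f x - convolve \<mu> k f x) \<le> m x) \<and> Lp_norm_on 1 \<mu> S m \<le> ennreal e"
    proof (intro exI[of _ m] conjI allI ballI m)
      show "Lp_norm_on 1 \<mu> S m \<le> ennreal e" using m(4) \<delta>r by (meson ennreal_leI order_trans)
      fix x assume x: "x \<in> S"
      have offj: "AE y in \<mu>. y \<notin> M \<longrightarrow> j (x + y) = 0"
        using AE_translate[OF offU, of x] by eventually_elim (use inM[OF x] U(4) in blast)
      have offk: "AE y in \<mu>. y \<notin> M \<longrightarrow> k (x + y) = 0" using kU inM[OF x] U(4) by (intro AE_I2) blast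
      have ffin: "(\<integral>\<^sup>+y\<in>M. ennreal (norm (f (- y))) \<partial>\<mu>) < \<infinity>"
        by (rule Lp_average_finite[OF order_refl M(1) f])
      have jJ: "AE h in \<mu>. cmod (j h) \<le> max 0 J" using j(2) by eventually_elim simp
      have hj: "has_bochner_int \<mu> (\<lambda>y. j (x + y) *\<^sub>C f (- y)) (convolve \<mu> j f x)"
      proof (rule convolve_has_bochner_int[OF j(1) fsm M(2) offj])
        have "(\<integral>\<^sup>+y. ennreal (cmod (j (x + y)) * norm (f (- y))) \<partial>\<mu>) \<le>
          ennreal (max 0 J) * (\<integral>\<^sup>+y\<in>M. ennreal (norm (f (- y))) \<partial>\<mu>)"
          using offj by (intro nn_integral_bounded_kernel_le[where \<kappa>="\<lambda>x. cmod (j x)"] fsm jJ M) auto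
        also have "\<dots> < \<infinity>" using ffin by (simp add: ennreal_mult_less_top)
        finally show "(\<integral>\<^sup>+y. ennreal (cmod (j (x + y)) * norm (f (- y))) \<partial>\<mu>) < \<infinity>" .
      qed
      have hk: "has_bochner_int \<mu> (\<lambda>y. k (x + y) *\<^sub>C f (- y)) (convolve \<mu> k f x)"
      proof (rule convolve_has_bochner_int[OF ksm fsm M(2) offk])
        have "(\<integral>\<^sup>+y. ennreal (cmod (k (x + y)) * norm (f (- y))) \<partial>\<mu>) \<le>
          ennreal J' * (\<integral>\<^sup>+y\<in>M. ennreal (norm (f (- y))) \<partial>\<mu>)"
          using offk J' by (intro nn_integral_bounded_kernel_le[where \<kappa>="\<lambda>x. cmod (k x)"] fsm M) auto
        also have "\<dots> < \<infinity>" using ffin by (simp add: ennreal_mult_less_top)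
        finally show "(\<integral>\<^sup>+y. ennreal (cmod (k (x + y)) * norm (f (- y))) \<partial>\<mu>) < \<infinity>" .
      qed
      have "ennreal (norm (convolve \<mu> j f x - convolve \<mu> k f x)) \<le> ennreal (m x)"
        using order_trans[OF convolve_diff_le[OF hj hk]] m(3)[OF x] by (simp add: \<kappa>_def)
      then show "norm (convolve \<mu> j f x - convolve \<mu> k f x) \<le> m x" using m(2)
        by (simp add: ennreal_le_iff)
    qed
  qed
qed

text \<open>For a bump \<open>\<kappa>\<close> of integral 1 supported in \<open>\<Theta>\<close>,
  the error of the convolution is the integral of
  \<open>\<kappa> (x + y) *\<^sub>R (f x - f (- y))\<close> over \<open>y\<close>. With
  \<open>h = x + y\<close> the difference is \<open>f x - translate h f x\<close>, and Minkowski's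
  inequality with \<open>c = 1\<close> applies.\<close>

lemma translation_imp_approximable:
  fixes \<Gamma> :: "('g \<Rightarrow> 'b::complex_banach) set set"
  assumes p: "1 \<le> p" and \<Gamma>: "\<Gamma> \<subseteq> Lp_space p \<mu>"
    and tr: "\<forall>\<epsilon>>0. \<exists>S \<Theta>. compact S \<and> 0 \<in> interior \<Theta> \<and>
         (\<forall>F\<in>\<Gamma>. \<forall>f\<in>F. Lp_norm_on p \<mu> (- S) f < ennreal \<epsilon>) \<and>
         (\<forall>F\<in>\<Gamma>. \<forall>f\<in>F. \<forall>h\<in>\<Theta>. Lp_norm_on p \<mu> S (\<lambda>x. translate h f x - f x) < ennreal \<epsilon>)"
  shows "approximable_by_convolution p \<Gamma>"
  unfolding approximable_by_convolution_def
proof (intro allI impI)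
  fix e :: real assume e: "0 < e"
  then have e2: "0 < e / 2" by simp
  obtain S \<Theta> where S: "compact S" and \<Theta>: "0 \<in> interior \<Theta>"
    and tail: "\<forall>F\<in>\<Gamma>. \<forall>f\<in>F. Lp_norm_on p \<mu> (- S) f < ennreal (e / 2)"
    and trans: "\<forall>F\<in>\<Gamma>. \<forall>f\<in>F. \<forall>h\<in>\<Theta>. Lp_norm_on p \<mu> S (\<lambda>x. translate h f x - f x) < ennreal (e / 2)"
    using tr[rule_format, OF e2] by (elim exE conjE)
  have z: "compact {0 :: 'g}" "open (interior \<Theta>)" "{0} \<subseteq> interior \<Theta>" using \<Theta> by auto
  obtain \<phi> :: "'g \<Rightarrow> real" and L where \<phi>: "continuous_on UNIV \<phi>" "\<And>x. 0 \<le> \<phi> x \<and> \<phi> x \<le> 1"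
    "\<And>x. x \<in> {0} \<Longrightarrow> \<phi> x = 1" "compact L" "L \<subseteq> interior \<Theta>" "\<And>x. x \<notin> L \<Longrightarrow> \<phi> x = 0"
    using urysohn_compact[OF z] by blast
  have Lb: "L \<in> sets \<mu>" using compact_borel[OF \<phi>(4)] by simp
  have \<phi>m[measurable]: "\<phi> \<in> borel_measurable borel" by (rule borel_measurable_continuous_onI[OF \<phi>(1)])
  \<comment> \<open>The integral is finite by compact support, and positive because the bump exceeds
    1/2 on an open set containing \<open>0\<close>, which has positive measure.\<close>
  obtain I where I: "(\<integral>\<^sup>+x. ennreal (\<phi> x) \<partial>\<mu>) = ennreal I" "I > 0"
  proof -
    have "(\<integral>\<^sup>+x. ennreal (\<phi> x) \<partial>\<mu>) \<le> (\<integral>\<^sup>+x. indicator L x \<partial>\<mu>)"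
      using \<phi>(2,6) by (intro nn_integral_mono) (auto split: split_indicator)
    also have "\<dots> < \<infinity>" using Lb emeasure_compact_finite[OF \<phi>(4)] by simp
    finally have fin: "(\<integral>\<^sup>+x. ennreal (\<phi> x) \<partial>\<mu>) < \<infinity>" .
    define V where "V = {x. \<phi> x > 1/2}"
    have V: "open V" "0 \<in> V"
      using open_vimage[OF open_greaterThan \<phi>(1), of "1/2"] \<phi>(3)[of 0]
        by (auto simp: V_def vimage_def greaterThan_def)
    have "0 < ennreal (1/2) * emeasure \<mu> V"
      unfolding ennreal_zero_less_mult_iff
    proof
      show "0 < ennreal (1/2)" by (subst ennreal_less_zero_iff) simp
      show "0 < emeasure \<mu> V" using V by (intro emeasure_open_pos) auto
    qed
    also have "\<dots> = (\<integral>\<^sup>+x. ennreal (1/2) * indicator V x \<partial>\<mu>)" using V(1)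
      by (simp add: nn_integral_cmult_indicator)
    also have "\<dots> \<le> (\<integral>\<^sup>+x. ennreal (\<phi> x) \<partial>\<mu>)"
    proof (rule nn_integral_mono)
      show "ennreal (1/2) * indicator V x \<le> ennreal (\<phi> x)" for x
      proof (cases "x \<in> V")
        case True
        then have "ennreal (1/2) \<le> ennreal (\<phi> x)" by (intro ennreal_leI) (simp add: V_def)
        then show ?thesis using True by (simp only: indicator_simps mult_1_right)
      qed simp
    qed
    finally have "0 < (\<integral>\<^sup>+x. ennreal (\<phi> x) \<partial>\<mu>)" .
    then show thesis using fin that by (cases "\<integral>\<^sup>+x. ennreal (\<phi> x) \<partial>\<mu>" rule: ennreal_cases) auto
  qed
  define \<kappa> where "\<kappa> x = \<phi> x / I" for x
  have \<kappa>m[measurable]: "\<kappa> \<in> borel_measurable borel" unfolding \<kappa>_def by measurable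
  have \<kappa>0: "0 \<le> \<kappa> x" for x using \<phi>(2)[of x] I(2) by (simp add: \<kappa>_def)
  have \<kappa>1: "(\<integral>\<^sup>+x. ennreal (\<kappa> x) \<partial>\<mu>) = 1"
  proof -
    have "(\<integral>\<^sup>+x. ennreal (\<kappa> x) \<partial>\<mu>) = (\<integral>\<^sup>+x. ennreal (1 / I) * ennreal (\<phi> x) \<partial>\<mu>)"
      using I(2) \<phi>(2) by (intro nn_integral_cong) (simp add: \<kappa>_def flip: ennreal_mult)
    also have "\<dots> = ennreal (1 / I) * ennreal I" by (subst nn_integral_cmult) (auto simp: I(1))
    also have "\<dots> = 1" using I(2) by (simp flip: ennreal_mult)
    finally show ?thesis .
  qed
  have \<kappa>sm: "strongly_measurable \<mu> \<kappa>" by (rule strongly_measurable_borel) simp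
  have \<kappa>c: "continuous_on UNIV \<kappa>" unfolding \<kappa>_def using \<phi>(1) I(2) by (intro continuous_intros) auto
  have \<kappa>L: "\<kappa> x = 0" if "x \<notin> L" for x using \<phi>(6)[OF that] by (simp add: \<kappa>_def)
  have \<kappa>J: "\<kappa> x \<le> 1 / I" for x using \<phi>(2)[of x] I(2) by (simp add: \<kappa>_def divide_right_mono)
  define j where "j x = complex_of_real (\<kappa> x)" for x
  have jc: "continuous_on UNIV j" unfolding j_def by (intro continuous_intros \<kappa>c)
  have jsm: "strongly_measurable \<mu> j" by (rule strongly_measurable_continuous[OF jc])
  have j: "j \<in> Cc UNIV" unfolding Cc_def using jc jsm \<kappa>L \<phi>(4) by (auto simp: j_def)
  obtain M where M: "compact M" "reflection_null M" and inM: "\<And>x y. x \<in> S \<Longrightarrow> x + y \<in> L \<Longrightarrow> y \<in> M"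
    using kernel_support[OF S \<phi>(4)] by blast
  show "\<exists>S. \<exists>j\<in>Cc UNIV. compact S \<and> (\<forall>F\<in>\<Gamma>. \<forall>f\<in>F. Lp_norm_on p \<mu> (- S) f < ennreal e \<and>
     Lp_dominated p S e (\<lambda>x. f x - convolve \<mu> j f x))"
  proof (intro exI[of _ S] bexI[OF _ j] conjI S ballI)
    fix F f assume Ff: "F \<in> \<Gamma>" "f \<in> F"
    have f: "f \<in> Lp_functions (ennreal p) \<mu>" using Ff \<Gamma> Lp_space_imp_function by blast
    have fsm: "strongly_measurable \<mu> f" using f p by (simp add: Lp_iff)
    have ee: "ennreal (e / 2) \<le> ennreal e" using e by (intro ennreal_leI) simp
    show "Lp_norm_on p \<mu> (- S) f < ennreal e" using tail Ff ee by (meson order_less_le_trans)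
    have E: "Lp_norm_on p \<mu> S (\<lambda>x. 1 *\<^sub>R f x - f (- h + x)) \<le> ennreal (e / 2)" if "h \<in> L" for h
    proof -
      have "h \<in> \<Theta>" using that \<phi>(5) interior_subset by blast
      then have "Lp_norm_on p \<mu> S (\<lambda>x. f (- h + x) - f x) < ennreal (e / 2)"
        using trans Ff by (auto simp: translate_def)
      then show ?thesis by (simp add: Lp_norm_on_minus_commute[of p \<mu> S f])
    qed
    have nums: "(0::real) \<le> 1" "0 \<le> 1 / I" "0 \<le> e / 2" using I(2) e by auto
    have \<kappa>1': "(\<integral>\<^sup>+h. ennreal (\<kappa> h) \<partial>\<mu>) \<le> ennreal 1" using \<kappa>1 by simp
    obtain m where m: "m \<in> borel_measurable (completion \<mu>)" "\<And>x. 0 \<le> m x"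
      "\<And>x. x \<in> S \<Longrightarrow> (\<integral>\<^sup>+y. ennreal (\<kappa> (x + y) * norm (1 *\<^sub>R f x - f (- y))) \<partial>\<mu>) \<le> ennreal (m x)"
      "Lp_norm_on p \<mu> S m \<le> ennreal (1 * (e / 2) + e / 2)"
      by (rule convolution_Minkowski[where c=1
        and J="1 / I", OF p f S \<phi>(4) \<kappa>sm \<kappa>0 _ _ \<kappa>1' nums(1,2) E nums(3) e2])
        (auto simp: \<kappa>J \<kappa>L)
    show "Lp_dominated p S e (\<lambda>x. f x - convolve \<mu> j f x)"
      unfolding Lp_dominated_def
    proof (intro exI[of _ "\<lambda>x. 0 :: 'b"] exI[of _ m] conjI allI ballI m)
      have "Lp_norm_on p \<mu> S (\<lambda>x. 0 :: 'b) \<le> ennreal 0" using p by (subst Lp_norm_on_le_iff) auto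
      then show "Lp_norm_on p \<mu> S (\<lambda>x. 0 :: 'b) \<le> ennreal e" by simp
      show "Lp_norm_on p \<mu> S m \<le> ennreal e" using m(4) by simp
      fix x assume x: "x \<in> S"
      have jM: "j (x + y) = 0" if "y \<notin> M" for y using inM[OF x] \<kappa>L that unfolding j_def by fastforce
      have hj: "has_bochner_int \<mu> (\<lambda>y. j (x + y) *\<^sub>C f (- y)) (convolve \<mu> j f x)"
      proof (rule convolve_has_bochner_int[OF jsm fsm M(2)])
        show "AE y in \<mu>. y \<notin> M \<longrightarrow> j (x + y) = 0" using jM by simp
        have "(\<integral>\<^sup>+y. ennreal (cmod (j (x + y)) * norm (f (- y))) \<partial>\<mu>) \<le>
          ennreal (1 / I) * (\<integral>\<^sup>+y\<in>M. ennreal (norm (f (- y))) \<partial>\<mu>)"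
          using jM \<kappa>J \<kappa>0 nums(2) by (intro nn_integral_bounded_kernel_le[where \<kappa>="\<lambda>x. cmod (j x)"]
            fsm M) (auto simp: j_def)
        also have "\<dots> < \<infinity>" using Lp_average_finite[OF p M(1) f] by (simp add: ennreal_mult_less_top)
        finally show "(\<integral>\<^sup>+y. ennreal (cmod (j (x + y)) * norm (f (- y))) \<partial>\<mu>) < \<infinity>" .
      qed
      have "(\<integral>\<^sup>+y. ennreal (\<kappa> (x + y)) \<partial>\<mu>) = ennreal 1"
        using \<kappa>1 nn_integral_translate[of "\<lambda>y. ennreal (\<kappa> y)" x] by (simp add: measurable_completion)
      then have hi: "has_bochner_integral \<mu> (\<lambda>y. \<kappa> (x + y)) 1"
        using \<kappa>0 by (intro has_bochner_integral_nn_integral) auto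
      from has_bochner_int_scaleR_const[OF has_bochner_integral_iff[THEN iffD1, OF hi,
        THEN conjunct1], of "f x"]
      have "has_bochner_int \<mu> (\<lambda>y. \<kappa> (x + y) *\<^sub>R f x) (f x)"
        using has_bochner_integral_integral_eq[OF hi] by simp
      from has_bochner_int_norm_le[OF has_bochner_int_diff[OF this hj]]
      have "ennreal (norm (f x - convolve \<mu> j f x)) \<le> (\<integral>\<^sup>+y. ennreal (norm (\<kappa> (x + y) *\<^sub>R f x - j (x +
        y) *\<^sub>C f (- y))) \<partial>\<mu>)" .
      also have "\<dots> = (\<integral>\<^sup>+y. ennreal (\<kappa> (x + y) * norm (1 *\<^sub>R f x - f (- y))) \<partial>\<mu>)"
      proof (rule nn_integral_cong)
        fix y
        have "\<kappa> (x + y) *\<^sub>R f x - j (x + y) *\<^sub>C f (- y) = \<kappa> (x + y) *\<^sub>R (f x - f (- y))"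
          by (simp add: j_def scaleC_of_real scaleR_diff_right)
        then show "ennreal (norm (\<kappa> (x + y) *\<^sub>R f x - j (x + y) *\<^sub>C f (- y))) = ennreal (\<kappa> (x +
          y) * norm (1 *\<^sub>R f x - f (- y)))"
          using \<kappa>0 by simp
      qed
      also have "\<dots> \<le> ennreal (m x)" by (rule m(3)[OF x])
      finally have "norm (f x - convolve \<mu> j f x) \<le> m x" using m(2) by (simp add: ennreal_le_iff)
      then show "norm (f x - convolve \<mu> j f x) \<le> norm (0 :: 'b) + m x" by simp
    qed
  qed
qed

text \<open>In \<open>ennreal\<close>, division of 1 by 0 gives \<open>top\<close> and division by
  \<open>top\<close> gives 0. The single equation therefore contains the case \<open>p = 1\<close>
  with infinite \<open>p'\<close> and excludes \<open>p' = 0\<close>.\<close>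

lemma conjugate_exponent_cases:
  assumes p: "1 \<le> p" and pp: "1 / ennreal p + 1 / p' = (1 :: ennreal)"
  obtains "p = 1" "p' = \<infinity>" | q where "1 < p" "1 < q" "1 / p + 1 / q = 1" "p' = ennreal q"
proof -
  have ip: "1 / ennreal p = ennreal (1 / p)" using p by (simp add: divide_ennreal flip: ennreal_1)
  show thesis
  proof (cases p' rule: ennreal_cases)
    case (real q)
    have q0: "q \<noteq> 0"
    proof
      assume "q = 0"
      then have "1 / p' = top" using real by (simp add: ennreal_divide_zero)
      then show False using pp by simp
    qed
    then have "1 / p' = ennreal (1 / q)" using real by (simp add: divide_ennreal flip: ennreal_1)
    then have "ennreal (1 / p + 1 / q) = ennreal 1" using pp ip p real q0 by simp
    then have sum: "1 / p + 1 / q = 1" using p real by (subst (asm) ennreal_inj) auto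
    have "1 / q > 0" using q0 real by simp
    then have "1 / p < 1" using sum by linarith
    then have p1: "1 < p" using p by (simp add: divide_less_eq)
    then have "1 / p > 0" by simp
    then have "1 / q < 1" using sum by linarith
    then have "1 < q" using real q0 by (simp add: divide_less_eq split: if_splits)
    then show thesis using that(2) p1 sum real by blast
  next
    case top
    then have "ennreal (1 / p) = ennreal 1" using pp ip by simp
    then have "p = 1" using p by (subst (asm) ennreal_inj) auto
    then show thesis using that(1) top by simp
  qed
qed

text \<open>The exponent decides how the kernel is made continuous. For \<open>p > 1\<close>, a set
  with a reflection bound must contain every \<open>y\<close> that the kernel meets: a compact set
  in the nonabelian case, thanks to the compact support, and the whole group in the abelian
  case.\<close>

lemma convolution_imp_approximable:
  fixes \<Gamma> :: "('g \<Rightarrow> 'b::complex_banach) set set"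
  assumes p: "1 \<le> p" and pp: "1 / ennreal p + 1 / p' = 1" and \<Gamma>: "\<Gamma> \<subseteq> Lp_space p \<mu>"
    and r: "\<And>F f. F \<in> \<Gamma> \<Longrightarrow> f \<in> F \<Longrightarrow> Lp_norm_on p \<mu> UNIV f \<le> ennreal r" "0 \<le> r"
    and cv: "\<forall>\<epsilon>>0. \<exists>S. \<exists>j \<in> Lp_functions p' \<mu>.
         compact S \<and>
         ((\<exists>x y :: 'g. x + y \<noteq> y + x) \<or> p = 1 \<longrightarrow>
            (\<exists>K. compact K \<and> (AE x in \<mu>. x \<notin> K \<longrightarrow> j x = 0))) \<and>
         (\<forall>F\<in>\<Gamma>. \<forall>f\<in>F. Lp_norm_on p \<mu> (- S) f < ennreal \<epsilon>) \<and>
         (\<forall>F\<in>\<Gamma>. \<forall>f\<in>F. Lp_norm_on p \<mu> S (\<lambda>x. f x - convolve \<mu> j f x) < ennreal \<epsilon>)"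
  shows "approximable_by_convolution p \<Gamma>"
  unfolding approximable_by_convolution_def
proof (intro allI impI)
  fix e :: real assume e: "0 < e"
  obtain S j where j: "j \<in> Lp_functions p' \<mu>" and S: "compact S"
    and supp: "(\<exists>x y :: 'g. x + y \<noteq> y + x) \<or> p = 1 \<longrightarrow> (\<exists>K. compact K \<and> (AE x in \<mu>. x \<notin> K \<longrightarrow> j x = 0))"
    and tail: "\<forall>F\<in>\<Gamma>. \<forall>f\<in>F. Lp_norm_on p \<mu> (- S) f < ennreal e"
    and conv: "\<forall>F\<in>\<Gamma>. \<forall>f\<in>F. Lp_norm_on p \<mu> S (\<lambda>x. f x - convolve \<mu> j f x) < ennreal e"
    using cv[rule_format, OF e] by (elim exE bexE conjE)
  have Sb: "S \<in> sets \<mu>" using compact_borel[OF S] by simp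
  have fL: "f \<in> Lp_functions (ennreal p) \<mu>" if "F \<in> \<Gamma>" "f \<in> F" for F f
    using that \<Gamma> Lp_space_imp_function by blast
  have "\<exists>k\<in>Cc UNIV. \<forall>f :: 'g \<Rightarrow> 'b. f \<in> Lp_functions (ennreal p) \<mu> \<and> Lp_norm_on p \<mu> UNIV f \<le> ennreal r \<longrightarrow>
     (\<exists>m. m \<in> borel_measurable (completion \<mu>) \<and> (\<forall>x. 0 \<le> m x) \<and>
         (\<forall>x\<in>S. norm (convolve \<mu> j f x - convolve \<mu> k f x) \<le> m x) \<and> Lp_norm_on p \<mu> S m \<le> ennreal e)"
  proof (rule conjugate_exponent_cases[OF p pp])
    assume p1: "p = 1" and "p' = \<infinity>"
    then obtain J where J: "strongly_measurable \<mu> j" "AE h in \<mu>. cmod (j h) \<le> J" using j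
      by (auto simp: Lp_functions_def)
    obtain K where K: "compact K" "AE x in \<mu>. x \<notin> K \<longrightarrow> j x = 0" using supp p1 by auto
    show ?thesis unfolding p1
      by (rule convolve_approx_one[OF J K S r(2) e]) blast
  next
    fix q assume pq: "1 < p" "1 < q" "1 / p + 1 / q = 1" and p': "p' = ennreal q"
    have jq: "j \<in> Lp_functions (ennreal q) \<mu>" using j p' by simp
    have "\<exists>U A C. open U \<and> (AE h in \<mu>. h \<notin> U \<longrightarrow> j h = 0) \<and> A \<in> sets borel \<and> reflection_bound A C \<and>
       (\<forall>x\<in>S. \<forall>y. x + y \<in> U \<longrightarrow> y \<in> A)"
    proof (cases "\<exists>x y :: 'g. x + y \<noteq> y + x")
      case True
      then obtain K where K: "compact K" "AE x in \<mu>. x \<notin> K \<longrightarrow> j x = 0" using supp by auto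
      obtain U L where U: "open U" "compact L" "K \<subseteq> U" "U \<subseteq> L"
        by (rule compact_open_neighbourhood[OF K(1)])
      obtain M where M: "compact M" "reflection_null M" "\<And>x y. x \<in> S \<Longrightarrow> x + y \<in> L \<Longrightarrow> y \<in> M"
        by (rule kernel_support[OF S U(2)]) (rule that)
      obtain C where "reflection_bound M C" using reflection_bound_compact[OF M(1)] by blast
      moreover have "AE h in \<mu>. h \<notin> U \<longrightarrow> j h = 0" using K(2) by eventually_elim (use U(3) in auto)
      moreover have "\<forall>x\<in>S. \<forall>y. x + y \<in> U \<longrightarrow> y \<in> M" using U(4) M(3) by blast
      ultimately show ?thesis using U(1) compact_borel[OF M(1)]
        by (intro exI[of _ U] exI[of _ M] exI[of _ C] conjI)
    next
      case False
      then obtain C where "reflection_bound UNIV C" using reflection_bound_abelian by blast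
      then show ?thesis by (intro exI[of _ UNIV] exI[of _ C]) auto
    qed
    then obtain U A C where U: "open U" "AE h in \<mu>. h \<notin> U \<longrightarrow> j h = 0"
      and A: "A \<in> sets borel" "reflection_bound A C" "\<forall>x\<in>S. \<forall>y. x + y \<in> U \<longrightarrow> y \<in> A" by (elim exE conjE)
    obtain d where d: "d > 0" "\<And>f :: 'g \<Rightarrow> real. (\<And>x. x \<in> S \<Longrightarrow> norm (f x) \<le> d) \<Longrightarrow> Lp_norm_on p \<mu> S f \<le>
      ennreal e"
      using Lp_norm_on_const_le[OF p Sb emeasure_compact_finite[OF S] e] by blast
    obtain k where k: "k \<in> Cc UNIV"
      "\<And>f :: 'g \<Rightarrow> 'b. \<And>x. f \<in> Lp_functions (ennreal p) \<mu> \<Longrightarrow> Lp_norm_on p \<mu> UNIV f \<le> ennreal r \<Longrightarrow> x \<in> S \<Longrightarrow>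
       norm (convolve \<mu> j f x - convolve \<mu> k f x) \<le> d"
      by (rule convolve_approx_conjugate[OF pq jq U A r(2) d(1)]) (rule that)
    \<comment> \<open>The error is uniform on \<open>S\<close> here, so a constant majorant
      suffices.\<close>
    show ?thesis
    proof (intro bexI[OF _ k(1)] allI impI)
      fix f :: "'g \<Rightarrow> 'b" assume f: "f \<in> Lp_functions (ennreal p) \<mu> \<and> Lp_norm_on p \<mu> UNIV f \<le> ennreal r"
      show "\<exists>m. m \<in> borel_measurable (completion \<mu>) \<and> (\<forall>x. 0 \<le> m x) \<and>
         (\<forall>x\<in>S. norm (convolve \<mu> j f x - convolve \<mu> k f x) \<le> m x) \<and> Lp_norm_on p \<mu> S m \<le> ennreal e"
        using k(2)[of f] f d by (intro exI[of _ "\<lambda>x. d"]) simp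
    qed
  qed
  then obtain k where k: "k \<in> Cc UNIV" "\<And>f :: 'g \<Rightarrow> 'b. f \<in> Lp_functions (ennreal p) \<mu> \<Longrightarrow>
    Lp_norm_on p \<mu> UNIV f \<le> ennreal r \<Longrightarrow>
     \<exists>m. m \<in> borel_measurable (completion \<mu>) \<and> (\<forall>x. 0 \<le> m x) \<and>
         (\<forall>x\<in>S. norm (convolve \<mu> j f x - convolve \<mu> k f x) \<le> m x) \<and> Lp_norm_on p \<mu> S m \<le>
           ennreal e" by blast
  show "\<exists>S. \<exists>j\<in>Cc UNIV. compact S \<and> (\<forall>F\<in>\<Gamma>. \<forall>f\<in>F. Lp_norm_on p \<mu> (- S) f < ennreal e \<and>
     Lp_dominated p S e (\<lambda>x. f x - convolve \<mu> j f x))"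
  proof (intro exI[of _ S] bexI[OF _ k(1)] conjI S ballI)
    fix F f assume Ff: "F \<in> \<Gamma>" "f \<in> F"
    show "Lp_norm_on p \<mu> (- S) f < ennreal e" using tail Ff by blast
    obtain m where m: "m \<in> borel_measurable (completion \<mu>)" "\<forall>x. 0 \<le> m x"
      "\<forall>x\<in>S. norm (convolve \<mu> j f x - convolve \<mu> k f x) \<le> m x" "Lp_norm_on p \<mu> S m \<le> ennreal e"
      using k(2)[OF fL[OF Ff] r(1)[OF Ff]] by (elim exE conjE)
    \<comment> \<open>The error given by (2a) takes the part without measurability, and the change
      of kernel the measurable part.\<close>
    show "Lp_dominated p S e (\<lambda>x. f x - convolve \<mu> k f x)"
      unfolding Lp_dominated_def
    proof (intro exI[of _ "\<lambda>x. f x - convolve \<mu> j f x"] exI[of _ m] conjI m ballI)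
      show "Lp_norm_on p \<mu> S (\<lambda>x. f x - convolve \<mu> j f x) \<le> ennreal e" using conv Ff
        by (intro less_imp_le) blast
      fix x assume x: "x \<in> S"
      have "norm (f x - convolve \<mu> k f x) \<le> norm (f x - convolve \<mu> j f x) +
        norm (convolve \<mu> j f x - convolve \<mu> k f x)"
        by (rule norm_diff_triangle_le[OF order_refl order_refl])
      then show "norm (f x - convolve \<mu> k f x) \<le> norm (f x - convolve \<mu> j f x) + m x" using m(3) x
        by fastforce
    qed
  qed
qed

end

theorem theorem8:
  fixes \<mu> :: "'g::{topological_group_add, t2_space} measure"
    and p :: real and p' :: ennreal
    and \<Gamma> :: "('g \<Rightarrow> 'b::complex_banach) set set"
  assumes "locally_compact_space (euclidean :: 'g topology)"
    and "left_haar_measure \<mu>"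
    and "1 \<le> p"
    and "1 / ennreal p + 1 / p' = 1"
    and "\<Gamma> \<subseteq> Lp_space p \<mu>"
    and "\<exists>C::real. \<forall>F\<in>\<Gamma>. \<forall>f\<in>F. Lp_norm_on p \<mu> UNIV f \<le> ennreal C"
  shows
    "compactin (Lp_topology p \<mu>) (Lp_topology p \<mu> closure_of \<Gamma>) \<longleftrightarrow>
     (\<forall>A\<in>sets \<mu>.
        emeasure \<mu> A < \<infinity> \<and>
        (\<forall>g \<in> (Lp_functions (ennreal p) \<mu> :: ('g \<Rightarrow> 'b) set).
           bochner_integrable_on \<mu> A (\<lambda>y. g (- y))) \<longrightarrow>
        compact (closure {bochner_integral_on \<mu> A (\<lambda>y. f (- y)) | F f. F \<in> \<Gamma> \<and> f \<in> F})) \<and>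
     ((\<forall>\<epsilon>>0. \<exists>S. \<exists>j \<in> Lp_functions p' \<mu>.
         compact S \<and>
         ((\<exists>x y :: 'g. x + y \<noteq> y + x) \<or> p = 1 \<longrightarrow>
            (\<exists>K. compact K \<and> (AE x in \<mu>. x \<notin> K \<longrightarrow> j x = 0))) \<and>
         (\<forall>F\<in>\<Gamma>. \<forall>f\<in>F. Lp_norm_on p \<mu> (- S) f < ennreal \<epsilon>) \<and>
         (\<forall>F\<in>\<Gamma>. \<forall>f\<in>F. Lp_norm_on p \<mu> S (\<lambda>x. f x - convolve \<mu> j f x) < ennreal \<epsilon>)) \<or>
      (\<forall>\<epsilon>>0. \<exists>S \<Theta>.
         compact S \<and> 0 \<in> interior \<Theta> \<and>
         (\<forall>F\<in>\<Gamma>. \<forall>f\<in>F. Lp_norm_on p \<mu> (- S) f < ennreal \<epsilon>) \<and>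
         (\<forall>F\<in>\<Gamma>. \<forall>f\<in>F. \<forall>h\<in>\<Theta>. Lp_norm_on p \<mu> S (\<lambda>x. translate h f x - f x) < ennreal \<epsilon>)))"
  (is "?compact \<longleftrightarrow> ?averages \<and> (?convolution \<or> ?translation)")
proof -
  interpret haar \<mu> by (unfold_locales) (rule assms(1), rule assms(2))
  obtain C :: real where C: "\<forall>F\<in>\<Gamma>. \<forall>f\<in>F. Lp_norm_on p \<mu> UNIV f \<le> ennreal C" using assms(6) by blast
  \<comment> \<open>The given bound may be negative, and \<open>ennreal\<close> then reads it as 0;
    the lemmas ask for a nonnegative number.\<close>
  have r: "Lp_norm_on p \<mu> UNIV f \<le> ennreal (max 0 C)" if "F \<in> \<Gamma>" "f \<in> F" for F f
    using C that by (metis ennreal_leI max.cobounded2 order_trans)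
  have tb: "?compact \<longleftrightarrow> Metric_space.mtotally_bounded (Lp_space p \<mu>) (Lp_dist p \<mu>) \<Gamma>"
    by (rule Lp_relatively_compact_iff[OF assms(3,5)])
  show ?thesis
  proof
    assume ?compact
    then have t: "Metric_space.mtotally_bounded (Lp_space p \<mu>) (Lp_dist p \<mu>) \<Gamma>" using tb by simp
    have ?averages
      using necessary_averages[OF assms(3,5) t] by (auto simp del: sets_haar simp: sets_haar[THEN arg_cong[where f="(\<in>) _"]])
    \<comment> \<open>Compactness is shown to imply (2b), which settles the disjunction; (2a) occurs
      only as a hypothesis.\<close>
    moreover have ?translation using necessary_translations[OF assms(3,5) t] by blast
    ultimately show "?averages \<and> (?convolution \<or> ?translation)" by blast
  next
    assume r2: "?averages \<and> (?convolution \<or> ?translation)"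
    have av: "averages_compact p \<Gamma>" unfolding averages_compact_def using r2 by (rule conjunct1)
    from r2 have "?convolution \<or> ?translation" by (rule conjunct2)
    then have "approximable_by_convolution p \<Gamma>"
    proof
      assume ?convolution
      from convolution_imp_approximable[OF assms(3,4,5) r max.cobounded1 this] show ?thesis .
    next
      assume ?translation
      then show ?thesis by (rule translation_imp_approximable[OF assms(3,5)])
    qed
    from sufficient_totally_bounded[OF assms(3,5) r max.cobounded1 av this] show ?compact using tb by simp
  qed
qed

end
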